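(* The sum of bilinear assignments problem (SOBLAP), i.e. the problem $$\operatorname*{arg\,max}_{\pi=\{P_1,\dots,P_{L-1}\}}\ \langle W_1^{(A)}, P_1 W_1^{(B)}\rangle_F + \langle W_2^{(A)}, P_2 W_2^{(B)} P_1^\top\rangle_F + \dots + \langle W_L^{(A)}, W_L^{(B)} P_{L-1}^\top\rangle_F$$ over permutation matrices $P_1,\dots,P_{L-1}$, is NP-hard and admits no polynomial-time constant-factor approximation scheme for $L>2$.
   Context: $L$ is the number of layers (weight matrices) of a multi-layer perceptron. $\Theta_A=\{W_1^{(A)},\dots,W_L^{(A)}\}$ and $\Theta_B=\{W_1^{(B)},\dots,W_L^{(B)}\}$ are the given real weight matrices (bias terms ignored) of two such networks $A$ and $B$ of the same architecture, so $W_\ell^{(A)}$ and $W_\ell^{(B)}$ have the same size for each $\ell$. $P_\ell$ ranges over the permutation matrices whose size is the number of rows of $W_\ell^{(B)}$; the general middle term of the objective, for $2\le\ell\le L-1$, is $\langle W_\ell^{(A)}, P_\ell W_\ell^{(B)} P_{\ell-1}^\top\rangle_F$. $\langle A,B\rangle_F=\sum_{i,j}A_{i,j}B_{i,j}$ is the Frobenius inner product of real matrices of the same size. *)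

theory Defs
  imports
    "Jordan_Normal_Form.Matrix"
    "HOL-Combinatorics.Permutations"
    "HOL-Computational_Algebra.Polynomial"
    Complex_Main
begin

section \<open>Multi-tape Turing machines and polynomial time\<close>

datatype move = MoveLeft | Stay | MoveRight

text \<open>
  States are numbers: 0 is the start state and the number of states itself serves as the
  halting state. Tape symbols are numbers: 0 is the blank, 1 and 2 are the bits.
\<close>

record tm =
  num_tapes :: nat
  num_states :: nat
  num_symbols :: nat
  transition :: "nat \<Rightarrow> nat list \<Rightarrow> nat \<times> (nat \<times> move) list"

definition wf_tm :: "tm \<Rightarrow> bool" where
  "wf_tm M \<longleftrightarrow>
     2 \<le> num_tapes M \<and> 0 < num_states M \<and> 3 \<le> num_symbols M \<and>
     (\<forall>q < num_states M. \<forall>rs. length rs = num_tapes M \<and> set rs \<subseteq> {..<num_symbols M} \<longrightarrow>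
        (case transition M q rs of (q', as) \<Rightarrow>
           q' \<le> num_states M \<and> length as = num_tapes M \<and> fst ` set as \<subseteq> {..<num_symbols M}))"

text \<open>A tape is a two-way infinite sequence of symbols together with the position of the head.\<close>

type_synonym tape = "(int \<Rightarrow> nat) \<times> int"
type_synonym config = "nat \<times> tape list"

fun tape_read :: "tape \<Rightarrow> nat" where
  "tape_read (t, p) = t p"

fun move_head :: "move \<Rightarrow> int \<Rightarrow> int" where
  "move_head MoveLeft p = p - 1"
| "move_head Stay p = p"
| "move_head MoveRight p = p + 1"

fun tape_act :: "nat \<times> move \<Rightarrow> tape \<Rightarrow> tape" where
  "tape_act (s, m) (t, p) = (t(p := s), move_head m p)"

fun tm_step :: "tm \<Rightarrow> config \<Rightarrow> config" where
  "tm_step M (q, ts) =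
     (if q < num_states M
      then (case transition M q (map tape_read ts) of (q', as) \<Rightarrow> (q', map2 tape_act as ts))
      else (q, ts))"

definition bit_symbol :: "bool \<Rightarrow> nat" where
  "bit_symbol b = (if b then 2 else 1)"

definition input_tape :: "bool list \<Rightarrow> tape" where
  "input_tape x =
     ((\<lambda>i. if 0 \<le> i \<and> nat i < length x then bit_symbol (x ! nat i) else 0), 0)"

definition init_config :: "tm \<Rightarrow> bool list \<Rightarrow> config" where
  "init_config M x = (0, input_tape x # replicate (num_tapes M - 1) (input_tape []))"

text \<open>
  The output is the maximal blank-free word that starts at cell 0 of the second tape; the rest of
  that tape and the other tapes may hold anything when the machine halts.
\<close>

definition tape_holds :: "tape \<Rightarrow> bool list \<Rightarrow> bool" where
  "tape_holds t y \<longleftrightarrow>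
     (\<forall>i < length y. fst t (int i) = bit_symbol (y ! i)) \<and> fst t (int (length y)) = 0"

text \<open>The halting configuration is a fixed point of the step function, so \<open>n\<close> is a time bound.\<close>

definition tm_computes_within :: "tm \<Rightarrow> bool list \<Rightarrow> bool list \<Rightarrow> nat \<Rightarrow> bool" where
  "tm_computes_within M x y n \<longleftrightarrow>
     (case (tm_step M ^^ n) (init_config M x) of (q, ts) \<Rightarrow>
        q = num_states M \<and> tape_holds (ts ! 1) y)"

definition FP :: "(bool list \<Rightarrow> bool list) set" where
  "FP = {f. \<exists>M (p :: nat poly). wf_tm M \<and>
              (\<forall>x. tm_computes_within M x (f x) (poly p (length x)))}"

definition PTIME :: "bool list set set" where
  "PTIME = {A. (\<lambda>x. [x \<in> A]) \<in> FP}"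


section \<open>Encodings\<close>

text \<open>Every bit is doubled and \<open>01\<close> marks the end, so the code words are prefix-free.\<close>

definition delimit :: "bool list \<Rightarrow> bool list" where
  "delimit x = concat (map (\<lambda>b. [b, b]) x) @ [False, True]"

definition enc_pair :: "bool list \<Rightarrow> bool list \<Rightarrow> bool list" where
  "enc_pair x y = delimit x @ y"

definition enc_list :: "('a \<Rightarrow> bool list) \<Rightarrow> 'a list \<Rightarrow> bool list" where
  "enc_list e xs = concat (map (\<lambda>x. delimit (e x)) xs)"

text \<open>Binary notation, least significant bit first.\<close>

fun enc_nat :: "nat \<Rightarrow> bool list" where
  "enc_nat n = (if n = 0 then [] else odd n # enc_nat (n div 2))"

declare enc_nat.simps [simp del]

definition enc_int :: "int \<Rightarrow> bool list" where
  "enc_int i = (i < 0) # enc_nat (nat \<bar>i\<bar>)"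

definition enc_rat :: "rat \<Rightarrow> bool list" where
  "enc_rat r = (case quotient_of r of (a, b) \<Rightarrow> enc_pair (enc_int a) (enc_int b))"

definition enc_mat :: "rat mat \<Rightarrow> bool list" where
  "enc_mat A = enc_list (enc_list enc_rat) (mat_to_list A)"

definition enc_mats :: "rat mat list \<Rightarrow> bool list" where
  "enc_mats = enc_list enc_mat"


section \<open>NP and NP-hardness\<close>

definition NPTIME :: "bool list set set" where
  "NPTIME = {A. \<exists>B \<in> PTIME. \<exists>p :: nat poly. \<forall>x.
       x \<in> A \<longleftrightarrow> (\<exists>y. length y \<le> poly p (length x) \<and> enc_pair x y \<in> B)}"

definition NP_hard :: "bool list set \<Rightarrow> bool" where
  "NP_hard B \<longleftrightarrow> (\<forall>A \<in> NPTIME. \<exists>f \<in> FP. \<forall>x. x \<in> A \<longleftrightarrow> f x \<in> B)"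

text \<open>
  A search problem is a set of pairs (instance, correct answer). It is NP-hard if every problem in
  NP is polynomial-time Turing reducible to it. Below the reduction makes exactly one query
  \<open>f x\<close>, and must work for every correct answer \<open>y\<close> to that query;
  this restricted form implies hardness under general Turing reductions.
\<close>

definition NP_hard_search :: "(bool list \<times> bool list) set \<Rightarrow> bool" where
  "NP_hard_search R \<longleftrightarrow>
     (\<forall>A \<in> NPTIME. \<exists>f \<in> FP. \<exists>B \<in> PTIME. \<forall>x.
        (\<exists>y. (f x, y) \<in> R) \<and>
        (\<forall>y. (f x, y) \<in> R \<longrightarrow> (x \<in> A \<longleftrightarrow> enc_pair x y \<in> B)))"


section \<open>Sum of bilinear assignments\<close>

definition frobenius :: "'a :: comm_ring_1 mat \<Rightarrow> 'a mat \<Rightarrow> 'a" where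
  "frobenius A B = (\<Sum>i < dim_row A. \<Sum>j < dim_col A. A $$ (i, j) * B $$ (i, j))"

definition perm_matrices :: "nat \<Rightarrow> 'a :: comm_ring_1 mat set" where
  "perm_matrices n = {mat n n (\<lambda>(i, j). if j = \<pi> i then 1 else 0) | \<pi>. \<pi> permutes {..<n}}"

text \<open>
  Lists count from 0: the weight matrix of layer \<open>l\<close> is entry \<open>l - 1\<close> of \<open>WA\<close> and \<open>WB\<close>, and the
  permutation matrix with index \<open>l\<close> is entry \<open>l - 1\<close> of \<open>Ps\<close>. The summation index below is
  therefore one less than the layer. The expression is meant for at least two layers.
\<close>

fun soblap_value :: "'a :: comm_ring_1 mat list \<times> 'a mat list \<Rightarrow> 'a mat list \<Rightarrow> 'a" where
  "soblap_value (WA, WB) Ps =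
     (let L = length WA in
        frobenius (WA ! 0) (Ps ! 0 * WB ! 0)
      + (\<Sum>k = 1..<L - 1. frobenius (WA ! k) (Ps ! k * WB ! k * transpose_mat (Ps ! (k - 1))))
      + frobenius (WA ! (L - 1)) (WB ! (L - 1) * transpose_mat (Ps ! (L - 2))))"

text \<open>
  \<open>d 0\<close> is the input width and \<open>d l\<close> the number of rows of the weight matrices of
  layer \<open>l\<close>.
\<close>

definition soblap_instances :: "nat \<Rightarrow> ('a :: comm_ring_1 mat list \<times> 'a mat list) set" where
  "soblap_instances L = {(WA, WB). length WA = L \<and> length WB = L \<and>
     (\<exists>d :: nat \<Rightarrow> nat. (\<forall>l \<le> L. 0 < d l) \<and>
        (\<forall>k < L. WA ! k \<in> carrier_mat (d (Suc k)) (d k) \<and> WB ! k \<in> carrier_mat (d (Suc k)) (d k)))}"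

fun soblap_solutions :: "'a :: comm_ring_1 mat list \<times> 'a mat list \<Rightarrow> 'a mat list set" where
  "soblap_solutions (WA, WB) = {Ps. length Ps = length WB - 1 \<and>
     (\<forall>k < length WB - 1. Ps ! k \<in> perm_matrices (dim_row (WB ! k)))}"

definition soblap_argmax :: "'a :: linordered_idom mat list \<times> 'a mat list \<Rightarrow> 'a mat list set" where
  "soblap_argmax I = {Ps. is_arg_max (soblap_value I) (\<lambda>Qs. Qs \<in> soblap_solutions I) Ps}"

definition soblap_opt :: "'a :: linordered_idom mat list \<times> 'a mat list \<Rightarrow> 'a" where
  "soblap_opt I = Max (soblap_value I ` soblap_solutions I)"


section \<open>SOBLAP as a computational problem\<close>

text \<open>As usual in the bit model, the weights of a problem instance are rational numbers.\<close>

fun enc_instance :: "rat mat list \<times> rat mat list \<Rightarrow> bool list" where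
  "enc_instance (WA, WB) = enc_pair (enc_mats WA) (enc_mats WB)"

definition SOBLAP_search :: "nat \<Rightarrow> (bool list \<times> bool list) set" where
  "SOBLAP_search L =
     {(enc_instance I, enc_mats Ps) | I Ps. I \<in> soblap_instances L \<and> Ps \<in> soblap_argmax I}"

definition SOBLAP_decision :: "nat \<Rightarrow> bool list set" where
  "SOBLAP_decision L =
     {enc_pair (enc_instance I) (enc_rat t) | I t. I \<in> soblap_instances L \<and>
        (\<exists>Ps \<in> soblap_solutions I. t \<le> soblap_value I Ps)}"

text \<open>
  The objective may be negative. The ratio is only required of instances with positive
  optimum, since for a negative optimum and \<open>c < 1\<close> the bound \<open>c * opt\<close> would exceed
  the optimum and no algorithm at all could meet it.
\<close>

definition SOBLAP_approximates :: "nat \<Rightarrow> real \<Rightarrow> (bool list \<Rightarrow> bool list) \<Rightarrow> bool" where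
  "SOBLAP_approximates L c alg \<longleftrightarrow>
     (\<forall>I \<in> soblap_instances L. \<exists>Ps \<in> soblap_solutions I.
        alg (enc_instance I) = enc_mats Ps \<and>
        (0 < soblap_opt I \<longrightarrow> c * of_rat (soblap_opt I) \<le> of_rat (soblap_value I Ps)))"

end

theory Submission
  imports Defs
begin

text \<open>
  The proof is a Cook-Levin construction aimed directly at SOBLAP. A decider for the certificates of
  an NP problem is turned into a program on stacks; its computations are the tilings of a grid of
  polynomial size that obey local constraints. With \<open>n\<close> the number of pairs of a cell and a tile,
  the linear term of the objective forces the permutation \<open>P\<^sub>1\<close> to choose one tile for every cell.
  In the bilinear term, \<open>P\<^sub>2\<close> can avoid all conflicts with \<open>P\<^sub>1\<close> only by choosing the same
  tiles, so that conflicts among the tiles chosen by \<open>P\<^sub>1\<close> itself are counted. Penalties equal to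
  the reward \<open>K\<close> make the value of every choice that violates a constraint nonpositive.

  An additional tile that may only be used everywhere or nowhere provides a solution of value 1,
  recognizable by the first entry of \<open>P\<^sub>1\<close>. Another solution reaches the value \<open>K\<close> if a
  certificate exists; otherwise all others have nonpositive value. So the first entry of \<open>P\<^sub>1\<close> in any
  optimal solution, or in any solution within a factor \<open>c > 1 / K\<close> of the optimum, decides the problem.

  Polynomial time is handled through the stack programs: they can simulate and be simulated by
  Turing machines, which gives closure of \<open>FP\<close> under composition and allows writing the
  reduction as a program of nested loops that print the matrices.
\<close>

section \<open>Structured programs on stacks\<close>

text \<open>No term of the objective multiplies a permutation with itself, so a constraint between
  two tiles chosen by \<open>P\<^sub>1\<close> needs a second permutation as a copy;
  \<open>L > 2\<close> provides it. The copying cannot be enforced cell by cell: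
  \<open>P\<^sub>2\<close> is penalized only through \<open>P\<^sub>1\<close>, and the choice it
  makes for one cell may fall into the block of another. Counting helps: agreement on tiles together
  with injectivity turns this displacement into a bijection of the cells, so every choice of
  \<open>P\<^sub>1\<close> still meets every other one.

  The escape of value 1 has two purposes. It keeps the optimum positive, so that the approximation
  guarantee applies to every instance produced, and it turns the answer into one bit at a fixed
  position of the output, so that no program has to evaluate the objective.

  Computations are tiled for stacks rather than tapes because all actions happen at the tops, in a
  fixed column of the grid, and a deeper symbol changes only in dependence on its two neighbours. No
  head position has to be encoded.\<close>

datatype op = Keep | Pop | Push nat | Put nat

fun apply_op :: "op \<Rightarrow> nat list \<Rightarrow> nat list" where
  "apply_op Keep xs = xs"
| "apply_op Pop xs = tl xs"
| "apply_op (Push a) xs = a # xs"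
| "apply_op (Put a) xs = a # tl xs"

text \<open>Stacks hold nonzero symbols, so 0 can stand for the top of an empty stack.\<close>

definition cont :: "nat list \<Rightarrow> nat \<Rightarrow> nat" where
  "cont xs i = (if i < length xs then xs ! i else 0)"

type_synonym store = "nat \<Rightarrow> nat list"

definition tops :: "store \<Rightarrow> nat \<Rightarrow> nat" where
  "tops s v = cont (s v) 0"

text \<open>An action works on all stacks at once and sees only their tops, like a transition of a
  Turing machine. Actions and tests are arbitrary functions, so no language of expressions is
  needed.\<close>

datatype com =
    Act "(nat \<Rightarrow> nat) \<Rightarrow> nat \<Rightarrow> op"
  | Seq com com (infixr ";;" 60)
  | Whl "(nat \<Rightarrow> nat) \<Rightarrow> bool" com

text \<open>
  The control state of a running program is the list of commands still to be executed; only
  finitely many such lists are reachable, so they can serve as the states of a Turing machine.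
\<close>

fun ctl :: "com list \<Rightarrow> (nat \<Rightarrow> nat) \<Rightarrow> com list" where
  "ctl [] \<tau> = []"
| "ctl (Act F # K) \<tau> = K"
| "ctl (Seq a b # K) \<tau> = a # b # K"
| "ctl (Whl P a # K) \<tau> = (if P \<tau> then a # Whl P a # K else K)"

fun ops :: "com list \<Rightarrow> (nat \<Rightarrow> nat) \<Rightarrow> nat \<Rightarrow> op" where
  "ops (Act F # K) \<tau> = F \<tau>"
| "ops _ \<tau> = (\<lambda>v. Keep)"

definition cstep :: "com list \<times> store \<Rightarrow> com list \<times> store" where
  "cstep = (\<lambda>(K, s). (ctl K (tops s), \<lambda>v. apply_op (ops K (tops s) v) (s v)))"

lemma cstep_pair: "cstep (K, s) = (ctl K (tops s), \<lambda>v. apply_op (ops K (tops s) v) (s v))"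
  by (simp add: cstep_def)

text \<open>Quantifying over the continuation \<open>K\<close> makes the notion compositional;
  \<open>t\<close> is only an upper bound, so that time bounds can be rounded up freely.\<close>

definition runs :: "com \<Rightarrow> store \<Rightarrow> store \<Rightarrow> nat \<Rightarrow> bool" where
  "runs c s s' t \<longleftrightarrow> (\<forall>K. \<exists>t' \<le> t. (cstep ^^ t') (c # K, s) = (K, s'))"

lemma cont_Nil [simp]: "cont [] i = 0"
  by (simp add: cont_def)

lemma cont_Cons [simp]: "cont (x # xs) 0 = x" "cont (x # xs) (Suc i) = cont xs i"
  by (simp_all add: cont_def)

lemma cont_tl: "cont (tl xs) i = cont xs (Suc i)"
  by (cases xs) auto

lemma cont_beyond: "length xs \<le> i \<Longrightarrow> cont xs i = 0"
  by (simp add: cont_def)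

lemma cont_eq_0_iff: "0 \<notin> set xs \<Longrightarrow> cont xs i = 0 \<longleftrightarrow> length xs \<le> i"
  by (metis cont_def linorder_not_le nth_mem)

lemma cont_less: "set xs \<subseteq> {0<..<S} \<Longrightarrow> 0 < S \<Longrightarrow> cont xs i < S"
  by (auto simp: cont_def dest: nth_mem)

lemma cstep_halted [simp]: "(cstep ^^ n) ([], s) = ([], s)"
  by (induction n) (simp_all add: cstep_def)

lemma runsI: "(\<And>K. \<exists>t' \<le> t. (cstep ^^ t') (c # K, s) = (K, s')) \<Longrightarrow> runs c s s' t"
  by (simp add: runs_def)

lemma runs_weaken: "runs c s s' t \<Longrightarrow> t \<le> t' \<Longrightarrow> runs c s s' t'"
  unfolding runs_def by (meson order_trans)

lemma runs_step:
  assumes "\<And>K. \<exists>t' \<le> t. (cstep ^^ t') (cstep (c # K, s)) = (K, s')"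
  shows "runs c s s' (Suc t)"
proof (rule runsI)
  fix K
  obtain t' where "t' \<le> t" "(cstep ^^ t') (cstep (c # K, s)) = (K, s')"
    using assms by blast
  then show "\<exists>t' \<le> Suc t. (cstep ^^ t') (c # K, s) = (K, s')"
    by (intro exI[of _ "Suc t'"]) (simp add: funpow_swap1)
qed

lemma runs_Act: "s' = (\<lambda>v. apply_op (F (tops s) v) (s v)) \<Longrightarrow> runs (Act F) s s' 1"
  unfolding runs_def by (intro allI exI[of _ 1]) (simp add: cstep_def)

lemma runs_append:
  assumes "runs a s s1 t1" "runs b s1 s2 t2"
  shows "\<exists>t' \<le> t1 + t2. (cstep ^^ t') (a # b # K, s) = (K, s2)"
proof -
  obtain u1 where u1: "u1 \<le> t1" "(cstep ^^ u1) (a # b # K, s) = (b # K, s1)"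
    using assms(1) unfolding runs_def by blast
  obtain u2 where u2: "u2 \<le> t2" "(cstep ^^ u2) (b # K, s1) = (K, s2)"
    using assms(2) unfolding runs_def by blast
  have "(cstep ^^ (u2 + u1)) (a # b # K, s) = (K, s2)"
    by (simp only: funpow_add o_apply u1 u2)
  with u1 u2 show ?thesis
    by (intro exI[of _ "u2 + u1"]) simp
qed

lemma runs_Seq:
  assumes "runs a s s1 t1" "runs b s1 s2 t2"
  shows "runs (a ;; b) s s2 (Suc (t1 + t2))"
  by (rule runs_step) (use runs_append[OF assms] in \<open>simp add: cstep_def\<close>)

lemma runs_Whl_False: "\<not> P (tops s) \<Longrightarrow> runs (Whl P c) s s 1"
  unfolding runs_def by (intro allI exI[of _ 1]) (simp add: cstep_def)

lemma runs_Whl_True: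
  assumes "P (tops s)" "runs c s s1 t1" "runs (Whl P c) s1 s2 t2"
  shows "runs (Whl P c) s s2 (Suc (t1 + t2))"
  by (rule runs_step) (use runs_append[OF assms(2,3)] assms(1) in \<open>simp add: cstep_def\<close>)

section \<open>Boundedness of symbols and finiteness of control\<close>

fun op_bounded :: "nat \<Rightarrow> op \<Rightarrow> bool" where
  "op_bounded S (Push a) \<longleftrightarrow> 0 < a \<and> a < S"
| "op_bounded S (Put a) \<longleftrightarrow> 0 < a \<and> a < S"
| "op_bounded S _ \<longleftrightarrow> True"

fun bounded :: "nat \<Rightarrow> nat \<Rightarrow> com \<Rightarrow> bool" where
  "bounded k S (Act F) \<longleftrightarrow> (\<forall>\<tau> v. op_bounded S (F \<tau> v) \<and> (k \<le> v \<longrightarrow> F \<tau> v = Keep))"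
| "bounded k S (a ;; b) \<longleftrightarrow> bounded k S a \<and> bounded k S b"
| "bounded k S (Whl P a) \<longleftrightarrow> bounded k S a"

lemma op_bounded_mono: "op_bounded S x \<Longrightarrow> S \<le> S' \<Longrightarrow> op_bounded S' x"
  by (cases x) auto

lemma bounded_mono: "bounded k S c \<Longrightarrow> k \<le> k' \<Longrightarrow> S \<le> S' \<Longrightarrow> bounded k' S' c"
  by (induction c) (auto intro: op_bounded_mono)

text \<open>The control lists that occur while \<open>c\<close> runs in front of \<open>K\<close>.
  The body of a loop returns to the list headed by the loop itself, which keeps the set
  finite.\<close>

fun reach :: "com \<Rightarrow> com list \<Rightarrow> com list set" where
  "reach (Act F) K = {Act F # K}"
| "reach (a ;; b) K = insert ((a ;; b) # K) (reach a (b # K) \<union> reach b K)"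
| "reach (Whl P a) K = insert (Whl P a # K) (reach a (Whl P a # K))"

lemma reach_start: "c # K \<in> reach c K"
  by (cases c) auto

lemma finite_reach: "finite (reach c K)"
  by (induction c arbitrary: K) auto

lemma reach_nonempty: "K' \<in> reach c K \<Longrightarrow> K' \<noteq> []"
  by (induction c arbitrary: K) auto

lemma ctl_reach: "K' \<in> reach c K \<Longrightarrow> ctl K' \<tau> \<in> insert K (reach c K)"
proof (induction c arbitrary: K)
  case (Seq a b)
  then show ?case using reach_start[of a "b # K"] reach_start[of b K] by fastforce
next
  case (Whl P a)
  then show ?case using reach_start[of a "Whl P a # K"] by (auto split: if_splits)
qed auto

lemma ops_reach:
  "K' \<in> reach c K \<Longrightarrow> bounded k S c \<Longrightarrow>
    op_bounded S (ops K' \<tau> v) \<and> (k \<le> v \<longrightarrow> ops K' \<tau> v = Keep)"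
  by (induction c arbitrary: K) auto

definition store_ok :: "nat \<Rightarrow> nat \<Rightarrow> store \<Rightarrow> bool" where
  "store_ok k S s \<longleftrightarrow> (\<forall>v. set (s v) \<subseteq> {0<..<S}) \<and> (\<forall>v \<ge> k. s v = [])"

lemma set_apply_op: "op_bounded S x \<Longrightarrow> set xs \<subseteq> {0<..<S} \<Longrightarrow> set (apply_op x xs) \<subseteq> {0<..<S}"
  by (cases x; cases xs) auto

lemma length_apply_op: "length (apply_op x xs) \<le> Suc (length xs)"
  by (cases x) auto

definition init_store :: "bool list \<Rightarrow> store" where
  "init_store x = (\<lambda>_. [])(0 := map bit_symbol x)"

lemma store_ok_init: "3 \<le> S \<Longrightarrow> 0 < k \<Longrightarrow> store_ok k S (init_store x)"
  by (auto simp: store_ok_def init_store_def bit_symbol_def)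

lemma cstep_invariant:
  assumes b: "bounded k S c" and ok: "store_ok k S s"
  shows "fst ((cstep ^^ t) ([c], s)) \<in> insert [] (reach c []) \<and>
    store_ok k S (snd ((cstep ^^ t) ([c], s))) \<and>
    (\<forall>v. length (snd ((cstep ^^ t) ([c], s)) v) \<le> length (s v) + t)"
proof (induction t)
  case 0
  then show ?case using reach_start ok by simp
next
  case (Suc t)
  obtain K s1 where Ks: "(cstep ^^ t) ([c], s) = (K, s1)" by fastforce
  have K: "K \<in> insert [] (reach c [])" and ok1: "store_ok k S s1"
    and len: "\<And>v. length (s1 v) \<le> length (s v) + t" using Suc Ks by auto
  have next_eq: "(cstep ^^ Suc t) ([c], s) = (ctl K (tops s1), \<lambda>v. apply_op (ops K (tops s1) v) (s1 v))"
    using Ks by (simp add: cstep_pair)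
  have bd: "op_bounded S (ops K \<tau> v) \<and> (k \<le> v \<longrightarrow> ops K \<tau> v = Keep)" for \<tau> v
    using K ops_reach[OF _ b] by (cases "K = []") auto
  have 1: "ctl K (tops s1) \<in> insert [] (reach c [])"
    using K ctl_reach by (cases "K = []") auto
  have 2: "store_ok k S (\<lambda>v. apply_op (ops K (tops s1) v) (s1 v))"
    using ok1 bd set_apply_op by (simp add: store_ok_def)
  have 3: "length (apply_op (ops K (tops s1) v) (s1 v)) \<le> length (s v) + Suc t" for v
    using length_apply_op[of "ops K (tops s1) v" "s1 v"] len[of v] by linarith
  show ?case unfolding next_eq using 1 2 3 by simp
qed

text \<open>The output word is reversed because it is produced by pushes: its first bit lies at the
  bottom of stack 1, which the compiled machine keeps in cell 0 of the output tape.\<close>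

definition com_computes :: "nat \<Rightarrow> nat \<Rightarrow> com \<Rightarrow> (bool list \<Rightarrow> bool list) \<Rightarrow> nat poly \<Rightarrow> bool" where
  "com_computes k S c f p \<longleftrightarrow> 2 \<le> k \<and> 3 \<le> S \<and> bounded k S c \<and>
     (\<forall>x. \<exists>s'. runs c (init_store x) s' (poly p (length x)) \<and> s' 1 = rev (map bit_symbol (f x)))"

section \<open>Compiling programs to Turing machines\<close>

text \<open>\<open>dir v\<close> points from the top of stack \<open>v\<close> towards its
  bottom.\<close>

definition dir :: "nat \<Rightarrow> int" where
  "dir v = (if v = 0 then 1 else - 1)"

definition down :: "nat \<Rightarrow> move" where
  "down v = (if v = 0 then MoveRight else MoveLeft)"

definition up :: "nat \<Rightarrow> move" where
  "up v = (if v = 0 then MoveLeft else MoveRight)"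

text \<open>
  The head stands on the top of the stack. The input stack 0 grows to the left; the other stacks
  grow to the right with their bottom in cell 0, as the output convention demands, so their head
  is in cell \<open>-1\<close> while they are empty.
\<close>

definition rep :: "nat \<Rightarrow> tape \<Rightarrow> nat list \<Rightarrow> bool" where
  "rep v T xs \<longleftrightarrow>
     (\<forall>q. fst T q = (if dir v * (q - snd T) < 0 then 0 else cont xs (nat (dir v * (q - snd T))))) \<and>
     (v \<noteq> 0 \<longrightarrow> snd T = int (length xs) - 1)"

text \<open>A machine writes before it moves, so a new top cannot be written in the step that moves
  up to its cell. Every operation is therefore split: \<open>act1\<close> moves, and
  \<open>act2\<close> writes the symbol left over by \<open>pending\<close>. On an empty stack
  \<open>Pop\<close> must not move, or the head would leave its position below the bottom.\<close>

fun act1 :: "nat \<Rightarrow> op \<Rightarrow> nat \<Rightarrow> nat \<times> move" where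
  "act1 v Keep a = (a, Stay)"
| "act1 v Pop a = (if a = 0 then (0, Stay) else (0, down v))"
| "act1 v (Push b) a = (a, up v)"
| "act1 v (Put b) a = (if a = 0 then (0, up v) else (b, Stay))"

fun pending :: "op \<Rightarrow> nat \<Rightarrow> nat" where
  "pending (Push b) a = b"
| "pending (Put b) a = (if a = 0 then b else 0)"
| "pending _ a = 0"

lemma pending_less: "op_bounded S x \<Longrightarrow> 0 < S \<Longrightarrow> pending x a < S"
  by (cases x) auto

definition act2 :: "nat \<Rightarrow> nat \<Rightarrow> nat \<times> move" where
  "act2 b a = (if b = 0 then a else b, Stay)"

lemma rep_read: "rep v T xs \<Longrightarrow> tape_read T = cont xs 0"
  by (cases T) (auto simp: rep_def)

lemma rep_grow:
  assumes "rep v (t, p) xs" and q: "q = p - dir v"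
  shows "rep v (t(q := a), q) (a # xs)"
proof -
  have *: "t x = (if dir v * (x - p) < 0 then 0 else cont xs (nat (dir v * (x - p))))" for x
    using assms by (simp add: rep_def)
  have "(t(q := a)) x = (if dir v * (x - q) < 0 then 0 else cont (a # xs) (nat (dir v * (x - q))))" for x
  proof (cases "x = q")
    case True
    then show ?thesis by simp
  next
    case False
    have eq: "dir v * (x - q) = dir v * (x - p) + 1"
      by (simp add: q dir_def)
    have ne: "dir v * (x - q) \<noteq> 0" using False by (simp add: dir_def)
    show ?thesis
    proof (cases "dir v * (x - p) < 0")
      case True
      then show ?thesis using False eq ne * by auto
    next
      case F2: False
      then have "nat (dir v * (x - q)) = Suc (nat (dir v * (x - p)))" unfolding eq by linarith
      then show ?thesis using False F2 eq * by (simp add: cont_def)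
    qed
  qed
  moreover have "v \<noteq> 0 \<longrightarrow> q = int (length (a # xs)) - 1"
    using assms by (auto simp: rep_def dir_def)
  ultimately show ?thesis by (simp add: rep_def)
qed

lemma rep_shrink:
  assumes "rep v (t, p) (x # xs)" and q: "q = p + dir v"
  shows "rep v (t(p := 0), q) xs"
proof -
  have *: "t y = (if dir v * (y - p) < 0 then 0 else cont (x # xs) (nat (dir v * (y - p))))" for y
    using assms by (simp add: rep_def)
  have "(t(p := 0)) y = (if dir v * (y - q) < 0 then 0 else cont xs (nat (dir v * (y - q))))" for y
  proof -
    have eq: "dir v * (y - p) = dir v * (y - q) + 1"
      by (simp add: q dir_def)
    show ?thesis
    proof (cases "y = p")
      case True
      then show ?thesis using eq by simp
    next
      case False
      then have ne: "dir v * (y - p) \<noteq> 0" by (simp add: dir_def)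
      show ?thesis
      proof (cases "dir v * (y - q) < 0")
        case True
        then have "dir v * (y - p) < 0" using eq ne by linarith
        then show ?thesis using False True * by simp
      next
        case F2: False
        then have "nat (dir v * (y - p)) = Suc (nat (dir v * (y - q)))" unfolding eq by linarith
        then show ?thesis using False F2 eq * by (simp add: cont_def)
      qed
    qed
  qed
  moreover have "v \<noteq> 0 \<longrightarrow> q = int (length xs) - 1"
    using assms by (auto simp: rep_def dir_def)
  ultimately show ?thesis by (simp add: rep_def)
qed

lemma rep_put:
  assumes "rep v (t, p) (x # xs)"
  shows "rep v (t(p := a), p) (a # xs)"
proof -
  have *: "t y = (if dir v * (y - p) < 0 then 0 else cont (x # xs) (nat (dir v * (y - p))))" for y
    using assms by (simp add: rep_def)
  have "(t(p := a)) y = (if dir v * (y - p) < 0 then 0 else cont (a # xs) (nat (dir v * (y - p))))" for y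
  proof (cases "y = p")
    case False
    then have ne: "dir v * (y - p) \<noteq> 0" by (simp add: dir_def)
    show ?thesis
    proof (cases "dir v * (y - p) < 0")
      case True
      then show ?thesis using False * by simp
    next
      case F2: False
      then obtain j where "nat (dir v * (y - p)) = Suc j" using ne
        by (metis int_nat_eq less_imp_Suc_add linorder_neqE_nat not_less_zero of_nat_0 linorder_not_less)
      then show ?thesis using False F2 * by simp
    qed
  qed simp
  then show ?thesis using assms by (auto simp: rep_def)
qed

lemma rep_holds:
  assumes "rep v T (rev (map bit_symbol y))" "v \<noteq> 0"
  shows "tape_holds T y"
proof -
  have p: "snd T = int (length y) - 1" using assms by (simp add: rep_def)
  have *: "fst T q = (if snd T < q then 0 else cont (rev (map bit_symbol y)) (nat (snd T - q)))" for q
    using assms by (simp add: rep_def dir_def)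
  have "fst T (int i) = bit_symbol (y ! i)" if "i < length y" for i
  proof -
    have "nat (snd T - int i) = length y - Suc i" using that p by simp
    then show ?thesis using that p by (simp add: * cont_def rev_nth)
  qed
  moreover have "fst T (int (length y)) = 0" by (simp add: * p)
  ultimately show ?thesis by (simp add: tape_holds_def)
qed

lemma move_up: "move_head (up v) p = p - dir v"
  and move_down: "move_head (down v) p = p + dir v"
  by (simp_all add: up_def down_def dir_def)

lemma rep_op:
  assumes rep: "rep v T xs" and nz: "0 \<notin> set xs" and x: "op_bounded S x"
    and T1: "T1 = tape_act (act1 v x (tape_read T)) T"
    and T2: "T2 = tape_act (act2 (pending x (tape_read T)) (tape_read T1)) T1"
  shows "rep v T2 (apply_op x xs)"
proof -
  obtain t p where T: "T = (t, p)" by fastforce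
  have rd: "t p = cont xs 0" using rep_read[OF rep] T by simp
  have triv: "t(p := t p) = t" by simp
  have zero: "cont xs 0 = 0 \<longleftrightarrow> xs = []" using cont_eq_0_iff[OF nz, of 0] by simp
  show ?thesis
  proof (cases x)
    case Keep
    then show ?thesis using rep by (simp add: T1 T2 T act2_def)
  next
    case Pop
    show ?thesis
    proof (cases xs)
      case Nil
      then have "t p = 0" using rd by simp
      then show ?thesis using Pop rep Nil triv by (simp add: T1 T2 T act2_def)
    next
      case (Cons y ys)
      then have "t p \<noteq> 0" using rd zero by simp
      moreover have "u(r := u r) = u" for u :: "int \<Rightarrow> nat" and r by simp
      ultimately show ?thesis using Pop Cons rep rep_shrink[OF rep[unfolded T Cons]]
        by (simp add: T1 T2 T act2_def move_down del: fun_upd_apply)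
    qed
  next
    case (Push b)
    then show ?thesis using rep_grow[OF rep[unfolded T]] x
      by (simp add: T1 T2 T act2_def move_up)
  next
    case (Put b)
    show ?thesis
    proof (cases xs)
      case Nil
      then have "t p = 0" using rd by simp
      moreover from this have "t(p := 0) = t" by (metis fun_upd_triv)
      ultimately show ?thesis using Put Nil rep_grow[OF rep[unfolded T]] x
        by (simp add: T1 T2 T act2_def move_up)
    next
      case (Cons y ys)
      then have "t p \<noteq> 0" using rd zero by simp
      then show ?thesis using Put Cons rep_put[OF rep[unfolded T Cons]] x
        by (simp add: T1 T2 T act2_def)
    qed
  qed
qed

text \<open>\<open>Start\<close> brings the heads of the empty stacks to cell -1;
  \<open>Work\<close> and \<open>Write\<close> are the two halves of a program step. Since the
  second half no longer sees the old tops, \<open>Write\<close> carries the symbols to be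
  written.\<close>

datatype ctrl = Start | Work "com list" | Write "com list" "nat \<Rightarrow> nat"

definition view :: "nat \<Rightarrow> nat list \<Rightarrow> nat \<Rightarrow> nat" where
  "view k rs v = (if v < k then rs ! v else 0)"

fun tr :: "com \<Rightarrow> nat \<Rightarrow> ctrl \<Rightarrow> nat list \<Rightarrow> ctrl \<times> (nat \<times> move) list" where
  "tr c k Start rs = (Work [c], map (\<lambda>v. (rs ! v, if v = 0 then Stay else MoveLeft)) [0..<k])"
| "tr c k (Work K) rs =
     (Write (ctl K (view k rs)) (\<lambda>v. pending (ops K (view k rs) v) (view k rs v)),
      map (\<lambda>v. act1 v (ops K (view k rs) v) (rs ! v)) [0..<k])"
| "tr c k (Write K p) rs = (Work K, map (\<lambda>v. act2 (p v) (rs ! v)) [0..<k])"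

definition tuples :: "nat \<Rightarrow> nat \<Rightarrow> (nat \<Rightarrow> nat) set" where
  "tuples k S = {f. (\<forall>v. f v < S) \<and> (\<forall>v \<ge> k. f v = 0)}"

lemma finite_tuples: "finite (tuples k S)"
proof -
  have "tuples k S \<subseteq> {f. \<forall>x. (x \<in> {..<k} \<longrightarrow> f x \<in> {..<S}) \<and> (x \<notin> {..<k} \<longrightarrow> f x = 0)}"
    by (auto simp: tuples_def)
  then show ?thesis
    by (rule finite_subset) (rule finite_set_of_finite_funs; simp)
qed

definition ctrls :: "com \<Rightarrow> nat \<Rightarrow> nat \<Rightarrow> ctrl set" where
  "ctrls c k S = insert Start (Work ` reach c [] \<union> (\<lambda>(K, p). Write K p) ` (insert [] (reach c []) \<times> tuples k S))"

lemma finite_ctrls: "finite (ctrls c k S)"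
  by (simp add: ctrls_def finite_reach finite_tuples)

lemma halt_notin_ctrls: "Work [] \<notin> ctrls c k S"
  using reach_nonempty by (auto simp: ctrls_def)

lemma tr_closed:
  assumes b: "bounded k S c" and S: "0 < S" and x: "x \<in> ctrls c k S"
    and len: "length rs = k" and rs: "set rs \<subseteq> {..<S}"
  shows "fst (tr c k x rs) \<in> insert (Work []) (ctrls c k S)"
    "length (snd (tr c k x rs)) = k" "fst ` set (snd (tr c k x rs)) \<subseteq> {..<S}"
proof -
  have rs_less: "v < k \<Longrightarrow> rs ! v < S" for v
    using rs len nth_mem by (metis lessThan_iff subsetD)
  have view: "view k rs v < S" for v using rs_less S by (simp add: view_def)
  have bd: "op_bounded S (ops K \<tau> v) \<and> (k \<le> v \<longrightarrow> ops K \<tau> v = Keep)"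
    if "K \<in> reach c []" for K \<tau> v using ops_reach[OF that b] .
  have a1: "op_bounded S y \<Longrightarrow> a < S \<Longrightarrow> fst (act1 v y a) < S" for v y a
    using S by (cases y) auto
  have "[c] \<in> reach c []" by (rule reach_start)
  moreover have "(\<lambda>v. pending (ops K (view k rs) v) (view k rs v)) \<in> tuples k S"
    if "K \<in> reach c []" for K using bd[OF that] pending_less S by (auto simp: tuples_def)
  ultimately show "fst (tr c k x rs) \<in> insert (Work []) (ctrls c k S)"
    using x ctl_reach by (cases x) (fastforce simp: ctrls_def)+
  show "length (snd (tr c k x rs)) = k" by (cases x) auto
  show "fst ` set (snd (tr c k x rs)) \<subseteq> {..<S}"
    using x rs_less a1 bd by (cases x) (auto simp: ctrls_def act2_def tuples_def)
qed

text \<open>The machine model prescribes 0 as start state and the number of states as halting state;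
  the remaining states can be numbered freely.\<close>

lemma ex_numbering:
  assumes "finite X" "a \<in> X" "h \<notin> X"
  shows "\<exists>e. bij_betw e X {..<card X} \<and> e a = 0 \<and> e h = card X"
proof -
  obtain f where f: "bij_betw f (X - {a}) {0..<card (X - {a})}"
    using ex_bij_betw_finite_nat assms(1) by blast
  define e where "e = (\<lambda>x. if x = a then 0 else if x = h then card X else Suc (f x))"
  have inj: "inj_on e X"
    using f assms(3) by (auto simp: e_def inj_on_def bij_betw_def)
  have "e x < card X" if "x \<in> X" for x
  proof (cases "x = a")
    case True
    then show ?thesis using assms by (auto simp: e_def card_gt_0_iff)
  next
    case False
    then have "f x < card (X - {a})" using f that by (auto simp: bij_betw_def)
    then show ?thesis using False that assms by (auto simp: e_def)
  qed
  then have "e ` X \<subseteq> {..<card X}" by auto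
  then have "e ` X = {..<card X}" using inj
    by (intro card_subset_eq) (auto simp: card_image)
  then show ?thesis using inj assms by (intro exI[of _ e]) (auto simp: e_def bij_betw_def)
qed

lemma funpow_fixed: "f x = x \<Longrightarrow> (f ^^ n) x = x"
  by (induction n) auto

lemma map2_map: "length ts = k \<Longrightarrow> map2 f (map g [0..<k]) ts = map (\<lambda>v. f (g v) (ts ! v)) [0..<k]"
  by (rule nth_equalityI) auto

lemma com_computes_FP:
  assumes cc: "com_computes k S c f p"
  shows "f \<in> FP"
proof -
  have k: "2 \<le> k" and S: "3 \<le> S" and b: "bounded k S c"
    using cc by (auto simp: com_computes_def)
  define X where "X = ctrls c k S"
  have finX: "finite X" and startX: "Start \<in> X" and haltX: "Work [] \<notin> X"
    using finite_ctrls halt_notin_ctrls by (auto simp: X_def ctrls_def)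
  obtain e where e: "bij_betw e X {..<card X}" "e Start = 0" "e (Work []) = card X"
    using ex_numbering[OF finX startX haltX] by blast
  define M where "M = \<lparr>num_tapes = k, num_states = card X, num_symbols = S,
    transition = \<lambda>q rs. (e (fst (tr c k (inv_into X e q) rs)), snd (tr c k (inv_into X e q) rs))\<rparr>"
  have cardX: "0 < card X" using finX startX by (auto simp: card_gt_0_iff)
  have e_le: "e x \<le> card X" if "x \<in> insert (Work []) X" for x
    using that e bij_betw_apply[OF e(1), of x] by auto
  have inv: "inv_into X e (e x) = x" if "x \<in> X" for x
    using that e by (auto simp: bij_betw_def)
  have inv_in: "inv_into X e q \<in> X" if "q < card X" for q
    using that e by (simp add: bij_betw_def inv_into_into)
  have "wf_tm M"
    unfolding wf_tm_def
  proof (intro conjI allI impI)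
    fix q rs assume q: "q < num_states M" and rs: "length rs = num_tapes M \<and> set rs \<subseteq> {..<num_symbols M}"
    have "inv_into X e q \<in> ctrls c k S" using inv_in q by (simp add: M_def X_def)
    from tr_closed[OF b _ this, of rs] e_le rs S
    show "case transition M q rs of (q', as) \<Rightarrow> q' \<le> num_states M \<and> length as = num_tapes M
        \<and> fst ` set as \<subseteq> {..<num_symbols M}"
      by (simp add: M_def X_def)
  qed (use k S cardX in \<open>auto simp: M_def\<close>)
  have step: "tm_step M (e x, ts) = (e (fst (tr c k x (map tape_read ts))),
      map2 tape_act (snd (tr c k x (map tape_read ts))) ts)" if "x \<in> X" for x ts
  proof -
    have "e x < card X" using that e by (auto simp: bij_betw_def)
    then show ?thesis by (simp add: M_def inv[OF that])
  qed
  define sim where "sim K s ts \<longleftrightarrow> length ts = k \<and> store_ok k S s \<and> (\<forall>v<k. rep v (ts ! v) (s v))" for K :: "com list" and s ts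
  have two: "\<exists>ts'. (tm_step M ^^ 2) (e (Work K), ts) = (e (Work (fst (cstep (K, s)))), ts') \<and>
      sim (fst (cstep (K, s))) (snd (cstep (K, s))) ts'"
    if K: "K \<in> reach c []" and sim: "sim K s ts" for K s ts
  proof -
    have len: "length ts = k" and ok: "store_ok k S s" and rep: "\<And>v. v < k \<Longrightarrow> rep v (ts ! v) (s v)"
      using sim by (auto simp: sim_def)
    define rs where "rs = map tape_read ts"
    have rs: "rs ! v = cont (s v) 0" if "v < k" for v
      using rep_read[OF rep[OF that]] that len by (simp add: rs_def)
    have view: "view k rs = tops s"
      using rs ok by (auto simp: view_def tops_def store_ok_def)
    have bd: "op_bounded S (ops K \<tau> v) \<and> (k \<le> v \<longrightarrow> ops K \<tau> v = Keep)" for \<tau> v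
      using ops_reach[OF K b] .
    define pd where "pd = (\<lambda>v. pending (ops K (tops s) v) (tops s v))"
    define ts1 where "ts1 = map (\<lambda>v. tape_act (act1 v (ops K (tops s) v) (rs ! v)) (ts ! v)) [0..<k]"
    define ts2 where "ts2 = map (\<lambda>v. tape_act (act2 (pd v) (tape_read (ts1 ! v))) (ts1 ! v)) [0..<k]"
    have K'in: "ctl K (tops s) \<in> insert [] (reach c [])" using ctl_reach[OF K] .
    have "tops s v < S \<and> (k \<le> v \<longrightarrow> tops s v = 0)" for v
      using ok S cont_less[of "s v" S 0] by (auto simp: store_ok_def tops_def)
    then have "pd \<in> tuples k S" using bd S pending_less
      by (simp add: tuples_def pd_def)
    then have WX: "Write (ctl K (tops s)) pd \<in> X"
      using K'in by (auto simp: X_def ctrls_def)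
    have "Work K \<in> X" using K by (simp add: X_def ctrls_def)
    from step[OF this, of ts] have s1: "tm_step M (e (Work K), ts) = (e (Write (ctl K (tops s)) pd), ts1)"
      by (simp add: rs_def[symmetric] view map2_map[OF len] ts1_def pd_def)
    have len1: "length ts1 = k" by (simp add: ts1_def)
    have s2: "tm_step M (e (Write (ctl K (tops s)) pd), ts1) = (e (Work (ctl K (tops s))), ts2)"
      by (subst step[OF WX]) (simp add: map2_map[OF len1] ts2_def len1 cong: map_cong)
    have "rep v (ts2 ! v) (apply_op (ops K (tops s) v) (s v))" if v: "v < k" for v
    proof (rule rep_op[OF rep[OF v]])
      show "0 \<notin> set (s v)" using ok by (force simp: store_ok_def)
      show "op_bounded S (ops K (tops s) v)" using bd by blast
      have r: "tape_read (ts ! v) = tops s v" using rep_read[OF rep[OF v]] by (simp add: tops_def)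
      have "rs ! v = tops s v" using rs[OF v] by (simp add: tops_def)
      then show "ts1 ! v = tape_act (act1 v (ops K (tops s) v) (tape_read (ts ! v))) (ts ! v)"
        using v r by (simp add: ts1_def)
      then show "ts2 ! v = tape_act (act2 (pending (ops K (tops s) v) (tape_read (ts ! v))) (tape_read (ts1 ! v))) (ts1 ! v)"
        using v r by (simp add: ts2_def pd_def)
    qed
    moreover have "store_ok k S (\<lambda>v. apply_op (ops K (tops s) v) (s v))"
      using ok bd set_apply_op by (simp add: store_ok_def)
    ultimately have "sim (ctl K (tops s)) (\<lambda>v. apply_op (ops K (tops s) v) (s v)) ts2"
      by (simp add: sim_def ts2_def)
    then show ?thesis using s1 s2 by (auto simp: cstep_pair numeral_2_eq_2)
  qed
  have many: "\<exists>ts'. (tm_step M ^^ (2 * n)) (e (Work K), ts) = (e (Work (fst ((cstep ^^ n) (K, s)))), ts') \<and>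
      sim (fst ((cstep ^^ n) (K, s))) (snd ((cstep ^^ n) (K, s))) ts'"
    if "K \<in> insert [] (reach c [])" "sim K s ts" for n K s ts
    using that
  proof (induction n arbitrary: K s ts)
    case (Suc n)
    show ?case
    proof (cases "K = []")
      case True
      have "tm_step M (e (Work []), ts) = (e (Work []), ts)" by (simp add: e M_def)
      then have "(tm_step M ^^ (2 * Suc n)) (e (Work []), ts) = (e (Work []), ts)" by (rule funpow_fixed)
      then show ?thesis using True Suc.prems cstep_halted[of "Suc n" s] by simp
    next
      case False
      with Suc.prems have K: "K \<in> reach c []" by simp
      obtain ts1 where ts1: "(tm_step M ^^ 2) (e (Work K), ts) = (e (Work (fst (cstep (K, s)))), ts1)"
        "sim (fst (cstep (K, s))) (snd (cstep (K, s))) ts1" using two[OF K Suc.prems(2)] by blast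
      have "fst (cstep (K, s)) \<in> insert [] (reach c [])" using ctl_reach[OF K] by (simp add: cstep_pair)
      from Suc.IH[OF this ts1(2)] obtain ts' where
        ts': "(tm_step M ^^ (2 * n)) (e (Work (fst (cstep (K, s)))), ts1) =
            (e (Work (fst ((cstep ^^ n) (cstep (K, s))))), ts')"
          "sim (fst ((cstep ^^ n) (cstep (K, s)))) (snd ((cstep ^^ n) (cstep (K, s)))) ts'"
        by auto
      have "2 * Suc n = 2 * n + 2" by simp
      then have "(tm_step M ^^ (2 * Suc n)) (e (Work K), ts) = (tm_step M ^^ (2 * n)) ((tm_step M ^^ 2) (e (Work K), ts))"
        by (simp only: funpow_add o_apply)
      then show ?thesis using ts' ts1 by (simp add: funpow_swap1)
    qed
  qed auto
  \<comment> \<open>One machine step for \<open>Start\<close>, then two for every step of the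
    program.\<close>
  have "tm_computes_within M x (f x) (poly (1 + 2 * p) (length x))" for x
  proof -
    obtain s' where s': "runs c (init_store x) s' (poly p (length x))" "s' 1 = rev (map bit_symbol (f x))"
      using cc by (auto simp: com_computes_def)
    obtain t where t: "t \<le> poly p (length x)" "(cstep ^^ t) ([c], init_store x) = ([], s')"
      using s'(1) unfolding runs_def by blast
    define ts where "ts = map (\<lambda>v. tape_act (tape_read (snd (init_config M x) ! v), if v = 0 then Stay else MoveLeft) (snd (init_config M x) ! v)) [0..<k]"
    have len: "length (snd (init_config M x)) = k" using k by (simp add: init_config_def M_def)
    have s1: "tm_step M (init_config M x) = (e (Work [c]), ts)"
    proof -
      have "init_config M x = (e Start, snd (init_config M x))" by (simp add: init_config_def e)
      then show ?thesis using step[OF startX, of "snd (init_config M x)"]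
        by (simp add: map2_map[OF len] ts_def len cong: map_cong)
    qed
    have "rep v (ts ! v) (init_store x v)" if v: "v < k" for v
    proof (cases "v = 0")
      case True
      then show ?thesis using v
        by (auto simp: ts_def init_config_def input_tape_def rep_def dir_def init_store_def cont_def)
    next
      case False
      have *: "(\<lambda>i::int. 0::nat)(0 := 0) = (\<lambda>i. 0)" by auto
      show ?thesis using v False
        by (auto simp: ts_def init_config_def input_tape_def rep_def dir_def init_store_def cont_def M_def nth_Cons')
    qed
    then have sim0: "sim [c] (init_store x) ts"
      using store_ok_init[OF S, of k x] k by (simp add: sim_def ts_def)
    have "[c] \<in> insert [] (reach c [])" using reach_start by blast
    from many[OF this sim0, of t] t obtain ts' where
      ts': "(tm_step M ^^ (2 * t)) (e (Work [c]), ts) = (card X, ts')" "sim [] s' ts'"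
      by (auto simp: e)
    have "(tm_step M ^^ Suc (2 * t)) (init_config M x) = (card X, ts')"
      using ts' s1 by (simp add: funpow_swap1)
    moreover have "tm_step M (card X, ts') = (card X, ts')" by (simp add: M_def)
    moreover obtain d where "poly (1 + 2 * p) (length x) = d + Suc (2 * t)"
      using t(1) le_iff_add[of "Suc (2 * t)" "poly (1 + 2 * p) (length x)"] by auto
    ultimately have run: "(tm_step M ^^ poly (1 + 2 * p) (length x)) (init_config M x) = (card X, ts')"
      by (simp only: funpow_add o_apply funpow_fixed)
    have "rep 1 (ts' ! 1) (s' 1)" using ts'(2) k by (simp add: sim_def)
    then have "tape_holds (ts' ! 1) (f x)" unfolding s'(2) by (rule rep_holds) simp
    then show ?thesis using run by (simp add: tm_computes_within_def M_def)
  qed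
  then show ?thesis using \<open>wf_tm M\<close> unfolding FP_def by blast
qed

section \<open>Simulating Turing machines by programs\<close>

definition upd :: "nat \<Rightarrow> ((nat \<Rightarrow> nat) \<Rightarrow> op) \<Rightarrow> com" where
  "upd a x = Act (\<lambda>\<tau> v. if v = a then x \<tau> else Keep)"

lemma runs_upd: "s' = s(a := apply_op (x (tops s)) (s a)) \<Longrightarrow> runs (upd a x) s s' 1"
  unfolding upd_def by (rule runs_Act) auto

lemma bounded_upd: "a < k \<Longrightarrow> (\<And>\<tau>. op_bounded S (x \<tau>)) \<Longrightarrow> bounded k S (upd a x)"
  by (auto simp: upd_def)

text \<open>One loop scheme for clearing, moving, duplicating and counting: each symbol taken from
  \<open>a\<close> may leave a symbol on any other stack, and the value 0 of \<open>h\<close> leaves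
  none.\<close>

definition xfer :: "nat \<Rightarrow> (nat \<Rightarrow> nat \<Rightarrow> nat) \<Rightarrow> com" where
  "xfer a h = Whl (\<lambda>\<tau>. \<tau> a \<noteq> 0)
     (Act (\<lambda>\<tau> v. if v = a then Pop else if h v (\<tau> a) = 0 then Keep else Push (h v (\<tau> a))))"

lemma bounded_xfer:
  "a < k \<Longrightarrow> (\<And>v x. h v x < S) \<Longrightarrow> (\<And>v x. k \<le> v \<Longrightarrow> h v x = 0) \<Longrightarrow> bounded k S (xfer a h)"
  by (auto simp: xfer_def)

lemma runs_xfer:
  assumes "0 \<notin> set (s a)" "2 * length (s a) + 1 \<le> t"
    and "s' = (\<lambda>v. if v = a then [] else rev (filter (\<lambda>y. y \<noteq> 0) (map (h v) (s a))) @ s v)"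
  shows "runs (xfer a h) s s' t"
  using assms
proof (induction "s a" arbitrary: s t)
  case Nil
  have sa: "s a = []" using Nil(1) by simp
  have "s' = s" unfolding Nil(4) by (rule ext) (simp add: sa)
  moreover have "tops s a = 0" using Nil by (metis cont_Nil tops_def)
  ultimately show ?case unfolding xfer_def
    using Nil(3) by (auto intro!: runs_weaken[OF runs_Whl_False])
next
  case (Cons x xs)
  define s1 where "s1 = (\<lambda>v. if v = a then xs else if h v x = 0 then s v else h v x # s v)"
  have sa: "s a = x # xs" by (simp add: Cons)
  have top: "tops s a = x" by (simp add: tops_def sa)
  have act: "runs (Act (\<lambda>\<tau> v. if v = a then Pop else if h v (\<tau> a) = 0 then Keep else Push (h v (\<tau> a)))) s s1 1"
    by (rule runs_Act) (auto simp: s1_def top sa)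
  have "runs (xfer a h) s1 s' (2 * length xs + 1)"
  proof (rule Cons.hyps(1))
    show "xs = s1 a" by (simp add: s1_def)
    show "0 \<notin> set (s1 a)" using Cons.prems(1) sa by (simp add: s1_def)
    show "2 * length (s1 a) + 1 \<le> 2 * length xs + 1" by (simp add: s1_def)
    show "s' = (\<lambda>v. if v = a then [] else rev (filter (\<lambda>y. y \<noteq> 0) (map (h v) (s1 a))) @ s1 v)"
      unfolding Cons.prems(3) by (rule ext) (simp add: s1_def sa)
  qed
  then have "runs (xfer a h) s s' (Suc (1 + (2 * length xs + 1)))"
    unfolding xfer_def using Cons.prems(1) sa by (intro runs_Whl_True[OF _ act]) (auto simp: top)
  then show ?case by (rule runs_weaken) (use Cons.prems(2) sa in simp)
qed

definition move :: "nat \<Rightarrow> nat \<Rightarrow> (nat \<Rightarrow> nat) \<Rightarrow> com" where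
  "move a b g = xfer a (\<lambda>v x. if v = b then g x else 0)"

lemma bounded_move: "a < k \<Longrightarrow> b < k \<Longrightarrow> (\<And>x. g x < S) \<Longrightarrow> bounded k S (move a b g)"
  unfolding move_def by (rule bounded_xfer) (auto intro: le_less_trans[of 0 "g 0" S])

lemma runs_move:
  assumes "0 \<notin> set (s a)" "a \<noteq> b" "\<And>x. x \<in> set (s a) \<Longrightarrow> g x \<noteq> 0" "2 * length (s a) + 1 \<le> t"
    and "s' = s(a := [], b := rev (map g (s a)) @ s b)"
  shows "runs (move a b g) s s' t"
proof -
  have "filter (\<lambda>y. 0 < y) (map g (s a)) = map g (s a)"
    using assms(3) by (auto simp: filter_id_conv)
  then show ?thesis
    unfolding move_def using assms by (intro runs_xfer) (auto simp: fun_eq_iff)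
qed

section \<open>Tapes as pairs of half-tapes on stacks\<close>

definition code :: "nat \<Rightarrow> nat \<Rightarrow> bool \<Rightarrow> nat" where
  "code S a marked = Suc a + (if marked then S else 0)"

definition symbol_of :: "nat \<Rightarrow> nat \<Rightarrow> nat" where
  "symbol_of S a = (a - 1) mod S"

text \<open>Reading beyond the end of a stack gives 0, which has to stand for a cell outside the
  stored part of the tape: 1 is the code of an unmarked blank. The upper bound makes the programs
  bounded for arbitrary tops.\<close>

definition cell_code :: "nat \<Rightarrow> nat \<Rightarrow> nat" where
  "cell_code S a = (if 1 \<le> a \<and> a \<le> 2 * S then a else 1)"

lemma code_bounds: "a < S \<Longrightarrow> code S a m \<noteq> 0 \<and> code S a m \<le> 2 * S"
  by (auto simp: code_def)

lemma cell_code_code [simp]: "a < S \<Longrightarrow> cell_code S (code S a m) = code S a m"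
  using code_bounds[of a S m] by (auto simp: cell_code_def)

lemma symbol_of_code [simp]: "a < S \<Longrightarrow> symbol_of S (code S a m) = a"
  by (auto simp: symbol_of_def code_def)

lemma marked_code [simp]: "a < S \<Longrightarrow> S < code S a m \<longleftrightarrow> m"
  by (auto simp: code_def)

lemma cell_code_bounds: "0 < S \<Longrightarrow> cell_code S a \<noteq> 0 \<and> cell_code S a \<le> 2 * S"
  by (auto simp: cell_code_def)

text \<open>
  The cells left of the head, the scanned cell and the cells right of the head are kept on three
  stacks; cell 0 is marked so that it can be found again when the machine has halted.
\<close>

definition cell :: "nat \<Rightarrow> (int \<Rightarrow> nat) \<Rightarrow> int \<Rightarrow> nat" where
  "cell S t q = code S (t q) (q = 0)"

definition trep :: "nat \<Rightarrow> tape \<Rightarrow> nat list \<Rightarrow> nat list \<Rightarrow> nat list \<Rightarrow> bool" where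
  "trep S T l h r \<longleftrightarrow> (\<forall>q. fst T q < S) \<and> 0 \<notin> set l \<and> 0 \<notin> set r \<and> h = [cell S (fst T) (snd T)] \<and>
     (\<forall>i. cell_code S (cont l i) = cell S (fst T) (snd T - 1 - int i)) \<and>
     (\<forall>i. cell_code S (cont r i) = cell S (fst T) (snd T + 1 + int i))"

lemma trep_left: "trep S (t, p) l h r \<Longrightarrow> cell_code S (cont l i) = cell S t (p - 1 - int i)"
  and trep_right: "trep S (t, p) l h r \<Longrightarrow> cell_code S (cont r i) = cell S t (p + 1 + int i)"
  by (simp_all add: trep_def)

fun moveops :: "nat \<Rightarrow> move \<Rightarrow> nat \<Rightarrow> nat \<Rightarrow> nat \<Rightarrow> op list" where
  "moveops S MoveLeft x a b = [Pop, Put (cell_code S a), Push x]"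
| "moveops S Stay x a b = [Keep, Put x, Keep]"
| "moveops S MoveRight x a b = [Push x, Put (cell_code S b), Pop]"

lemma trep_move:
  assumes tr: "trep S T l h r" and a: "a < S"
    and x: "x = code S a (snd T = 0)" and u: "u = moveops S m x (cont l 0) (cont r 0)"
  shows "trep S (tape_act (a, m) T) (apply_op (u ! 0) l) (apply_op (u ! 1) h) (apply_op (u ! 2) r)"
proof -
  obtain t p where T: "T = (t, p)" by fastforce
  have tS: "t q < S" for q using tr T by (simp add: trep_def)
  have nz: "0 \<notin> set l" "0 \<notin> set r" "0 \<notin> set (tl l)" "0 \<notin> set (tl r)"
    using tr by (auto simp: trep_def) (metis list.sel(2) list.set_sel(2))+
  have h: "h = [cell S t p]" using tr T by (simp add: trep_def)
  have l: "cell_code S (cont l i) = cell S t (p - 1 - int i)" for i using tr T by (simp add: trep_def)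
  have r: "cell_code S (cont r i) = cell S t (p + 1 + int i)" for i using tr T by (simp add: trep_def)
  have xb: "0 < x" "cell_code S x = x" using x code_bounds[OF a] a by auto
  have upd_cell: "cell S (t(p := a)) q = (if q = p then x else cell S t q)" for q
    by (simp add: cell_def x T)
  show ?thesis
  proof (cases m)
    case MoveLeft
    have "cell_code S (cont (x # r) i) = cell S (t(p := a)) (p - 1 + 1 + int i)" for i
      using r[of "i - 1"] by (cases i) (simp_all add: upd_cell xb algebra_simps)
    moreover have "cell_code S (cont (tl l) i) = cell S (t(p := a)) (p - 1 - 1 - int i)" for i
      using l[of "Suc i"] by (simp add: upd_cell cont_tl algebra_simps)
    moreover have "cell S (t(p := a)) (p - 1) = cell_code S (cont l 0)"
      using l[of 0] by (simp add: upd_cell)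
    ultimately show ?thesis using nz tS a xb
      by (simp add: T MoveLeft u h trep_def)
  next
    case Stay
    have "cell_code S (cont r i) = cell S (t(p := a)) (p + 1 + int i)" for i
      using r[of i] by (simp add: upd_cell)
    moreover have "cell_code S (cont l i) = cell S (t(p := a)) (p - 1 - int i)" for i
      using l[of i] by (simp add: upd_cell)
    moreover have "cell S (t(p := a)) p = x" by (simp add: upd_cell)
    ultimately show ?thesis using nz tS a xb
      by (simp add: T Stay u h trep_def)
  next
    case MoveRight
    have "cell_code S (cont (x # l) i) = cell S (t(p := a)) (p + 1 - 1 - int i)" for i
      using l[of "i - 1"] by (cases i) (simp_all add: upd_cell xb algebra_simps)
    moreover have "cell_code S (cont (tl r) i) = cell S (t(p := a)) (p + 1 + 1 + int i)" for i
      using r[of "Suc i"] by (simp add: upd_cell cont_tl algebra_simps)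
    moreover have "cell S (t(p := a)) (p + 1) = cell_code S (cont r 0)"
      using r[of 0] by (simp add: upd_cell)
    ultimately show ?thesis using nz tS a xb
      by (simp add: T MoveRight u h trep_def)
  qed
qed

lemma moveops_bounded:
  "0 < S \<Longrightarrow> 0 < x \<Longrightarrow> x \<le> 2 * S \<Longrightarrow> i < 3 \<Longrightarrow> 2 * S < S' \<Longrightarrow> op_bounded S' (moveops S m x a b ! i)"
  using cell_code_bounds[of S a] cell_code_bounds[of S b]
  by (cases m) (auto simp: less_Suc_eq numeral_3_eq_3)

text \<open>Tape \<open>j\<close> of the machine lives on the stacks \<open>2 + 3 * j\<close>,
  \<open>3 + 3 * j\<close> and \<open>4 + 3 * j\<close>. This command moves the head of tape 1, the
  output tape, without changing any cell, while \<open>w\<close> acts on the output stack.\<close>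

definition scan :: "nat \<Rightarrow> move \<Rightarrow> ((nat \<Rightarrow> nat) \<Rightarrow> op) \<Rightarrow> com" where
  "scan S m w = Act (\<lambda>\<tau> v. if v \<in> {5, 6, 7} then moveops S m (cell_code S (\<tau> 6)) (\<tau> 5) (\<tau> 7) ! (v - 5)
     else if v = 1 then w \<tau> else Keep)"

lemma bounded_scan:
  assumes "8 \<le> k" "0 < S" "2 * S < S'" "\<And>\<tau>. op_bounded S' (w \<tau>)"
  shows "bounded k S' (scan S m w)"
  using assms cell_code_bounds moveops_bounded by (auto simp: scan_def)

lemma runs_scan:
  assumes tr: "trep S (t, p) (s 5) (s 6) (s 7)"
  shows "\<exists>s'. runs (scan S m w) s s' 1 \<and> trep S (t, move_head m p) (s' 5) (s' 6) (s' 7) \<and>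
    s' 1 = apply_op (w (tops s)) (s 1) \<and>
    (m = MoveLeft \<longrightarrow> s' 5 = tl (s 5) \<and> length (s' 7) = Suc (length (s 7))) \<and>
    (m = MoveRight \<longrightarrow> length (s' 7) = length (s 7) - 1)"
proof -
  define u where "u = moveops S m (cell_code S (tops s 6)) (tops s 5) (tops s 7)"
  define s' where "s' = (\<lambda>v. apply_op (if v \<in> {5, 6, 7} then u ! (v - 5)
     else if v = 1 then w (tops s) else Keep) (s v))"
  have tS: "t p < S" and s6: "s 6 = [cell S t p]" using tr unfolding trep_def by simp_all
  have x: "cell_code S (tops s 6) = code S (t p) (p = 0)"
    unfolding tops_def s6 using tS by (simp add: cell_def)
  have "trep S (tape_act (t p, m) (t, p)) (apply_op (u ! 0) (s 5)) (apply_op (u ! 1) (s 6)) (apply_op (u ! 2) (s 7))"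
    by (rule trep_move[OF tr tS]) (simp_all add: u_def x, simp add: tops_def)
  then have "trep S (t, move_head m p) (s' 5) (s' 6) (s' 7)"
    by (simp add: s'_def)
  moreover have "runs (scan S m w) s s' 1"
    unfolding scan_def by (rule runs_Act) (auto simp: s'_def u_def fun_eq_iff)
  ultimately show ?thesis
    by (intro exI[of _ s']) (auto simp: s'_def u_def)
qed

text \<open>When the machine halts it is unknown on which side of cell 0 its head stands. So the
  head goes to the left end of the stored part first, and the mark is then found by moving
  right.\<close>

definition rewind :: "nat \<Rightarrow> com" where
  "rewind S = Whl (\<lambda>\<tau>. \<tau> 5 \<noteq> 0) (scan S MoveLeft (\<lambda>_. Keep))"

lemma runs_rewind:
  assumes "trep S (t, p) (s 5) (s 6) (s 7)"
  shows "\<exists>s'. runs (rewind S) s s' (2 * length (s 5) + 1) \<and>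
    trep S (t, p - int (length (s 5))) [] (s' 6) (s' 7) \<and> s' 5 = [] \<and> s' 1 = s 1 \<and>
    length (s' 7) = length (s 5) + length (s 7)"
  using assms
proof (induction "length (s 5)" arbitrary: s p)
  case 0
  then have "tops s 5 = 0" by (simp add: tops_def)
  then show ?case using 0 runs_Whl_False[of "\<lambda>\<tau>. \<tau> 5 \<noteq> 0" s] unfolding rewind_def
    by (intro exI[of _ s]) auto
next
  case (Suc n)
  have nz: "tops s 5 \<noteq> 0"
    using Suc.prems Suc.hyps(2) by (auto simp: tops_def trep_def cont_eq_0_iff)
  obtain s1 where s1: "runs (scan S MoveLeft (\<lambda>_. Keep)) s s1 1" "trep S (t, p - 1) (s1 5) (s1 6) (s1 7)"
    "s1 1 = s 1" "s1 5 = tl (s 5)" "length (s1 7) = Suc (length (s 7))"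
    using runs_scan[OF Suc.prems, of MoveLeft "\<lambda>_. Keep"] by auto
  have len: "n = length (s1 5)" using Suc.hyps(2) s1(4) by simp
  obtain s' where s': "runs (rewind S) s1 s' (2 * length (s1 5) + 1)"
    "trep S (t, p - 1 - int (length (s1 5))) [] (s' 6) (s' 7)" "s' 5 = []" "s' 1 = s1 1"
    "length (s' 7) = length (s1 5) + length (s1 7)"
    using Suc.hyps(1)[OF len s1(2)] by blast
  have "runs (rewind S) s s' (Suc (1 + (2 * length (s1 5) + 1)))"
    unfolding rewind_def by (rule runs_Whl_True[OF _ s1(1)]) (use nz s'(1) in \<open>auto simp: rewind_def\<close>)
  then have "runs (rewind S) s s' (2 * length (s 5) + 1)"
    by (rule runs_weaken) (use len Suc.hyps(2) in simp)
  moreover have "p - 1 - int (length (s1 5)) = p - int (length (s 5))"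
    using len Suc.hyps(2) by linarith
  ultimately show ?case using s' s1 len Suc.hyps(2) by (intro exI[of _ s']) auto
qed

definition find_mark :: "nat \<Rightarrow> com" where
  "find_mark S = Whl (\<lambda>\<tau>. \<tau> 6 \<le> S) (scan S MoveRight (\<lambda>_. Keep))"

lemma runs_find_mark:
  assumes "trep S (t, - int n) (s 5) (s 6) (s 7)"
  shows "\<exists>s'. runs (find_mark S) s s' (2 * n + 1) \<and>
    trep S (t, 0) (s' 5) (s' 6) (s' 7) \<and> s' 1 = s 1 \<and> length (s' 7) \<le> length (s 7)"
  using assms
proof (induction n arbitrary: s)
  case 0
  then have "t 0 < S" "s 6 = [code S (t 0) True]" by (auto simp: trep_def cell_def)
  then have "\<not> tops s 6 \<le> S" using marked_code[of "t 0" S True] by (simp add: tops_def not_le)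
  then show ?case using 0 runs_Whl_False[of "\<lambda>\<tau>. \<tau> 6 \<le> S" s] unfolding find_mark_def
    by (intro exI[of _ s]) auto
next
  case (Suc n)
  then have "t (- int (Suc n)) < S" "s 6 = [code S (t (- int (Suc n))) False]" by (auto simp: trep_def cell_def)
  then have nz: "tops s 6 \<le> S" by (simp add: tops_def code_def)
  obtain s1 where s1: "runs (scan S MoveRight (\<lambda>_. Keep)) s s1 1" "trep S (t, - int n) (s1 5) (s1 6) (s1 7)"
    "s1 1 = s 1" "length (s1 7) = length (s 7) - 1"
    using runs_scan[OF Suc.prems, of MoveRight "\<lambda>_. Keep"] by auto
  obtain s' where s': "runs (find_mark S) s1 s' (2 * n + 1)"
    "trep S (t, 0) (s' 5) (s' 6) (s' 7)" "s' 1 = s1 1" "length (s' 7) \<le> length (s1 7)"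
    using Suc.IH[OF s1(2)] by blast
  have "runs (find_mark S) s s' (Suc (1 + (2 * n + 1)))"
    unfolding find_mark_def by (rule runs_Whl_True[OF _ s1(1)]) (use nz s'(1) in \<open>auto simp: find_mark_def\<close>)
  then show ?case using s' s1 by (intro exI[of _ s']) auto
qed

definition write_out :: "nat \<Rightarrow> com" where
  "write_out S = Whl (\<lambda>\<tau>. symbol_of S (\<tau> 6) \<noteq> 0)
     (scan S MoveRight (\<lambda>\<tau>. if symbol_of S (\<tau> 6) = 0 then Keep else Push (symbol_of S (\<tau> 6))))"

lemma runs_write_out:
  assumes "trep S (t, int p) (s 5) (s 6) (s 7)"
    and "\<And>i. i < length y \<Longrightarrow> t (int (p + i)) = bit_symbol (y ! i)" "t (int (p + length y)) = 0"
  shows "\<exists>s'. runs (write_out S) s s' (2 * length y + 1) \<and> s' 1 = rev (map bit_symbol y) @ s 1"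
  using assms
proof (induction y arbitrary: s p)
  case Nil
  then have "t (int p) = 0" "s 6 = [code S (t (int p)) (p = 0)]" "0 < S"
    by (auto simp: trep_def cell_def intro: le_less_trans[of 0])
  then have "symbol_of S (tops s 6) = 0" by (simp add: tops_def)
  then show ?case using runs_Whl_False[of "\<lambda>\<tau>. symbol_of S (\<tau> 6) \<noteq> 0" s] unfolding write_out_def
    by (intro exI[of _ s]) auto
next
  case (Cons b y)
  have tp: "t (int p) = bit_symbol b" using Cons.prems(2)[of 0] by simp
  have "t (int p) < S" "s 6 = [code S (t (int p)) (p = 0)]" using Cons.prems(1)
    by (auto simp: trep_def cell_def)
  then have top6: "symbol_of S (tops s 6) = bit_symbol b" by (simp add: tops_def tp)
  then have nz: "symbol_of S (tops s 6) \<noteq> 0" by (simp add: bit_symbol_def)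
  let ?w = "\<lambda>\<tau>. if symbol_of S (\<tau> 6) = 0 then Keep else Push (symbol_of S (\<tau> 6))"
  obtain s1 where s1: "runs (scan S MoveRight ?w) s s1 1" "trep S (t, int p + 1) (s1 5) (s1 6) (s1 7)"
    "s1 1 = apply_op (?w (tops s)) (s 1)"
    using runs_scan[OF Cons.prems(1), of MoveRight ?w] by auto
  have s11: "s1 1 = bit_symbol b # s 1" using s1(3) nz top6 by simp
  have "int p + 1 = int (Suc p)" by simp
  from s1(2)[unfolded this] obtain s' where s': "runs (write_out S) s1 s' (2 * length y + 1)"
    "s' 1 = rev (map bit_symbol y) @ s1 1"
    using Cons.IH[of "Suc p" s1] Cons.prems(2)[of "Suc i" for i] Cons.prems(3) by auto
  have "runs (write_out S) s s' (Suc (1 + (2 * length y + 1)))"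
    unfolding write_out_def by (rule runs_Whl_True[OF _ s1(1)]) (use nz s'(1) in \<open>auto simp: write_out_def\<close>)
  then show ?case using s' s11 by (intro exI[of _ s']) auto
qed

text \<open>Reversing the input twice preserves its order. Its first symbol becomes the scanned cell
  of tape 0, and since all heads start in cell 0, all scanned cells get the mark \<open>S\<close>.
  The state is stored as its successor because 0 is not a stack symbol.\<close>

definition sim_init :: "nat \<Rightarrow> nat \<Rightarrow> com" where
  "sim_init k S =
     move 0 2 (\<lambda>x. if x < 3 then Suc x else 1) ;;
     move 2 4 (\<lambda>x. if 1 \<le> x \<and> x \<le> 3 then x else 1) ;;
     Act (\<lambda>\<tau> v. if v = 2 + 3 * k then Push 1
       else if v = 4 then Pop
       else if v = 3 then Push ((if \<tau> 4 = 2 \<or> \<tau> 4 = 3 then \<tau> 4 else 1) + S)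
       else if 2 \<le> v \<and> v < 2 + 3 * k \<and> v mod 3 = 0 then Push (1 + S)
       else Keep)"

text \<open>Tops that encode no running configuration lead to \<open>Keep\<close>, since
  \<open>wf_tm\<close> restricts the transition function only below the number of states.\<close>

definition sim_step :: "tm \<Rightarrow> (nat \<Rightarrow> nat) \<Rightarrow> nat \<Rightarrow> op" where
  "sim_step M \<tau> v =
     (let k = num_tapes M; S = num_symbols M; q = \<tau> (2 + 3 * k) - 1;
          r = transition M q (map (\<lambda>j. symbol_of S (\<tau> (3 + 3 * j))) [0..<k]);
          j = (v - 2) div 3
      in if \<tau> (2 + 3 * k) = 0 \<or> num_states M \<le> q then Keep
         else if v = 2 + 3 * k then Put (Suc (fst r))
         else if 2 \<le> v \<and> v < 2 + 3 * k then
           moveops S (snd (snd r ! j)) (code S (fst (snd r ! j)) (S < \<tau> (3 + 3 * j)))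
             (\<tau> (2 + 3 * j)) (\<tau> (4 + 3 * j)) ! ((v - 2) mod 3)
         else Keep)"

definition sim_loop :: "tm \<Rightarrow> com" where
  "sim_loop M = Whl (\<lambda>\<tau>. \<tau> (2 + 3 * num_tapes M) \<noteq> Suc (num_states M)) (Act (sim_step M))"

definition simulator :: "tm \<Rightarrow> com" where
  "simulator M = sim_init (num_tapes M) (num_symbols M) ;; sim_loop M ;;
     rewind (num_symbols M) ;; find_mark (num_symbols M) ;; write_out (num_symbols M)"

section \<open>Correctness of the simulation\<close>

definition simrep :: "tm \<Rightarrow> config \<Rightarrow> store \<Rightarrow> bool" where
  "simrep M C s \<longleftrightarrow> length (snd C) = num_tapes M \<and> fst C \<le> num_states M \<and>
     s (2 + 3 * num_tapes M) = [Suc (fst C)] \<and> s 1 = [] \<and>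
     (\<forall>j < num_tapes M. trep (num_symbols M) (snd C ! j) (s (2 + 3 * j)) (s (3 + 3 * j)) (s (4 + 3 * j)))"

lemma wf_tm_transition:
  assumes "wf_tm M" "q < num_states M" "length rs = num_tapes M" "set rs \<subseteq> {..<num_symbols M}"
  shows "fst (transition M q rs) \<le> num_states M" "length (snd (transition M q rs)) = num_tapes M"
    "j < num_tapes M \<Longrightarrow> fst (snd (transition M q rs) ! j) < num_symbols M"
proof -
  obtain q' as where qa: "transition M q rs = (q', as)" by fastforce
  have *: "q' \<le> num_states M \<and> length as = num_tapes M \<and> fst ` set as \<subseteq> {..<num_symbols M}"
    using assms qa unfolding wf_tm_def by fastforce
  show "fst (transition M q rs) \<le> num_states M" "length (snd (transition M q rs)) = num_tapes M"
    using * qa by auto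
  show "fst (snd (transition M q rs) ! j) < num_symbols M" if "j < num_tapes M"
  proof -
    have "as ! j \<in> set as" using * that by simp
    then have "fst (as ! j) \<in> {..<num_symbols M}" using * by blast
    then show ?thesis by (simp add: qa)
  qed
qed

lemma symbol_of_less: "0 < S \<Longrightarrow> symbol_of S a < S"
  by (simp add: symbol_of_def)

lemma sim_step_bounded:
  assumes wf: "wf_tm M" and S': "2 * num_symbols M < S'" "Suc (num_states M) < S'"
  shows "bounded (3 + 3 * num_tapes M) S' (Act (sim_step M))"
proof -
  let ?S = "num_symbols M" let ?k = "num_tapes M"
  have S: "0 < ?S" using wf by (simp add: wf_tm_def)
  have "op_bounded S' (sim_step M \<tau> v) \<and> (3 + 3 * ?k \<le> v \<longrightarrow> sim_step M \<tau> v = Keep)" for \<tau> v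
  proof (cases "\<tau> (2 + 3 * ?k) = 0 \<or> num_states M \<le> \<tau> (2 + 3 * ?k) - 1")
    case True
    then show ?thesis by (simp add: sim_step_def Let_def)
  next
    case False
    define r where "r = transition M (\<tau> (2 + 3 * ?k) - 1) (map (\<lambda>j. symbol_of ?S (\<tau> (3 + 3 * j))) [0..<?k])"
    have q: "\<tau> (2 + 3 * ?k) - 1 < num_states M" using False by linarith
    have rs: "set (map (\<lambda>j. symbol_of ?S (\<tau> (3 + 3 * j))) [0..<?k]) \<subseteq> {..<?S}" using symbol_of_less[OF S] by auto
    note tr = wf_tm_transition[OF wf q _ rs, folded r_def, simplified]
    have eq: "sim_step M \<tau> v = (if v = 2 + 3 * ?k then Put (Suc (fst r))
         else if 2 \<le> v \<and> v < 2 + 3 * ?k then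
           moveops ?S (snd (snd r ! ((v - 2) div 3))) (code ?S (fst (snd r ! ((v - 2) div 3))) (?S < \<tau> (3 + 3 * ((v - 2) div 3))))
             (\<tau> (2 + 3 * ((v - 2) div 3))) (\<tau> (4 + 3 * ((v - 2) div 3))) ! ((v - 2) mod 3)
         else Keep)"
      unfolding sim_step_def Let_def r_def[symmetric] using False by simp
    have "op_bounded S' (moveops ?S (snd (snd r ! j)) (code ?S (fst (snd r ! j)) b) x y ! (i mod 3))"
      if "j < ?k" for j b x y i
      using code_bounds[OF tr(3)[OF that], of b] S S' by (intro moveops_bounded) auto
    moreover have "(v - 2) div 3 < ?k" if "2 \<le> v" "v < 2 + 3 * ?k"
      using that by (simp add: less_mult_imp_div_less mult.commute)
    ultimately show ?thesis unfolding eq using tr(1) S' by auto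
  qed
  then show ?thesis by simp
qed

lemma runs_sim_step:
  assumes wf: "wf_tm M" and q: "fst C < num_states M" and rep: "simrep M C s"
  shows "\<exists>s'. runs (Act (sim_step M)) s s' 1 \<and> simrep M (tm_step M C) s' \<and>
    (\<forall>v. length (s' v) \<le> Suc (length (s v)))"
proof -
  let ?S = "num_symbols M" let ?k = "num_tapes M"
  obtain q ts where C: "C = (q, ts)" by fastforce
  define s' where "s' = (\<lambda>v. apply_op (sim_step M (tops s) v) (s v))"
  have len: "length ts = ?k" and st: "s (2 + 3 * ?k) = [Suc q]" and s1: "s 1 = []"
    and tr: "\<And>j. j < ?k \<Longrightarrow> trep ?S (ts ! j) (s (2 + 3 * j)) (s (3 + 3 * j)) (s (4 + 3 * j))"
    using rep by (auto simp: simrep_def C)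
  have S: "0 < ?S" using wf by (simp add: wf_tm_def)
  have h: "tops s (3 + 3 * j) = code ?S (tape_read (ts ! j)) (snd (ts ! j) = 0) \<and> tape_read (ts ! j) < ?S"
    if "j < ?k" for j
    using tr[OF that] by (cases "ts ! j") (simp add: trep_def cell_def tops_def)
  have reads: "map (\<lambda>j. symbol_of ?S (tops s (3 + 3 * j))) [0..<?k] = map tape_read ts"
    by (rule nth_equalityI) (simp_all add: h len)
  define r where "r = transition M q (map tape_read ts)"
  have reads_le: "set (map tape_read ts) \<subseteq> {..<?S}"
  proof
    fix a assume "a \<in> set (map tape_read ts)"
    then obtain T where T: "T \<in> set ts" "a = tape_read T" by (auto simp only: set_map)
    obtain j where j: "j < length ts" "ts ! j = T" using T(1) by (auto simp only: in_set_conv_nth)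
    show "a \<in> {..<?S}" using h[of j] j len T(2) by simp
  qed
  have qQ: "q < num_states M" using q C by simp
  have tr': "fst r \<le> num_states M" "length (snd r) = ?k" "\<And>j. j < ?k \<Longrightarrow> fst (snd r ! j) < ?S"
    using wf_tm_transition[OF wf qQ _ reads_le] len by (simp_all add: r_def)
  have eq: "sim_step M (tops s) v = (if v = 2 + 3 * ?k then Put (Suc (fst r))
       else if 2 \<le> v \<and> v < 2 + 3 * ?k then
         moveops ?S (snd (snd r ! ((v - 2) div 3))) (code ?S (fst (snd r ! ((v - 2) div 3))) (?S < tops s (3 + 3 * ((v - 2) div 3))))
           (tops s (2 + 3 * ((v - 2) div 3))) (tops s (4 + 3 * ((v - 2) div 3))) ! ((v - 2) mod 3)
       else Keep)" for v
  proof -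
    have "tops s (2 + 3 * ?k) = Suc q" by (simp only: tops_def st cont_Cons)
    then show ?thesis unfolding sim_step_def Let_def using qQ reads r_def by simp
  qed
  have new: "tm_step M C = (fst r, map2 tape_act (snd r) ts)"
    using qQ by (simp add: C r_def case_prod_beta)
  have "trep ?S (map2 tape_act (snd r) ts ! j) (s' (2 + 3 * j)) (s' (3 + 3 * j)) (s' (4 + 3 * j))"
    if j: "j < ?k" for j
  proof -
    obtain a m where am: "snd r ! j = (a, m)" by fastforce
    have aS: "a < ?S" using tr'(3)[OF j] am by simp
    define u where "u = moveops ?S m (code ?S a (snd (ts ! j) = 0)) (cont (s (2 + 3 * j)) 0) (cont (s (4 + 3 * j)) 0)"
    have mk: "?S < tops s (3 + 3 * j) \<longleftrightarrow> snd (ts ! j) = 0" using h[OF j] by simp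
    have op: "sim_step M (tops s) (2 + 3 * j + i) = u ! i" if i: "i < 3" for i
    proof -
      have "(2 + 3 * j + i - 2) div 3 = j" "(2 + 3 * j + i - 2) mod 3 = i" using i by auto
      moreover have "2 + 3 * j + i \<noteq> 2 + 3 * ?k" "2 \<le> 2 + 3 * j + i" "2 + 3 * j + i < 2 + 3 * ?k"
        using i j by linarith+
      ultimately show ?thesis unfolding eq u_def by (simp only: am fst_conv snd_conv mk[unfolded tops_def] if_True if_False simp_thms tops_def)
    qed
    have e3: "3 + 3 * j = 2 + 3 * j + 1" and e4: "4 + 3 * j = 2 + 3 * j + 2" by simp_all
    have "sim_step M (tops s) (2 + 3 * j) = u ! 0" using op[of 0] by simp
    moreover have "sim_step M (tops s) (3 + 3 * j) = u ! 1" by (subst e3, rule op) simp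
    moreover have "sim_step M (tops s) (4 + 3 * j) = u ! 2" by (subst e4, rule op) simp
    moreover have "map2 tape_act (snd r) ts ! j = tape_act (a, m) (ts ! j)"
      using j len tr'(2) am by simp
    ultimately show ?thesis
      unfolding s'_def using trep_move[OF tr[OF j] aS refl u_def] by simp
  qed
  moreover have "s' 1 = []" using s1 by (simp add: s'_def eq)
  moreover have "s' (2 + 3 * ?k) = [Suc (fst r)]" unfolding s'_def eq st by simp
  ultimately have "simrep M (tm_step M C) s'"
    using tr'(1,2) len by (simp add: simrep_def new)
  moreover have "runs (Act (sim_step M)) s s' 1" by (rule runs_Act) (simp add: s'_def)
  moreover have "length (s' v) \<le> Suc (length (s v))" for v
    by (simp add: s'_def length_apply_op)
  ultimately show ?thesis by blast
qed

lemma runs_sim_loop: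
  assumes wf: "wf_tm M" and rep: "simrep M C s" and halt: "fst ((tm_step M ^^ n) C) = num_states M"
  shows "\<exists>s'. runs (sim_loop M) s s' (2 * n + 1) \<and> simrep M ((tm_step M ^^ n) C) s' \<and>
    (\<forall>v. length (s' v) \<le> length (s v) + n)"
  using rep halt
proof (induction n arbitrary: C s)
  case 0
  have "tops s (2 + 3 * num_tapes M) = Suc (num_states M)"
    using 0 by (simp add: simrep_def tops_def)
  then show ?case using 0 runs_Whl_False[of "\<lambda>\<tau>. \<tau> (2 + 3 * num_tapes M) \<noteq> Suc (num_states M)" s]
    unfolding sim_loop_def by (intro exI[of _ s]) auto
next
  case (Suc n)
  show ?case
  proof (cases "fst C = num_states M")
    case True
    obtain q ts where C: "C = (q, ts)" by fastforce
    have fixed: "tm_step M C = C" using True by (simp add: C)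
    have "(tm_step M ^^ n) C = C" "(tm_step M ^^ Suc n) C = C" by (rule funpow_fixed[of "tm_step M", OF fixed])+
    with Suc.IH[OF Suc.prems(1)] True obtain s' where "runs (sim_loop M) s s' (2 * n + 1)"
      "simrep M C s'" "\<forall>v. length (s' v) \<le> length (s v) + n" by auto
    then show ?thesis using \<open>(tm_step M ^^ Suc n) C = C\<close>
      by (intro exI[of _ s']) (auto elim: runs_weaken intro: le_SucI)
  next
    case False
    then have q: "fst C < num_states M" using Suc.prems(1) by (simp add: simrep_def)
    obtain s1 where s1: "runs (Act (sim_step M)) s s1 1" "simrep M (tm_step M C) s1"
      "\<forall>v. length (s1 v) \<le> Suc (length (s v))" using runs_sim_step[OF wf q Suc.prems(1)] by blast
    have "fst ((tm_step M ^^ n) (tm_step M C)) = num_states M"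
      using Suc.prems(2) by (simp add: funpow_swap1)
    from Suc.IH[OF s1(2) this] obtain s' where s': "runs (sim_loop M) s1 s' (2 * n + 1)"
      "simrep M ((tm_step M ^^ n) (tm_step M C)) s'" "\<forall>v. length (s' v) \<le> length (s1 v) + n" by blast
    have "tops s (2 + 3 * num_tapes M) \<noteq> Suc (num_states M)"
      using Suc.prems(1) q by (simp add: simrep_def tops_def)
    then have "runs (sim_loop M) s s' (Suc (1 + (2 * n + 1)))"
      unfolding sim_loop_def by (intro runs_Whl_True[OF _ s1(1)]) (use s'(1) in \<open>auto simp: sim_loop_def\<close>)
    moreover have "length (s' v) \<le> length (s v) + Suc n" for v
      using s1(3) s'(3) by (metis add_Suc_shift add_le_mono1 order_trans)
    ultimately show ?thesis using s'(2) by (intro exI[of _ s']) (auto simp: funpow_swap1)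
  qed
qed

lemma runs_sim_init:
  assumes wf: "wf_tm M"
  shows "\<exists>s. runs (sim_init (num_tapes M) (num_symbols M)) (init_store x) s (4 * length x + 5) \<and>
    simrep M (init_config M x) s \<and> s 5 = [] \<and> s 7 = []"
proof -
  let ?S = "num_symbols M" let ?k = "num_tapes M"
  have S: "3 \<le> ?S" and k: "2 \<le> ?k" using wf by (auto simp: wf_tm_def)
  define bs where "bs = map (\<lambda>b. Suc (bit_symbol b)) x"
  have bs: "map (\<lambda>x. if 1 \<le> x \<and> x \<le> 3 then x else 1) bs = bs" "0 \<notin> set bs"
    "map (\<lambda>x. if x < 3 then Suc x else 1) (map bit_symbol x) = bs"
    by (auto simp: bs_def bit_symbol_def)
  define s1 :: store where "s1 = (\<lambda>_. [])(2 := rev bs)"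
  define s2 :: store where "s2 = (\<lambda>_. [])(4 := bs)"
  define s where "s = (\<lambda>v. if v = 2 + 3 * ?k then [1]
       else if v = 4 then tl bs
       else if v = 3 then [(if cont bs 0 = 2 \<or> cont bs 0 = 3 then cont bs 0 else 1) + ?S]
       else if 2 \<le> v \<and> v < 2 + 3 * ?k \<and> v mod 3 = 0 then [1 + ?S]
       else [])"
  have r1: "runs (move 0 2 (\<lambda>x. if x < 3 then Suc x else 1)) (init_store x) s1 (2 * length x + 1)"
  proof (rule runs_move)
    show "s1 = (init_store x)(0 := [], 2 := rev (map (\<lambda>x. if x < 3 then Suc x else 1) (init_store x 0)) @ init_store x 2)"
      unfolding bs(3)[symmetric] s1_def by (auto simp: init_store_def fun_eq_iff rev_map)
  qed (auto simp: init_store_def bit_symbol_def)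
  have r2: "runs (move 2 4 (\<lambda>x. if 1 \<le> x \<and> x \<le> 3 then x else 1)) s1 s2 (2 * length x + 1)"
  proof (rule runs_move)
    show "s2 = s1(2 := [], 4 := rev (map (\<lambda>x. if 1 \<le> x \<and> x \<le> 3 then x else 1) (s1 2)) @ s1 4)"
      unfolding s1_def s2_def fun_upd_same rev_map[symmetric] bs(1) by (auto simp: fun_eq_iff)
  qed (auto simp: s1_def bs(2), simp add: bs_def)
  have "?k \<noteq> 0" using k by simp
  then have r3: "runs (Act (\<lambda>\<tau> v. if v = 2 + 3 * ?k then Push 1
       else if v = 4 then Pop
       else if v = 3 then Push ((if \<tau> 4 = 2 \<or> \<tau> 4 = 3 then \<tau> 4 else 1) + ?S)
       else if 2 \<le> v \<and> v < 2 + 3 * ?k \<and> v mod 3 = 0 then Push (1 + ?S)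
       else Keep)) s2 s 1"
    using k by (intro runs_Act) (auto simp: s2_def s_def fun_eq_iff tops_def)
  have run: "runs (sim_init ?k ?S) (init_store x) s (4 * length x + 5)"
    unfolding sim_init_def
    by (rule runs_weaken[OF runs_Seq[OF r1 runs_Seq[OF r2 r3]]]) simp
  have first: "s 3 = [cell ?S (fst (input_tape x)) 0]"
    by (cases x) (auto simp: s_def bs_def cell_def code_def input_tape_def bit_symbol_def)
  have s4: "cell_code ?S (cont (s 4) i) = cell ?S (fst (input_tape x)) (1 + int i)" for i
  proof -
    have "cont (tl bs) i = (if Suc i < length x then Suc (bit_symbol (x ! Suc i)) else 0)"
      unfolding cont_tl by (simp add: cont_def bs_def)
    moreover have "nat (1 + int i) = Suc i" by simp
    ultimately show ?thesis using S k
      by (simp add: s_def cell_def code_def input_tape_def cell_code_def bit_symbol_def)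
  qed
  have "trep ?S (snd (init_config M x) ! j) (s (2 + 3 * j)) (s (3 + 3 * j)) (s (4 + 3 * j))"
    if j: "j < ?k" for j
  proof (cases "j = 0")
    case True
    have "s 2 = []" using k by (simp add: s_def)
    moreover have "0 \<notin> set (s 4)" using bs(2) k by (auto simp: s_def) (metis list.sel(2) list.set_sel(2))
    ultimately show ?thesis using True first s4 S
      by (simp add: init_config_def trep_def) (auto simp: input_tape_def cell_def code_def cell_code_def bit_symbol_def)
  next
    case False
    have "snd (init_config M x) ! j = input_tape []"
      using False j by (simp add: init_config_def nth_Cons')
    moreover have "s (2 + 3 * j) = []" using False j by (auto simp: s_def) presburger+
    moreover have "s (4 + 3 * j) = []" using False j by (auto simp: s_def)
    moreover have "(3 + 3 * j) mod 3 = 0" by presburger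
    then have "s (3 + 3 * j) = [1 + ?S]" using False j by (auto simp: s_def)
    ultimately show ?thesis using S
      by (simp add: trep_def) (auto simp: input_tape_def cell_def code_def cell_code_def)
  qed
  moreover have "s (2 + 3 * ?k) = [1]" by (simp add: s_def)
  moreover have "s 1 = []" "s 5 = []" "s 7 = []" using k by (auto simp: s_def) 
  ultimately show ?thesis using run k by (intro exI[of _ s]) (simp add: simrep_def init_config_def)
qed

lemma FP_com_computes:
  assumes "f \<in> FP"
  shows "\<exists>k S c p. com_computes k S c f p"
proof -
  obtain M p where wf: "wf_tm M" and M: "\<And>x. tm_computes_within M x (f x) (poly p (length x))"
    using assms unfolding FP_def by blast
  let ?S = "num_symbols M" let ?k = "num_tapes M"
  have S: "3 \<le> ?S" and k: "2 \<le> ?k" using wf by (auto simp: wf_tm_def)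
  \<comment> \<open>Stack symbols are cell codes, at most twice the number of symbols, and
    successors of states, at most one more than the number of states.\<close>
  define S' where "S' = 2 * ?S + num_states M + 2"
  have b: "bounded (3 + 3 * ?k) S' (simulator M)"
  proof -
    have "bounded (3 + 3 * ?k) S' (sim_init ?k ?S)"
      using S k by (auto simp: sim_init_def S'_def intro!: bounded_move)
    moreover have "bounded (3 + 3 * ?k) S' (sim_loop M)"
      using sim_step_bounded[OF wf, of S'] by (simp add: sim_loop_def S'_def)
    moreover have "symbol_of ?S a < S'" for a
      using symbol_of_less[of ?S a] S by (simp add: S'_def)
    then have "bounded (3 + 3 * ?k) S' (rewind ?S)" "bounded (3 + 3 * ?k) S' (find_mark ?S)"
      "bounded (3 + 3 * ?k) S' (write_out ?S)"
      unfolding rewind_def find_mark_def write_out_def bounded.simps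
      using S k by (simp_all add: bounded_scan S'_def)
    ultimately show ?thesis by (simp add: simulator_def)
  qed
  define p' where "p' = [:40, 4:] + 20 * p"
  have "\<exists>s'. runs (simulator M) (init_store x) s' (poly p' (length x)) \<and> s' 1 = rev (map bit_symbol (f x))" for x
  proof -
    define T where "T = poly p (length x)"
    obtain q ts where C: "(tm_step M ^^ T) (init_config M x) = (q, ts)" by fastforce
    have q: "q = num_states M" and holds: "tape_holds (ts ! 1) (f x)"
      using M[of x] by (auto simp: tm_computes_within_def C T_def[symmetric])
    obtain s0 where s0: "runs (sim_init ?k ?S) (init_store x) s0 (4 * length x + 5)"
      "simrep M (init_config M x) s0" "s0 5 = []" "s0 7 = []" using runs_sim_init[OF wf] by blast
    have "fst ((tm_step M ^^ T) (init_config M x)) = num_states M" by (simp add: C q)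
    from runs_sim_loop[OF wf s0(2) this] obtain s1 where
      s1: "runs (sim_loop M) s0 s1 (2 * T + 1)" "simrep M (q, ts) s1" "length (s1 5) \<le> T" "length (s1 7) \<le> T"
      unfolding C using s0(3,4) by (metis add_0 list.size(3))
    obtain t h where th: "ts ! 1 = (t, h)" by fastforce
    have tr1: "trep ?S (t, h) (s1 5) (s1 6) (s1 7)" and s11: "s1 1 = []"
      using s1(2) k th unfolding simrep_def by (auto dest!: spec[of _ 1])
    obtain s2 where s2: "runs (rewind ?S) s1 s2 (2 * length (s1 5) + 1)"
      "trep ?S (t, h - int (length (s1 5))) [] (s2 6) (s2 7)" "s2 5 = []" "s2 1 = s1 1"
      "length (s2 7) = length (s1 5) + length (s1 7)"
      using runs_rewind[OF tr1] by blast
    have S0: "0 < ?S" using S by simp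
    define h' where "h' = h - int (length (s1 5))"
    have tS: "t i < ?S" for i using tr1 by (simp add: trep_def)
    \<comment> \<open>Otherwise the marked cell 0 would lie to the left of the head, where the empty
      left stack represents unmarked blanks only.\<close>
    have h'0: "h' \<le> 0"
    proof (rule ccontr)
      assume "\<not> h' \<le> 0"
      then have "h' - 1 - int (nat (h' - 1)) = 0" by simp
      moreover have "cell_code ?S (cont [] (nat (h' - 1))) = cell ?S t (h' - 1 - int (nat (h' - 1)))"
        using trep_left[OF s2(2)] by (simp only: h'_def)
      ultimately have "1 = cell ?S t 0" by (simp add: cell_code_def)
      then show False using S by (simp add: cell_def code_def)
    qed
    \<comment> \<open>Likewise the mark must be among the cells stored on the right stack, whose
      length is at most \<open>2 * T\<close>.\<close>
    have nh': "nat (- h') \<le> 2 * T"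
    proof (rule ccontr)
      assume "\<not> nat (- h') \<le> 2 * T"
      then have *: "length (s2 7) \<le> nat (- h' - 1)" "h' + 1 + int (nat (- h' - 1)) = 0"
        using s2(5) s1(3,4) by auto
      have "cell_code ?S (cont (s2 7) (nat (- h' - 1))) = cell ?S t (h' + 1 + int (nat (- h' - 1)))"
        using trep_right[OF s2(2)] by (simp only: h'_def)
      then have "1 = cell ?S t 0" using * by (simp add: cont_beyond cell_code_def)
      then show False using S by (simp add: cell_def code_def)
    qed
    have "trep ?S (t, - int (nat (- h'))) (s2 5) (s2 6) (s2 7)"
      using s2(2,3) h'0 by (simp add: h'_def)
    from runs_find_mark[OF this] obtain s3 where
      s3: "runs (find_mark ?S) s2 s3 (2 * nat (- h') + 1)" "trep ?S (t, 0) (s3 5) (s3 6) (s3 7)"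
        "s3 1 = s2 1" "length (s3 7) \<le> length (s2 7)" by blast
    have tout: "i < length (f x) \<Longrightarrow> t (int i) = bit_symbol (f x ! i)" "t (int (length (f x))) = 0" for i
      using holds unfolding th tape_holds_def by simp_all
    \<comment> \<open>A longer output would have a bit beyond the end of the right stack, where all
      cells are blank.\<close>
    have ylen: "length (f x) \<le> 2 * T + 1"
    proof (rule ccontr)
      assume "\<not> length (f x) \<le> 2 * T + 1"
      then have *: "length (s3 7) \<le> 2 * T" "t (int (Suc (2 * T))) \<noteq> 0"
        using s3(4) s2(5) s1(3,4) tout(1)[of "Suc (2 * T)"] by (auto simp: bit_symbol_def)
      have "cell_code ?S (cont (s3 7) (2 * T)) = cell ?S t (0 + 1 + int (2 * T))"
        using trep_right[OF s3(2)] by (simp only:)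
      moreover have "0 + 1 + int (2 * T) = int (Suc (2 * T))" by simp
      ultimately have "1 = cell ?S t (int (Suc (2 * T)))" using * by (simp add: cont_beyond cell_code_def)
      then show False using *(2) by (simp add: cell_def code_def)
    qed
    have "trep ?S (t, int 0) (s3 5) (s3 6) (s3 7)" using s3(2) by simp
    from runs_write_out[OF this, of "f x"] tout obtain s4 where
      s4: "runs (write_out ?S) s3 s4 (2 * length (f x) + 1)" "s4 1 = rev (map bit_symbol (f x)) @ s3 1"
      by auto
    have "runs (simulator M) (init_store x) s4 (poly p' (length x))"
      unfolding simulator_def
      by (rule runs_weaken[OF runs_Seq[OF s0(1) runs_Seq[OF s1(1) runs_Seq[OF s2(1) runs_Seq[OF s3(1) s4(1)]]]]])
        (use s1(3) nh' ylen in \<open>simp add: p'_def T_def[symmetric]\<close>)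
    then show ?thesis using s4(2) s3(3) s2(4) s11 by (intro exI[of _ s4]) simp
  qed
  then have "com_computes (3 + 3 * ?k) S' (simulator M) f p'"
    using b k S by (simp add: com_computes_def S'_def)
  then show ?thesis by blast
qed

section \<open>Composition\<close>

lemma poly_mono_nat: "a \<le> b \<Longrightarrow> poly (p :: nat poly) a \<le> poly p b"
  by (induction p) (auto intro: add_mono mult_mono)

lemma runs_store_ok:
  assumes "runs c s s' t" "bounded k S c" "store_ok k S s"
  shows "store_ok k S s'" "length (s' v) \<le> length (s v) + t"
proof -
  obtain t' where t': "t' \<le> t" "(cstep ^^ t') ([c], s) = ([], s')"
    using assms(1) unfolding runs_def by blast
  have *: "store_ok k S s'" "length (s' v) \<le> length (s v) + t'"
    using cstep_invariant[OF assms(2,3), of t'] unfolding t'(2) by auto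
  show "store_ok k S s'" "length (s' v) \<le> length (s v) + t"
    using * t'(1) by auto
qed

lemma ctl_append: "K \<noteq> [] \<Longrightarrow> ctl (K @ K') \<tau> = ctl K \<tau> @ K'"
  and ops_append: "K \<noteq> [] \<Longrightarrow> ops (K @ K') \<tau> = ops K \<tau>"
  by (cases K; cases "hd K"; auto)+

text \<open>A step looks only at the first command of the list, so a complete run can be replayed in
  front of any continuation.\<close>

lemma cstep_append:
  "(cstep ^^ t) (K1, s) = ([], s') \<Longrightarrow> \<exists>t' \<le> t. (cstep ^^ t') (K1 @ K, s) = (K, s')"
proof (induction t arbitrary: K1 s)
  case (Suc t)
  show ?case
  proof (cases "K1 = []")
    case True
    then show ?thesis using Suc.prems cstep_halted[of "Suc t" s] by (intro exI[of _ 0]) simp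
  next
    case False
    obtain t' where "t' \<le> t" "(cstep ^^ t') (fst (cstep (K1, s)) @ K, snd (cstep (K1, s))) = (K, s')"
      using Suc by (metis funpow_swap1 funpow.simps(2) o_apply prod.collapse)
    then show ?thesis using False
      by (intro exI[of _ "Suc t'"]) (simp add: funpow_swap1 cstep_pair ctl_append ops_append)
  qed
qed auto

lemma runs_from_Nil: "(cstep ^^ t') ([c], s) = ([], s') \<Longrightarrow> t' \<le> t \<Longrightarrow> runs c s s' t"
  unfolding runs_def using cstep_append[of t' "[c]" s s'] by (auto intro: order_trans)

text \<open>Renaming its stacks lets the second of two composed programs work above those of the
  first, whatever the first has left there.\<close>

fun shift :: "nat \<Rightarrow> com \<Rightarrow> com" where
  "shift d (Act F) = Act (\<lambda>\<tau> v. if v < d then Keep else F (\<lambda>u. \<tau> (u + d)) (v - d))"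
| "shift d (a ;; b) = shift d a ;; shift d b"
| "shift d (Whl P a) = Whl (\<lambda>\<tau>. P (\<lambda>u. \<tau> (u + d))) (shift d a)"

definition merge :: "nat \<Rightarrow> store \<Rightarrow> store \<Rightarrow> store" where
  "merge d s r = (\<lambda>v. if v < d then s v else r (v - d))"

lemma bounded_shift: "bounded k S c \<Longrightarrow> bounded (d + k) S (shift d c)"
  by (induction c) auto

lemma cstep_shift:
  "cstep (map (shift d) K, merge d s r) =
    (map (shift d) (fst (cstep (K, r))), merge d s (snd (cstep (K, r))))"
proof -
  have tops: "(\<lambda>u. tops (merge d s r) (u + d)) = tops r"
    by (simp add: tops_def merge_def fun_eq_iff)
  have "ctl (map (shift d) K) (tops (merge d s r)) = map (shift d) (ctl K (tops r))"
    by (cases K; cases "hd K") (auto simp: tops)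
  moreover have "(\<lambda>v. apply_op (ops (map (shift d) K) (tops (merge d s r)) v) (merge d s r v)) =
      merge d s (\<lambda>v. apply_op (ops K (tops r) v) (r v))"
    by (cases K; cases "hd K") (auto simp: tops fun_eq_iff, auto simp: merge_def)
  ultimately show ?thesis by (simp add: cstep_pair)
qed

lemma runs_shift:
  assumes "runs c r r' t"
  shows "runs (shift d c) (merge d s r) (merge d s r') t"
proof -
  obtain t' where t': "t' \<le> t" "(cstep ^^ t') ([c], r) = ([], r')"
    using assms unfolding runs_def by blast
  have "(cstep ^^ n) (map (shift d) K, merge d s r) =
    (map (shift d) (fst ((cstep ^^ n) (K, r))), merge d s (snd ((cstep ^^ n) (K, r))))" for n K r
    by (induction n arbitrary: K r) (simp_all add: funpow_swap1 cstep_shift)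
  from this[of t' "[c]" r] have "(cstep ^^ t') ([shift d c], merge d s r) = ([], merge d s r')"
    by (simp add: t'(2))
  then show ?thesis using t'(1) by (rule runs_from_Nil)
qed

text \<open>Boundedness is demanded for all tops, even those that never occur. Clamping restricts
  the pushed symbols without changing any symbol of an actual run.\<close>

definition bit_clamp :: "nat \<Rightarrow> nat" where
  "bit_clamp x = (if x = 2 then 2 else 1)"

lemma bit_clamp_simps [simp]: "bit_clamp (bit_symbol b) = bit_symbol b" "bit_clamp x \<noteq> 0"
    "map (bit_clamp \<circ> bit_symbol) bs = map bit_symbol bs" "0 < bit_clamp x"
  by (auto simp: bit_clamp_def bit_symbol_def)

lemma bit_clamp_less: "3 \<le> S \<Longrightarrow> bit_clamp x < S"
  by (auto simp: bit_clamp_def)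

lemma bit_symbol_nonzero [simp]: "0 \<notin> bit_symbol ` A" "bit_symbol b \<noteq> 0" "0 < bit_symbol b"
  by (auto simp: bit_symbol_def)

lemma FP_comp:
  assumes "f \<in> FP" "g \<in> FP"
  shows "g \<circ> f \<in> FP"
proof -
  obtain k1 S1 c1 p1 where "com_computes k1 S1 c1 f p1" using FP_com_computes[OF assms(1)] by blast
  then have k1: "2 \<le> k1" and S1: "3 \<le> S1" and b1: "bounded k1 S1 c1"
    and run1: "\<And>x. \<exists>s'. runs c1 (init_store x) s' (poly p1 (length x)) \<and> s' 1 = rev (map bit_symbol (f x))"
    by (auto simp: com_computes_def)
  obtain k2 S2 c2 p2 where "com_computes k2 S2 c2 g p2" using FP_com_computes[OF assms(2)] by blast
  then have k2: "2 \<le> k2" and S2: "3 \<le> S2" and b2: "bounded k2 S2 c2"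
    and run2: "\<And>x. \<exists>s'. runs c2 (init_store x) s' (poly p2 (length x)) \<and> s' 1 = rev (map bit_symbol (g x))"
    by (auto simp: com_computes_def)
  \<comment> \<open>The first move reverses the output of \<open>c1\<close> into an input with its
    first bit on top. The output of \<open>c2\<close> must arrive in reversed order, hence the two
    moves at the end, through the fresh stack \<open>k1 + k2\<close>.\<close>
  define c where "c = c1 ;; move 1 k1 bit_clamp ;; shift k1 c2 ;;
    move (k1 + 1) (k1 + k2) bit_clamp ;; move (k1 + k2) 1 bit_clamp"
  define S where "S = max S1 S2"
  define p where "p = [:20:] + 3 * p1 + 6 * pcompose p2 p1"
  have b: "bounded (k1 + k2 + 1) S c"
  proof -
    have "bounded (k1 + k2 + 1) S c1" by (rule bounded_mono[OF b1]) (auto simp: S_def)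
    moreover have "bounded (k1 + k2 + 1) S (shift k1 c2)"
      by (rule bounded_mono[OF bounded_shift[OF b2]]) (auto simp: S_def)
    ultimately show ?thesis using k1 k2 S1 bit_clamp_less[of S]
      by (auto simp: c_def S_def intro!: bounded_move)
  qed
  have "\<exists>s'. runs c (init_store x) s' (poly p (length x)) \<and> s' 1 = rev (map bit_symbol (g (f x)))" for x
  proof -
    obtain s1 where s1: "runs c1 (init_store x) s1 (poly p1 (length x))" "s1 1 = rev (map bit_symbol (f x))"
      using run1 by blast
    have "store_ok k1 S1 (init_store x)" using S1 k1 by (intro store_ok_init) auto
    note ok = runs_store_ok[OF s1(1) b1 this]
    \<comment> \<open>A stack gains at most one symbol per step, so the running time bounds the
      length of the output.\<close>
    have fx: "length (f x) \<le> poly p1 (length x)" using ok(2)[of 1] unfolding s1(2) by (simp add: init_store_def)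
    have empty1: "s1 v = []" if "k1 \<le> v" for v using ok(1) that by (simp add: store_ok_def)
    have s2: "runs (move 1 k1 bit_clamp) s1 (merge k1 (s1(1 := [])) (init_store (f x))) (2 * length (f x) + 1)"
    proof (rule runs_move)
      show "merge k1 (s1(1 := [])) (init_store (f x)) = s1(1 := [], k1 := rev (map bit_clamp (s1 1)) @ s1 k1)"
        using k1 by (auto simp: merge_def init_store_def s1(2) empty1 fun_eq_iff rev_map simp del: One_nat_def)
    qed (use k1 s1(2) in auto)
    obtain r where r: "runs c2 (init_store (f x)) r (poly p2 (length (f x)))" "r 1 = rev (map bit_symbol (g (f x)))"
      using run2 by blast
    have "store_ok k2 S2 (init_store (f x))" using S2 k2 by (intro store_ok_init) auto
    note ok2 = runs_store_ok[OF r(1) b2 this]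
    define T where "T = poly p2 (length (f x))"
    have T: "T \<le> poly p2 (poly p1 (length x))" unfolding T_def by (rule poly_mono_nat[OF fx])
    have gfx: "length (g (f x)) \<le> T" using ok2(2)[of 1] unfolding r(2) T_def by (simp add: init_store_def)
    define s3 where "s3 = merge k1 (s1(1 := [])) r"
    have s3: "runs (shift k1 c2) (merge k1 (s1(1 := [])) (init_store (f x))) s3 T"
      unfolding s3_def T_def by (rule runs_shift[OF r(1)])
    have s3v: "s3 (k1 + 1) = rev (map bit_symbol (g (f x)))" "s3 (k1 + k2) = []" "s3 1 = []"
      using k1 k2 r(2) ok2(1) by (auto simp: s3_def merge_def store_ok_def)
    define s4 where "s4 = s3(k1 + 1 := [], k1 + k2 := map bit_symbol (g (f x)))"
    have s4: "runs (move (k1 + 1) (k1 + k2) bit_clamp) s3 s4 (2 * T + 1)"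
      by (rule runs_move) (use k2 s3v gfx in \<open>auto simp: s4_def rev_map\<close>)
    define s5 where "s5 = s4(k1 + k2 := [], 1 := rev (map bit_symbol (g (f x))))"
    have s5: "runs (move (k1 + k2) 1 bit_clamp) s4 s5 (2 * T + 1)"
      by (rule runs_move) (use k1 k2 s3v gfx in \<open>auto simp: s4_def s5_def rev_map\<close>)
    have "runs c (init_store x) s5 (poly p (length x))"
      unfolding c_def
      by (rule runs_weaken[OF runs_Seq[OF s1(1) runs_Seq[OF s2 runs_Seq[OF s3 runs_Seq[OF s4 s5]]]]])
        (use fx T in \<open>simp add: p_def poly_pcompose\<close>)
    then show ?thesis by (intro exI[of _ s5]) (simp add: s5_def)
  qed
  then have "com_computes (k1 + k2 + 1) S c (g \<circ> f) p"
    using b k1 S1 by (simp add: com_computes_def S_def)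
  then show ?thesis by (rule com_computes_FP)
qed

section \<open>Decoding pairs and reading one bit\<close>

fun unpair :: "bool list \<Rightarrow> bool list \<times> bool list" where
  "unpair (a # b # z) = (if a = b then (a # fst (unpair z), snd (unpair z)) else ([], z))"
| "unpair _ = ([], [])"

lemma unpair_enc_pair [simp]: "unpair (enc_pair x y) = (x, y)"
  by (induction x) (simp_all add: enc_pair_def delimit_def)

text \<open>Each round consumes two bits. Stack 3 holds the first of them for the comparison, and a
  symbol on stack 2 ends the loop. An input that ends too early is treated like an end mark.\<close>

definition unpair_loop :: "bool \<Rightarrow> com" where
  "unpair_loop keep = Whl (\<lambda>\<tau>. \<tau> 2 = 0)
     (Act (\<lambda>\<tau> v. if v = 0 then Pop else if v = 3 \<and> \<tau> 0 \<noteq> 0 then Push (bit_clamp (\<tau> 0)) else Keep) ;;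
      Act (\<lambda>\<tau> v. if v = 0 then Pop
        else if \<tau> 0 \<noteq> 0 \<and> \<tau> 0 = \<tau> 3 then
          (if v = 3 then Pop else if v = 1 \<and> keep then Push (bit_clamp (\<tau> 0)) else Keep)
        else if v = 2 then Push 1 else Keep))"

lemma bit_symbol_inj [simp]: "bit_symbol a = bit_symbol b \<longleftrightarrow> a = b"
  by (auto simp: bit_symbol_def)

lemma runs_unpair_loop:
  assumes "s 0 = map bit_symbol z" "s 2 = []" "s 3 = []"
  shows "\<exists>s'. runs (unpair_loop keep) s s' (4 * length z + 6) \<and> s' 0 = map bit_symbol (snd (unpair z)) \<and>
    s' 1 = (if keep then rev (map bit_symbol (fst (unpair z))) else []) @ s 1"
proof -
  let ?a1 = "\<lambda>\<tau> v. if v = 0 then Pop else if v = 3 \<and> \<tau> 0 \<noteq> 0 then Push (bit_clamp (\<tau> 0)) else Keep"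
  let ?a2 = "\<lambda>\<tau> v. if v = 0 then Pop
        else if \<tau> 0 \<noteq> 0 \<and> \<tau> 0 = \<tau> 3 then
          (if v = 3 then Pop else if v = 1 \<and> keep then Push (bit_clamp (\<tau> 0)) else Keep)
        else if v = 2 then Push 1 else Keep"
  have body: "\<exists>s1 s2. runs (Act ?a1 ;; Act ?a2) s s2 3 \<and>
      s1 = (\<lambda>v. apply_op (?a1 (tops s) v) (s v)) \<and> s2 = (\<lambda>v. apply_op (?a2 (tops s1) v) (s1 v))" for s
    by (intro exI conjI runs_weaken[OF runs_Seq[OF runs_Act runs_Act]]) auto
  \<comment> \<open>The last round: the two symbols differ or fewer than two are left.\<close>
  have stop: "\<exists>s'. runs (unpair_loop keep) s s' 6 \<and> s' 0 = map bit_symbol y \<and> s' 1 = s 1"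
    if s: "s 2 = []" "s 3 = []" "tl (tl (s 0)) = map bit_symbol y"
      "cont (s 0) 1 = 0 \<or> cont (s 0) 0 \<noteq> cont (s 0) 1" "set (s 0) \<subseteq> range bit_symbol" for s y
  proof -
    obtain s1 s2 where 1: "runs (Act ?a1 ;; Act ?a2) s s2 3"
      and s1: "s1 = (\<lambda>v. apply_op (?a1 (tops s) v) (s v))" and s2: "s2 = (\<lambda>v. apply_op (?a2 (tops s1) v) (s1 v))"
      using body by blast
    have t1: "tops s1 0 = cont (s 0) 1" by (simp add: s1 tops_def cont_tl)
    have t3: "tops s1 3 = cont (s 0) 0"
      using s(2,5) by (cases "s 0") (auto simp: s1 tops_def)
    have s2v: "s2 0 = map bit_symbol y" "s2 2 = [1]" "s2 1 = s 1"
      using s by (auto simp: s2 t1 t3) (auto simp: s1)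
    have "runs (unpair_loop keep) s2 s2 1" unfolding unpair_loop_def
      by (rule runs_Whl_False) (simp add: tops_def s2v)
    then have "runs (unpair_loop keep) s s2 (Suc (3 + 1))"
      using 1 s(1) unfolding unpair_loop_def by (intro runs_Whl_True) (auto simp: tops_def)
    then have "runs (unpair_loop keep) s s2 6" by (rule runs_weaken) simp
    then show ?thesis using s2v by (intro exI[of _ s2]) auto
  qed
  show ?thesis using assms
  proof (induction z arbitrary: s rule: unpair.induct)
    case (1 a b z)
    show ?case
    proof (cases "a = b")
      case True
      obtain s1 s2 where run: "runs (Act ?a1 ;; Act ?a2) s s2 3"
        and s1: "s1 = (\<lambda>v. apply_op (?a1 (tops s) v) (s v))" and s2: "s2 = (\<lambda>v. apply_op (?a2 (tops s1) v) (s1 v))"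
        using body by blast
      have s1v: "s1 0 = bit_symbol a # map bit_symbol z" "s1 3 = [bit_symbol a]" "s1 2 = []" "s1 1 = s 1"
        using "1.prems" True by (auto simp: s1 tops_def)
      then have s2v: "s2 0 = map bit_symbol z" "s2 3 = []" "s2 2 = []"
        "s2 1 = (if keep then [bit_symbol a] else []) @ s 1"
        by (auto simp: s2 tops_def)
      from "1.IH"(1)[OF True s2v(1,3,2)] obtain s' where s': "runs (unpair_loop keep) s2 s' (4 * length z + 6)"
        "s' 0 = map bit_symbol (snd (unpair z))"
        "s' 1 = (if keep then rev (map bit_symbol (fst (unpair z))) else []) @ s2 1" by blast
      have "runs (unpair_loop keep) s s' (Suc (3 + (4 * length z + 6)))"
        using run s'(1) "1.prems"(2) unfolding unpair_loop_def by (intro runs_Whl_True) (auto simp: tops_def)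
      then have "runs (unpair_loop keep) s s' (4 * length (a # b # z) + 6)" by (rule runs_weaken) simp
      then show ?thesis using s' s2v True by (intro exI[of _ s']) auto
    next
      case False
      from stop[of s z] "1.prems" False obtain s' where "runs (unpair_loop keep) s s' 6"
        "s' 0 = map bit_symbol z" "s' 1 = s 1" by auto
      moreover from this have "runs (unpair_loop keep) s s' (4 * length (a # b # z) + 6)"
        by (auto intro: runs_weaken)
      ultimately show ?thesis using False by (intro exI[of _ s']) auto
    qed
  next
    case "2_1"
    then show ?case using stop[of s "[]"] by auto
  next
    case ("2_2" v)
    then obtain s' where "runs (unpair_loop keep) s s' 6" "s' 0 = []" "s' 1 = s 1"
      using stop[of s "[]"] by auto
    moreover from this have "runs (unpair_loop keep) s s' (4 * length [v] + 6)"
      by (auto intro: runs_weaken)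
    ultimately show ?case by (intro exI[of _ s']) auto
  qed
qed

lemma bounded_unpair_loop: "bounded 4 3 (unpair_loop keep)"
  using bit_clamp_less[of 3] by (simp add: unpair_loop_def)

lemma fst_unpair_FP: "(\<lambda>z. fst (unpair z)) \<in> FP"
proof -
  have "com_computes 4 3 (unpair_loop True) (\<lambda>z. fst (unpair z)) [:6, 4:]"
    unfolding com_computes_def
  proof (intro conjI allI)
    fix z
    have "init_store z 1 = []" by (simp add: init_store_def)
    then show "\<exists>s'. runs (unpair_loop True) (init_store z) s' (poly [:6, 4:] (length z)) \<and>
        s' 1 = rev (map bit_symbol (fst (unpair z)))"
      using runs_unpair_loop[of "init_store z" z True] by (auto simp: init_store_def algebra_simps)
  qed (simp_all add: bounded_unpair_loop)
  then show ?thesis by (rule com_computes_FP)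
qed

lemma length_snd_unpair: "length (snd (unpair z)) \<le> length z"
  by (induction z rule: unpair.induct) auto

lemma snd_unpair_FP: "(\<lambda>z. snd (unpair z)) \<in> FP"
proof -
  have "com_computes 4 3 (unpair_loop False ;; move 0 1 bit_clamp) (\<lambda>z. snd (unpair z)) [:8, 6:]"
    unfolding com_computes_def
  proof (intro conjI allI)
    fix z
    obtain s' where s': "runs (unpair_loop False) (init_store z) s' (4 * length z + 6)"
      "s' 0 = map bit_symbol (snd (unpair z))" "s' 1 = []"
      using runs_unpair_loop[of "init_store z" z False] by (auto simp: init_store_def)
    have "runs (move 0 1 bit_clamp) s' (s'(0 := [], 1 := rev (map bit_symbol (snd (unpair z))))) (2 * length (snd (unpair z)) + 1)"
      by (rule runs_move) (use s' in \<open>auto simp del: One_nat_def\<close>)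
    from runs_Seq[OF s'(1) this]
    have "runs (unpair_loop False ;; move 0 1 bit_clamp) (init_store z)
        (s'(0 := [], 1 := rev (map bit_symbol (snd (unpair z))))) (poly [:8, 6:] (length z))"
      by (rule runs_weaken) (use length_snd_unpair[of z] in simp)
    then show "\<exists>s'. runs (unpair_loop False ;; move 0 1 bit_clamp) (init_store z) s' (poly [:8, 6:] (length z)) \<and>
        s' 1 = rev (map bit_symbol (snd (unpair z)))"
      by (intro exI[of _ "s'(0 := [], 1 := rev (map bit_symbol (snd (unpair z))))"]) simp
  qed (use bounded_unpair_loop bit_clamp_less[of 3] in \<open>auto intro!: bounded_move\<close>)
  then show ?thesis by (rule com_computes_FP)
qed

section \<open>Reading a bit at a fixed position\<close>

definition skip :: com where
  "skip = Act (\<lambda>_ _. Keep)"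

fun seqs :: "com list \<Rightarrow> com" where
  "seqs [] = skip"
| "seqs (c # cs) = c ;; seqs cs"

lemma runs_skip: "runs skip s s 1"
  unfolding skip_def by (rule runs_Act) simp

lemma bounded_seqs: "(\<And>c. c \<in> set cs \<Longrightarrow> bounded k S c) \<Longrightarrow> bounded k S (seqs cs)"
  by (induction cs) (auto simp: skip_def)

lemma runs_pops: "runs (seqs (replicate n (upd v (\<lambda>_. Pop)))) s (s(v := drop n (s v))) (2 * n + 1)"
proof (induction n arbitrary: s)
  case 0
  then show ?case using runs_skip[of s] by simp
next
  case (Suc n)
  have "runs (upd v (\<lambda>_. Pop)) s (s(v := tl (s v))) 1" by (rule runs_upd) simp
  from runs_Seq[OF this Suc.IH] show ?case by (simp add: drop_Suc fun_upd_upd del: fun_upd_apply) simp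
qed

text \<open>The reductions read their answer off one bit of a solution. It is negated because a set
  bit will signify the escape, that is, a negative answer.\<close>

definition bit_clear :: "nat \<Rightarrow> bool list \<Rightarrow> bool" where
  "bit_clear n y \<longleftrightarrow> \<not> (n < length y \<and> y ! n)"

lemma bit_clear_FP: "(\<lambda>y. [bit_clear n y]) \<in> FP"
proof -
  let ?c = "seqs (replicate n (upd 0 (\<lambda>_. Pop))) ;; upd 1 (\<lambda>\<tau>. Push (if \<tau> 0 = 2 then 1 else 2))"
  have "com_computes 2 3 ?c (\<lambda>y. [bit_clear n y]) [:2 * n + 3:]"
    unfolding com_computes_def
  proof (intro conjI allI)
    fix y
    define s where "s = (init_store y)(0 := drop n (map bit_symbol y))"
    have "runs (seqs (replicate n (upd 0 (\<lambda>_. Pop)))) (init_store y) s (2 * n + 1)"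
      using runs_pops[of n 0 "init_store y"] by (simp add: s_def init_store_def)
    moreover have "runs (upd 1 (\<lambda>\<tau>. Push (if \<tau> 0 = 2 then 1 else 2))) s (s(1 := [bit_symbol (bit_clear n y)])) 1"
    proof (rule runs_upd)
      have "tops s 0 = 2 \<longleftrightarrow> \<not> bit_clear n y"
        by (auto simp: tops_def s_def cont_def bit_clear_def bit_symbol_def)
      then show "s(1 := [bit_symbol (bit_clear n y)]) = s(1 := apply_op (Push (if tops s 0 = 2 then 1 else 2)) (s 1))"
        by (simp add: bit_symbol_def s_def init_store_def)
    qed
    ultimately have "runs ?c (init_store y) (s(1 := [bit_symbol (bit_clear n y)])) (Suc (2 * n + 1 + 1))"
      by (rule runs_Seq)
    then have "runs ?c (init_store y) (s(1 := [bit_symbol (bit_clear n y)])) (poly [:2 * n + 3:] (length y))"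
      by (rule runs_weaken) simp
    then show "\<exists>s'. runs ?c (init_store y) s' (poly [:2 * n + 3:] (length y)) \<and>
        s' 1 = rev (map bit_symbol [bit_clear n y])"
      by (intro exI[of _ "s(1 := [bit_symbol (bit_clear n y)])"]) simp
  qed (auto intro!: bounded_upd bounded_seqs)
  then show ?thesis by (rule com_computes_FP)
qed

lemma PTIME_subset_NPTIME: "PTIME \<subseteq> NPTIME"
proof
  fix A assume "A \<in> PTIME"
  then have "(\<lambda>x. [x \<in> A]) \<in> FP" by (simp add: PTIME_def)
  from FP_comp[OF fst_unpair_FP this]
  have "{z. fst (unpair z) \<in> A} \<in> PTIME" by (simp add: PTIME_def o_def)
  then show "A \<in> NPTIME"
    unfolding NPTIME_def by (auto intro!: bexI[of _ "{z. fst (unpair z) \<in> A}"] exI[of _ 0] exI[of _ "[]"])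
qed

section \<open>Injectivity of the encodings\<close>

lemma enc_pair_inject: "enc_pair x y = enc_pair x' y' \<longleftrightarrow> x = x' \<and> y = y'"
  by (metis unpair_enc_pair prod.inject)

lemma enc_list_Cons: "enc_list e (x # xs) = enc_pair (e x) (enc_list e xs)"
  by (simp add: enc_list_def enc_pair_def)

lemma enc_list_eq_map: "enc_list e xs = enc_list e ys \<Longrightarrow> map e xs = map e ys"
proof (induction xs arbitrary: ys)
  case Nil
  then show ?case by (cases ys) (simp_all add: enc_list_def delimit_def)
next
  case (Cons x xs)
  show ?case
  proof (cases ys)
    case Nil
    then show ?thesis using Cons.prems by (simp add: enc_list_def delimit_def)
  next
    case (Cons y ys')
    then show ?thesis using Cons.prems Cons.IH[of ys'] by (simp add: enc_list_Cons enc_pair_inject)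
  qed
qed

lemma inj_enc_list: "inj e \<Longrightarrow> inj (enc_list e)"
  by (rule injI) (metis enc_list_eq_map inj_map_eq_map)

fun bits_val :: "bool list \<Rightarrow> nat" where
  "bits_val [] = 0"
| "bits_val (b # bs) = of_bool b + 2 * bits_val bs"

lemma bits_val_enc_nat: "bits_val (enc_nat n) = n"
proof (induction n rule: less_induct)
  case (less n)
  show ?case
    using less[of "n div 2"] by (subst enc_nat.simps) (auto simp: odd_two_times_div_two_succ)
qed

lemma inj_enc_int: "inj enc_int"
proof (rule injI)
  fix i j assume "enc_int i = enc_int j"
  then have "i < 0 \<longleftrightarrow> j < 0" "enc_nat (nat \<bar>i\<bar>) = enc_nat (nat \<bar>j\<bar>)"
    by (simp_all add: enc_int_def)
  from this(1) arg_cong[OF this(2), of bits_val] show "i = j"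
    by (auto simp: bits_val_enc_nat)
qed

lemma inj_enc_rat: "inj enc_rat"
proof (rule injI)
  fix r s assume "enc_rat r = enc_rat s"
  then have "quotient_of r = quotient_of s"
    by (auto simp: enc_rat_def enc_pair_inject split: prod.splits dest: injD[OF inj_enc_int])
  then show "r = s" by (rule quotient_of_inject)
qed

text \<open>A matrix without rows yields the empty list whatever its number of columns, so the list
  determines the matrix only if there is a row.\<close>

lemma mat_to_list_inject:
  assumes "mat_to_list A = mat_to_list B" "0 < dim_row A"
  shows "A = B"
proof (rule eq_matI)
  have rows: "dim_row A = dim_row B"
    using arg_cong[OF assms(1), of length] by (simp add: mat_to_list_def)
  have row: "map (\<lambda>j. A $$ (i, j)) [0..<dim_col A] = map (\<lambda>j. B $$ (i, j)) [0..<dim_col B]"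
    if "i < dim_row A" for i
    using arg_cong[OF assms(1), of "\<lambda>l. l ! i"] that rows by (simp add: mat_to_list_def)
  show "dim_row A = dim_row B" by (rule rows)
  show cols: "dim_col A = dim_col B"
    using arg_cong[OF row[OF assms(2)], of length] by simp
  show "A $$ (i, j) = B $$ (i, j)" if "i < dim_row B" "j < dim_col B" for i j
    using arg_cong[OF row[of i], of "\<lambda>l. l ! j"] that rows cols by simp
qed

lemma enc_mats_inject:
  assumes "enc_mats As = enc_mats Bs" "\<And>A. A \<in> set As \<Longrightarrow> 0 < dim_row A"
  shows "As = Bs"
proof -
  have eq: "map enc_mat As = map enc_mat Bs"
    using assms(1) unfolding enc_mats_def by (rule enc_list_eq_map)
  then have len: "length As = length Bs" by (rule map_eq_imp_length_eq)
  have "As ! i = Bs ! i" if "i < length As" for i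
  proof (rule mat_to_list_inject)
    have "enc_mat (As ! i) = enc_mat (Bs ! i)"
      using arg_cong[OF eq, of "\<lambda>l. l ! i"] that len by simp
    then show "mat_to_list (As ! i) = mat_to_list (Bs ! i)"
      unfolding enc_mat_def by (rule injD[OF inj_enc_list[OF inj_enc_list[OF inj_enc_rat]]])
  qed (use assms(2) that in simp)
  with len show ?thesis by (rule nth_equalityI)
qed

text \<open>The problems are sets of code words, so a code word must not stand for two instances.
  The positive widths in \<open>soblap_instances\<close> exclude matrices without rows.\<close>

lemma enc_instance_inject:
  assumes "I \<in> soblap_instances L" "enc_instance I = enc_instance J"
  shows "I = J"
proof -
  obtain WA WB where I: "I = (WA, WB)" by fastforce
  obtain VA VB where J: "J = (VA, VB)" by fastforce
  have pos: "0 < dim_row A" if "A \<in> set WA \<or> A \<in> set WB" for A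
  proof -
    obtain d where d: "\<forall>l \<le> L. 0 < d l" "\<forall>k < L. WA ! k \<in> carrier_mat (d (Suc k)) (d k) \<and> WB ! k \<in> carrier_mat (d (Suc k)) (d k)"
      "length WA = L" "length WB = L"
      using assms(1) by (auto simp: soblap_instances_def I)
    have "\<exists>k < L. A = WA ! k \<or> A = WB ! k"
      using that d(3,4) by (metis in_set_conv_nth)
    then show ?thesis using d(1,2) by (metis Suc_leI carrier_matD(1))
  qed
  have "enc_mats WA = enc_mats VA" "enc_mats WB = enc_mats VB"
    using assms(2) by (simp_all add: I J enc_pair_inject)
  then show ?thesis using enc_mats_inject pos by (auto simp: I J)
qed

section \<open>A gap instance from a tiling problem\<close>

text \<open>
  Cells are numbered consecutively, with \<open>m\<close> cells in a row of the grid; \<open>R1\<close> relates the tiles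
  of horizontally and \<open>R2\<close> those of vertically adjacent cells, and \<open>ok a g\<close> says that tile \<open>g\<close> is
  allowed in a cell of class \<open>a\<close>. Classes from 7 onwards mark the first cell.
\<close>

definition link :: "nat \<Rightarrow> nat \<Rightarrow> nat \<Rightarrow> nat" where
  "link m c c' = (if c' = c then 2 else if c' = c + 1 then 3 else if c' = c + m then 4 else 1)"

text \<open>Index \<open>c * G + g\<close> stands for the pair of cell \<open>c\<close> and tile
  \<open>g\<close>. Entries depend on the cells only through the class of the first one and the link
  between them, so a table of constant size describes matrices of every size.\<close>

definition blocks :: "nat \<Rightarrow> nat \<Rightarrow> nat list \<Rightarrow> (nat \<Rightarrow> nat \<Rightarrow> nat \<Rightarrow> nat \<Rightarrow> 'a) \<Rightarrow> 'a mat" where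
  "blocks G m u e = mat (length u * G) (length u * G)
     (\<lambda>(i, j). e (u ! (i div G)) (link m (i div G) (j div G)) (i mod G) (j mod G))"

text \<open>Only the slots, the rows with \<open>g = 0\<close>, count: the column that
  \<open>P\<^sub>1\<close> assigns to the slot of a cell is the tile chosen there. All reward sits
  in the first cell, 1 for the joker and \<open>K\<close> for any other tile. A first slot that
  leaves its block forfeits the reward, any other pays \<open>K\<close>.\<close>

definition choice_entry :: "rat \<Rightarrow> nat \<Rightarrow> nat \<Rightarrow> nat \<Rightarrow> nat \<Rightarrow> rat" where
  "choice_entry K a d g g' =
     (if g \<noteq> 0 then 0
      else if 7 \<le> a then (if d = 2 then (if g' = 0 then 1 else K) else 0)
      else (if d = 2 then 0 else - K))"

text \<open>As \<open>A2\<close>, this masks the bilinear term, so that only pairs of slots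
  contribute.\<close>

definition slot_entry :: "nat \<Rightarrow> nat \<Rightarrow> nat \<Rightarrow> nat \<Rightarrow> rat" where
  "slot_entry a d g g' = (if g = 0 \<and> g' = 0 then 1 else 0)"

text \<open>The identity matrix, put in block form so that the printer of block matrices serves for
  it too.\<close>

definition unit_entry :: "nat \<Rightarrow> nat \<Rightarrow> nat \<Rightarrow> nat \<Rightarrow> rat" where
  "unit_entry a d g g' = (if d = 2 \<and> g = g' then 1 else 0)"

text \<open>The clause \<open>g \<noteq> g'\<close> within one cell makes \<open>P\<^sub>2\<close> a
  copy of \<open>P\<^sub>1\<close>; the other clauses are the constraints on tilings.\<close>

definition conflict_entry ::
  "rat \<Rightarrow> (nat \<Rightarrow> nat \<Rightarrow> bool) \<Rightarrow> (nat \<Rightarrow> nat \<Rightarrow> bool) \<Rightarrow> (nat \<Rightarrow> nat \<Rightarrow> bool) \<Rightarrow>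
    nat \<Rightarrow> nat \<Rightarrow> nat \<Rightarrow> nat \<Rightarrow> rat" where
  "conflict_entry K ok R1 R2 a d g g' =
     (if d = 2 \<and> (g \<noteq> g' \<or> \<not> ok a g) \<or> d = 3 \<and> \<not> R1 g g' \<or> d = 4 \<and> \<not> R2 g g' then - K else 0)"

definition tiling ::
  "nat \<Rightarrow> nat \<Rightarrow> nat list \<Rightarrow> (nat \<Rightarrow> nat \<Rightarrow> bool) \<Rightarrow> (nat \<Rightarrow> nat \<Rightarrow> bool) \<Rightarrow> (nat \<Rightarrow> nat \<Rightarrow> bool) \<Rightarrow>
    (nat \<Rightarrow> nat) \<Rightarrow> bool" where
  "tiling G m u ok R1 R2 \<sigma> \<longleftrightarrow>
     (\<forall>c < length u. \<sigma> c < G \<and> ok (u ! c) (\<sigma> c)) \<and>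
     (\<forall>c. c + 1 < length u \<longrightarrow> R1 (\<sigma> c) (\<sigma> (c + 1))) \<and>
     (\<forall>c. c + m < length u \<longrightarrow> R2 (\<sigma> c) (\<sigma> (c + m)))"

section \<open>Permutation matrices and sums over slots\<close>

definition perm_mat :: "nat \<Rightarrow> (nat \<Rightarrow> nat) \<Rightarrow> 'a :: comm_ring_1 mat" where
  "perm_mat n \<pi> = mat n n (\<lambda>(i, j). if j = \<pi> i then 1 else 0)"

lemma perm_mat_mult:
  assumes "A \<in> carrier_mat n c" "\<pi> permutes {..<n}"
  shows "perm_mat n \<pi> * A = mat n c (\<lambda>(i, j). A $$ (\<pi> i, j))"
proof (rule eq_matI)
  fix i j assume "i < dim_row (mat n c (\<lambda>(i, j). A $$ (\<pi> i, j)))" "j < dim_col (mat n c (\<lambda>(i, j). A $$ (\<pi> i, j)))"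
  then have ij: "i < n" "j < c" by auto
  have "\<pi> i < n" using permutes_in_image[OF assms(2), of i] ij by simp
  then have "(\<Sum>l = 0..<n. (if l = \<pi> i then 1 else 0) * A $$ (l, j)) = A $$ (\<pi> i, j)"
    by (subst sum.remove[of _ "\<pi> i"]) auto
  then show "(perm_mat n \<pi> * A) $$ (i, j) = mat n c (\<lambda>(i, j). A $$ (\<pi> i, j)) $$ (i, j)"
    using ij assms(1) by (simp add: perm_mat_def scalar_prod_def)
qed (use assms in \<open>auto simp: perm_mat_def\<close>)

lemma mult_perm_mat_transpose:
  assumes "A \<in> carrier_mat r n" "\<pi> permutes {..<n}"
  shows "A * transpose_mat (perm_mat n \<pi>) = mat r n (\<lambda>(i, j). A $$ (i, \<pi> j))"
proof (rule eq_matI)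
  fix i j assume "i < dim_row (mat r n (\<lambda>(i, j). A $$ (i, \<pi> j)))" "j < dim_col (mat r n (\<lambda>(i, j). A $$ (i, \<pi> j)))"
  then have ij: "i < r" "j < n" by auto
  have "\<pi> j < n" using permutes_in_image[OF assms(2), of j] ij by simp
  then have "(\<Sum>l = 0..<n. A $$ (i, l) * (if l = \<pi> j then 1 else 0)) = A $$ (i, \<pi> j)"
    by (subst sum.remove[of _ "\<pi> j"]) auto
  then show "(A * transpose_mat (perm_mat n \<pi>)) $$ (i, j) = mat r n (\<lambda>(i, j). A $$ (i, \<pi> j)) $$ (i, j)"
    using ij assms(1) by (simp add: perm_mat_def scalar_prod_def)
qed (use assms in \<open>auto simp: perm_mat_def\<close>)

lemma perm_matrices_iff: "P \<in> perm_matrices n \<longleftrightarrow> (\<exists>\<pi>. \<pi> permutes {..<n} \<and> P = perm_mat n \<pi>)"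
  by (auto simp: perm_matrices_def perm_mat_def)

lemma frobenius_zero: "frobenius (0\<^sub>m r c) X = 0"
  by (simp add: frobenius_def)

lemma sum_slots:
  fixes f :: "nat \<Rightarrow> 'a :: comm_monoid_add"
  assumes "0 < G" "\<And>i. i < N * G \<Longrightarrow> i mod G \<noteq> 0 \<Longrightarrow> f i = 0"
  shows "(\<Sum>i < N * G. f i) = (\<Sum>c < N. f (c * G))"
proof -
  have "(\<Sum>c < N. f (c * G)) = sum f ((\<lambda>c. c * G) ` {..<N})"
    using assms(1) by (subst sum.reindex) (auto simp: inj_on_def)
  also have "\<dots> = (\<Sum>i < N * G. f i)"
  proof (rule sum.mono_neutral_left)
    show "\<forall>i \<in> {..<N * G} - (\<lambda>c. c * G) ` {..<N}. f i = 0"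
    proof
      fix i assume i: "i \<in> {..<N * G} - (\<lambda>c. c * G) ` {..<N}"
      have "i mod G \<noteq> 0"
      proof
        assume "i mod G = 0"
        then have "i = i div G * G" by (metis add_0_right div_mult_mod_eq)
        moreover have "i div G < N" using i by (simp add: less_mult_imp_div_less)
        ultimately show False using i by blast
      qed
      then show "f i = 0" using assms(2) i by simp
    qed
  qed (use assms(1) in auto)
  finally show ?thesis by simp
qed

lemma involution_permutes: "(\<And>x. x \<notin> S \<Longrightarrow> p x = x) \<Longrightarrow> (\<And>x. p (p x) = x) \<Longrightarrow> p permutes S"
  unfolding permutes_def by metis

locale gap =
  fixes G m L :: nat and u :: "nat list" and ok R1 R2 :: "nat \<Rightarrow> nat \<Rightarrow> bool" and K :: rat
  assumes G: "0 < G" and m: "2 \<le> m" and L: "2 < L" and K: "1 \<le> K"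
    and first: "\<And>c. c < length u \<Longrightarrow> 7 \<le> u ! c \<longleftrightarrow> c = 0" and u: "u \<noteq> []"
begin

abbreviation "N \<equiv> length u"
abbreviation "n \<equiv> N * G"
abbreviation "A1 \<equiv> blocks G m u (choice_entry K)"
abbreviation "A2 \<equiv> blocks G m u slot_entry"
abbreviation "B2 \<equiv> blocks G m u (conflict_entry K ok R1 R2)"

text \<open>From the third layer on the matrices vanish, so the first two permutations alone
  determine the value. The layers that fill up the depth to \<open>L\<close> have width 1.\<close>

definition WA :: "rat mat list" where
  "WA = [A1, A2, 0\<^sub>m 1 n] @ replicate (L - 3) (0\<^sub>m 1 1)"

definition WB :: "rat mat list" where
  "WB = [blocks G m u unit_entry, B2, 0\<^sub>m 1 n] @ replicate (L - 3) (0\<^sub>m 1 1)"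

lemma N: "0 < N"
  using u by simp

lemma slot_less: "c < N \<Longrightarrow> c * G < n"
  using G by simp

lemma div_less: "i < n \<Longrightarrow> i div G < N"
  by (simp add: less_mult_imp_div_less)

lemma blocks_carrier [simp]: "blocks G m u e \<in> carrier_mat n n"
  by (simp add: blocks_def)

lemma blocks_index:
  "i < n \<Longrightarrow> j < n \<Longrightarrow> blocks G m u e $$ (i, j) =
     e (u ! (i div G)) (link m (i div G) (j div G)) (i mod G) (j mod G)"
  by (simp add: blocks_def)

lemma unit_blocks: "blocks G m u unit_entry = 1\<^sub>m n"
proof (rule eq_matI)
  fix i j assume ij: "i < dim_row (1\<^sub>m n :: rat mat)" "j < dim_col (1\<^sub>m n :: rat mat)"
  have "j div G = i div G \<and> i mod G = j mod G \<longleftrightarrow> i = j"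
    by (metis div_mult_mod_eq)
  then show "blocks G m u unit_entry $$ (i, j) = 1\<^sub>m n $$ (i, j)"
    using ij by (auto simp: blocks_index unit_entry_def link_def)
qed (auto simp: blocks_def)

lemma instance_in: "(WA, WB) \<in> soblap_instances L"
proof -
  define d :: "nat \<Rightarrow> nat" where "d = (\<lambda>l. if l \<le> 2 then n else 1)"
  have "WA ! k \<in> carrier_mat (d (Suc k)) (d k) \<and> WB ! k \<in> carrier_mat (d (Suc k)) (d k)"
    if k: "k < L" for k
  proof -
    consider "k = 0" | "k = 1" | "k = 2" | "3 \<le> k" by linarith
    then show ?thesis
    proof cases
      case 4
      then obtain j where j: "k = Suc (Suc (Suc j))" "j < L - 3" using k
        by (metis L One_nat_def Suc_less_eq add_2_eq_Suc' less_diff_conv less_iff_Suc_add numeral_3_eq_3 plus_1_eq_Suc le_iff_add add.commute add_Suc_right)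
      then show ?thesis by (simp add: WA_def WB_def d_def)
    qed (auto simp: WA_def WB_def d_def numeral_2_eq_2)
  qed
  moreover have "\<forall>l \<le> L. 0 < d l" using G N by (simp add: d_def)
  moreover have "length WA = L" "length WB = L" using L by (auto simp: WA_def WB_def)
  ultimately show ?thesis by (auto simp: soblap_instances_def)
qed

definition solution :: "(nat \<Rightarrow> nat) \<Rightarrow> (nat \<Rightarrow> nat) \<Rightarrow> rat mat list \<Rightarrow> bool" where
  "solution \<pi>1 \<pi>2 Ps \<longleftrightarrow> \<pi>1 permutes {..<n} \<and> \<pi>2 permutes {..<n} \<and>
     Ps \<in> soblap_solutions (WA, WB) \<and> Ps ! 0 = perm_mat n \<pi>1 \<and> Ps ! 1 = perm_mat n \<pi>2"

lemma solution_exists: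
  assumes "\<pi>1 permutes {..<n}" "\<pi>2 permutes {..<n}"
  shows "\<exists>Ps. solution \<pi>1 \<pi>2 Ps"
proof -
  define Ps where "Ps = [perm_mat n \<pi>1, perm_mat n \<pi>2] @ replicate (L - 3) (perm_mat 1 id :: rat mat)"
  have "Ps ! k \<in> perm_matrices (dim_row (WB ! k))" if k: "k < L - 1" for k
  proof -
    consider "k = 0" | "k = 1" | "2 \<le> k" by linarith
    then show ?thesis
    proof cases
      case 3
      have "WB ! k = (if k = 2 then 0\<^sub>m 1 n else 0\<^sub>m 1 1)"
        using 3 k by (auto simp: WB_def nth_append nth_Cons' numeral_3_eq_3)
      moreover have "Ps ! k = perm_mat 1 id" using 3 k by (auto simp: Ps_def nth_append)
      ultimately show ?thesis unfolding perm_matrices_iff by (auto intro!: exI[of _ id] permutes_id)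
    qed (use assms in \<open>auto simp: perm_matrices_iff Ps_def WB_def blocks_def\<close>)
  qed
  moreover have "length Ps = length WB - 1" "length WB = L" using L by (auto simp: Ps_def WB_def)
  ultimately have "Ps \<in> soblap_solutions (WA, WB)" by simp
  then show ?thesis using assms by (intro exI[of _ Ps]) (simp add: solution_def Ps_def)
qed

lemma solution_cases:
  assumes "Ps \<in> soblap_solutions (WA, WB)"
  shows "\<exists>\<pi>1 \<pi>2. solution \<pi>1 \<pi>2 Ps"
proof -
  have "length WB = L" using L by (simp add: WB_def)
  then have *: "Ps ! k \<in> perm_matrices (dim_row (WB ! k))" if "k < 2" for k using assms L that by simp
  have "Ps ! 0 \<in> perm_matrices n" "Ps ! 1 \<in> perm_matrices n"
    using *[of 0] *[of 1] by (simp_all add: WB_def blocks_def)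
  then show ?thesis using assms unfolding perm_matrices_iff solution_def by blast
qed

lemma solution_00: "solution \<pi>1 \<pi>2 Ps \<Longrightarrow> Ps ! 0 $$ (0, 0) = 1 \<longleftrightarrow> \<pi>1 0 = 0"
  using N G by (auto simp: solution_def perm_mat_def)

text \<open>Rows that are not slots vanish in \<open>A1\<close> and \<open>A2\<close>. What remains
  of the linear term is the choice of \<open>\<pi>1\<close> in each cell, and the bilinear term
  compares each choice of \<open>\<pi>2\<close> with each choice of \<open>\<pi>1\<close>.\<close>

lemma value_eq:
  assumes "solution \<pi>1 \<pi>2 Ps"
  shows "soblap_value (WA, WB) Ps =
    (\<Sum>c < N. A1 $$ (c * G, \<pi>1 (c * G))) + (\<Sum>c < N. \<Sum>c' < N. B2 $$ (\<pi>2 (c * G), \<pi>1 (c' * G)))"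
proof -
  have p1: "\<pi>1 permutes {..<n}" and p2: "\<pi>2 permutes {..<n}"
    and P0: "Ps ! 0 = perm_mat n \<pi>1" and P1: "Ps ! 1 = perm_mat n \<pi>2" using assms by (auto simp: solution_def)
  have in1: "\<pi>1 i < n" if "i < n" for i using permutes_in_image[OF p1, of i] that by simp
  have in2: "\<pi>2 i < n" if "i < n" for i using permutes_in_image[OF p2, of i] that by simp
  have len: "length WA = L" using L by (simp add: WA_def)
  have z: "\<exists>r c. WA ! k = 0\<^sub>m r c" if "2 \<le> k" "k < L" for k
    using that by (auto simp: WA_def nth_append nth_Cons' numeral_3_eq_3)
  have zero: "frobenius (WA ! k) X = 0" if "2 \<le> k" "k < L" for k X
    using z[OF that] by (auto simp: frobenius_zero)
  have "(\<Sum>k = 1..<L - 1. frobenius (WA ! k) (Ps ! k * WB ! k * transpose_mat (Ps ! (k - 1)))) =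
      frobenius (WA ! 1) (Ps ! 1 * WB ! 1 * transpose_mat (Ps ! 0)) +
      (\<Sum>k = 2..<L - 1. frobenius (WA ! k) (Ps ! k * WB ! k * transpose_mat (Ps ! (k - 1))))"
    using L by (subst sum.atLeast_Suc_lessThan) (auto simp: numeral_2_eq_2)
  also have "(\<Sum>k = 2..<L - 1. frobenius (WA ! k) (Ps ! k * WB ! k * transpose_mat (Ps ! (k - 1)))) = 0"
    by (rule sum.neutral, rule ballI, rule zero) auto
  finally have "soblap_value (WA, WB) Ps = frobenius A1 (perm_mat n \<pi>1 * blocks G m u unit_entry) +
      frobenius A2 (perm_mat n \<pi>2 * B2 * transpose_mat (perm_mat n \<pi>1))"
    using zero[of "L - 1"] L P0 P1 by (simp add: len) (simp add: WA_def WB_def)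
  moreover have "frobenius A1 (perm_mat n \<pi>1 * blocks G m u unit_entry) = (\<Sum>c < N. A1 $$ (c * G, \<pi>1 (c * G)))"
  proof -
    have "frobenius A1 (perm_mat n \<pi>1 * blocks G m u unit_entry) = (\<Sum>i < n. A1 $$ (i, \<pi>1 i))"
    proof -
      have "frobenius A1 (perm_mat n \<pi>1 * blocks G m u unit_entry) =
          (\<Sum>i < n. \<Sum>j < n. A1 $$ (i, j) * (if j = \<pi>1 i then 1 else 0))"
        unfolding unit_blocks using right_mult_one_mat[of "perm_mat n \<pi>1 :: rat mat" n n]
        by (simp add: frobenius_def perm_mat_def blocks_def)
      also have "\<dots> = (\<Sum>i < n. A1 $$ (i, \<pi>1 i))"
      proof (rule sum.cong[OF refl])
        fix i assume "i \<in> {..<n}"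
        then show "(\<Sum>j < n. A1 $$ (i, j) * (if j = \<pi>1 i then 1 else 0)) = A1 $$ (i, \<pi>1 i)"
          using in1[of i] by (subst sum.remove[of _ "\<pi>1 i"]) auto
      qed
      finally show ?thesis .
    qed
    also have "\<dots> = (\<Sum>c < N. A1 $$ (c * G, \<pi>1 (c * G)))"
      by (rule sum_slots[OF G]) (simp add: blocks_index in1 choice_entry_def)
    finally show ?thesis .
  qed
  moreover have "frobenius A2 (perm_mat n \<pi>2 * B2 * transpose_mat (perm_mat n \<pi>1)) =
      (\<Sum>c < N. \<Sum>c' < N. B2 $$ (\<pi>2 (c * G), \<pi>1 (c' * G)))"
  proof -
    have X: "perm_mat n \<pi>2 * B2 * transpose_mat (perm_mat n \<pi>1) = mat n n (\<lambda>(i, j). B2 $$ (\<pi>2 i, \<pi>1 j))"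
    proof -
      have "perm_mat n \<pi>2 * B2 = mat n n (\<lambda>(i, j). B2 $$ (\<pi>2 i, j))"
        by (rule perm_mat_mult[OF _ p2]) simp
      then show ?thesis
        by (simp add: mult_perm_mat_transpose[OF _ p1, of _ n]) (rule eq_matI; simp add: in1)
    qed
    have "frobenius A2 (perm_mat n \<pi>2 * B2 * transpose_mat (perm_mat n \<pi>1)) =
        (\<Sum>i < n. \<Sum>j < n. A2 $$ (i, j) * B2 $$ (\<pi>2 i, \<pi>1 j))"
      unfolding X by (simp add: frobenius_def blocks_def)
    also have "\<dots> = (\<Sum>c < N. \<Sum>j < n. A2 $$ (c * G, j) * B2 $$ (\<pi>2 (c * G), \<pi>1 j))"
      by (rule sum_slots[OF G]) (simp add: blocks_index slot_entry_def)
    also have "\<dots> = (\<Sum>c < N. \<Sum>c' < N. A2 $$ (c * G, c' * G) * B2 $$ (\<pi>2 (c * G), \<pi>1 (c' * G)))"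
    proof (rule sum.cong[OF refl])
      fix c assume "c \<in> {..<N}"
      then show "(\<Sum>j < n. A2 $$ (c * G, j) * B2 $$ (\<pi>2 (c * G), \<pi>1 j)) =
          (\<Sum>c' < N. A2 $$ (c * G, c' * G) * B2 $$ (\<pi>2 (c * G), \<pi>1 (c' * G)))"
        using slot_less by (intro sum_slots[OF G]) (simp add: blocks_index slot_entry_def)
    qed
    also have "\<dots> = (\<Sum>c < N. \<Sum>c' < N. B2 $$ (\<pi>2 (c * G), \<pi>1 (c' * G)))"
      by (intro sum.cong refl) (simp add: blocks_index G slot_entry_def)
    finally show ?thesis .
  qed
  ultimately show ?thesis by simp
qed

lemma B2_cases: "i < n \<Longrightarrow> j < n \<Longrightarrow> B2 $$ (i, j) = 0 \<or> B2 $$ (i, j) = - K"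
  by (simp add: blocks_index conflict_entry_def)

lemma A1_cases: "0 < c \<Longrightarrow> c < N \<Longrightarrow> j < n \<Longrightarrow> A1 $$ (c * G, j) = (if j div G = c then 0 else - K)"
  using first[of c] G by (auto simp: blocks_index slot_less choice_entry_def link_def)

lemma A1_first: "j < n \<Longrightarrow> A1 $$ (0, j) = (if j = 0 then 1 else if j div G = 0 then K else 0)"
  using first[of 0] N G slot_less[of 0] div_mult_mod_eq[of j G]
  by (auto simp: blocks_index choice_entry_def link_def)

text \<open>The reward of the first cell is then exactly 1, and every other term is
  nonpositive.\<close>

lemma value_escape:
  assumes "Ps \<in> soblap_solutions (WA, WB)" "Ps ! 0 $$ (0, 0) = 1"
  shows "soblap_value (WA, WB) Ps \<le> 1"
proof -
  obtain \<pi>1 \<pi>2 where sol: "solution \<pi>1 \<pi>2 Ps" using solution_cases[OF assms(1)] by blast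
  then have 0: "\<pi>1 0 = 0" using solution_00 assms(2) by blast
  have in1: "\<pi>1 i < n" and in2: "\<pi>2 i < n" if "i < n" for i
    using sol that permutes_in_image[of _ "{..<n}" i] by (auto simp: solution_def)
  have "(\<Sum>c < N. A1 $$ (c * G, \<pi>1 (c * G))) =
      A1 $$ (0, \<pi>1 0) + (\<Sum>c \<in> {..<N} - {0}. A1 $$ (c * G, \<pi>1 (c * G)))"
    using N by (subst sum.remove[of _ 0]) auto
  moreover have "(\<Sum>c \<in> {..<N} - {0}. A1 $$ (c * G, \<pi>1 (c * G))) \<le> 0"
    using A1_cases in1 slot_less K by (intro sum_nonpos) auto
  moreover have "(\<Sum>c < N. \<Sum>c' < N. B2 $$ (\<pi>2 (c * G), \<pi>1 (c' * G))) \<le> 0"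
  proof (intro sum_nonpos)
    fix c c' assume "c \<in> {..<N}" "c' \<in> {..<N}"
    then show "B2 $$ (\<pi>2 (c * G), \<pi>1 (c' * G)) \<le> 0"
      using B2_cases[OF in2[OF slot_less] in1[OF slot_less], of c c'] K by auto
  qed
  moreover have "A1 $$ (0, \<pi>1 0) = 1" using A1_first[of 0] N G 0 by simp
  ultimately show ?thesis unfolding value_eq[OF sol] by linarith
qed

text \<open>Without the escape the reward is 0 or \<open>K\<close> and each penalty is 0 or
  \<open>K\<close>. A positive value thus means that the reward is earned and that not a single
  penalty is paid.\<close>

lemma value_no_escape:
  assumes "Ps \<in> soblap_solutions (WA, WB)" "Ps ! 0 $$ (0, 0) \<noteq> 1" "0 < soblap_value (WA, WB) Ps"
  shows "\<exists>\<sigma>. tiling G m u ok R1 R2 \<sigma> \<and> \<sigma> 0 \<noteq> 0"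
proof -
  obtain \<pi>1 \<pi>2 where sol: "solution \<pi>1 \<pi>2 Ps" using solution_cases[OF assms(1)] by blast
  then have ne: "\<pi>1 0 \<noteq> 0" using solution_00 assms(2) by blast
  have p1: "\<pi>1 permutes {..<n}" and p2: "\<pi>2 permutes {..<n}" using sol by (auto simp: solution_def)
  have in1: "\<pi>1 i < n" if "i < n" for i using permutes_in_image[OF p1, of i] that by simp
  have in2: "\<pi>2 i < n" if "i < n" for i using permutes_in_image[OF p2, of i] that by simp
  have n0: "0 < n" using N G by simp
  define x where "x = (\<lambda>c. - A1 $$ (c * G, \<pi>1 (c * G)))"
  define y where "y = (\<lambda>(c, c'). - B2 $$ (\<pi>2 (c * G), \<pi>1 (c' * G)))"
  have x: "x c = (if \<pi>1 (c * G) div G = c then 0 else K)" if "0 < c" "c < N" for c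
    using A1_cases[OF that in1[OF slot_less[OF that(2)]]] by (simp add: x_def)
  have y: "y (c, c') = 0 \<or> y (c, c') = K" if "c < N" "c' < N" for c c'
    using B2_cases[OF in2[OF slot_less[OF that(1)]] in1[OF slot_less[OF that(2)]]] by (auto simp: y_def)
  have x0: "0 \<le> x c" if "c \<in> {..<N} - {0}" for c using x[of c] that K by auto
  have y0: "0 \<le> y p" if "p \<in> {..<N} \<times> {..<N}" for p using y[of "fst p" "snd p"] that K by auto
  have val: "soblap_value (WA, WB) Ps = A1 $$ (0, \<pi>1 0) - sum x ({..<N} - {0}) - sum y ({..<N} \<times> {..<N})"
  proof -
    have "(\<Sum>c < N. A1 $$ (c * G, \<pi>1 (c * G))) = A1 $$ (0, \<pi>1 0) - sum x ({..<N} - {0})"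
      using N by (subst sum.remove[of _ 0]) (auto simp: x_def sum_negf)
    moreover have "sum y ({..<N} \<times> {..<N}) = - (\<Sum>c < N. \<Sum>c' < N. B2 $$ (\<pi>2 (c * G), \<pi>1 (c' * G)))"
      by (simp add: y_def sum.cartesian_product[symmetric] sum_negf)
    ultimately show ?thesis unfolding value_eq[OF sol] by simp
  qed
  have sx: "0 \<le> sum x ({..<N} - {0})" using x0 by (rule sum_nonneg)
  have sy: "0 \<le> sum y ({..<N} \<times> {..<N})" using y0 by (rule sum_nonneg)
  have A0: "A1 $$ (0, \<pi>1 0) = (if \<pi>1 0 div G = 0 then K else 0)"
    using A1_first[OF in1[OF n0]] ne by simp
  have blk0: "\<pi>1 0 div G = 0" using A0 val sx sy assms(3) by (auto split: if_splits)
  have lt: "sum x ({..<N} - {0}) + sum y ({..<N} \<times> {..<N}) < K"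
    using A0 blk0 val assms(3) by simp
  have blk: "\<pi>1 (c * G) div G = c" if "c < N" for c
  proof (cases "c = 0")
    case True
    then show ?thesis using blk0 by simp
  next
    case False
    have "x c \<le> sum x ({..<N} - {0})"
      using x0 False that by (intro member_le_sum) auto
    then have "x c \<noteq> K" using lt sy by linarith
    then show ?thesis using x[of c] False that by (auto split: if_splits)
  qed
  have B0: "B2 $$ (\<pi>2 (c * G), \<pi>1 (c' * G)) = 0" if "c < N" "c' < N" for c c'
  proof -
    have "y (c, c') \<le> sum y ({..<N} \<times> {..<N})"
      using y0 that by (intro member_le_sum) auto
    then have "y (c, c') \<noteq> K" using lt sx by linarith
    then show ?thesis using y[OF that] by (auto simp: y_def)
  qed
  \<comment> \<open>The cell in whose block \<open>\<pi>2\<close> chooses for cell \<open>c\<close>.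
    It may differ from \<open>c\<close>, since only \<open>\<pi>1\<close> is held to the blocks by
    the linear term.\<close>
  define f where "f = (\<lambda>c. \<pi>2 (c * G) div G)"
  have f: "f c < N" if "c < N" for c using div_less in2 slot_less that by (simp add: f_def)
  have diag: "\<pi>2 (c * G) = \<pi>1 (f c * G)" if c: "c < N" for c
  proof -
    have fc: "\<pi>2 (c * G) div G = f c" by (simp add: f_def)
    have "B2 $$ (\<pi>2 (c * G), \<pi>1 (f c * G)) = 0" using B0[OF c f[OF c]] .
    then have "conflict_entry K ok R1 R2 (u ! f c) 2 (\<pi>2 (c * G) mod G) (\<pi>1 (f c * G) mod G) = 0"
      using blocks_index[OF in2[OF slot_less[OF c]] in1[OF slot_less[OF f[OF c]]], of "conflict_entry K ok R1 R2"] blk[OF f[OF c]]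
      by (simp add: fc link_def)
    then have "\<pi>2 (c * G) mod G = \<pi>1 (f c * G) mod G"
      using K by (auto simp: conflict_entry_def split: if_splits)
    moreover have "\<pi>2 (c * G) div G = \<pi>1 (f c * G) div G" using blk[OF f[OF c]] by (simp add: f_def)
    ultimately show ?thesis by (metis div_mult_mod_eq)
  qed
  \<comment> \<open>As \<open>f\<close> permutes the cells, \<open>\<pi>2\<close> chooses exactly
    the tiles that \<open>\<pi>1\<close> chooses. Hence the absence of penalties also says that the
    choices of \<open>\<pi>1\<close> do not conflict with each other.\<close>
  have "inj_on f {..<N}"
  proof (rule inj_onI)
    fix c c' assume "c \<in> {..<N}" "c' \<in> {..<N}" "f c = f c'"
    then have "\<pi>2 (c * G) = \<pi>2 (c' * G)" using diag by simp
    then have "c * G = c' * G" using permutes_inj[OF p2] by (simp add: inj_eq)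
    then show "c = c'" using G by simp
  qed
  then have surj: "f ` {..<N} = {..<N}" using f by (intro endo_inj_surj) auto
  define \<sigma> where "\<sigma> = (\<lambda>c. \<pi>1 (c * G) mod G)"
  have entry: "conflict_entry K ok R1 R2 (u ! b) (link m b b') (\<sigma> b) (\<sigma> b') = 0" if bb: "b < N" "b' < N" for b b'
  proof -
    obtain c where c: "c < N" "f c = b" using surj bb(1) by (metis image_iff lessThan_iff)
    have "B2 $$ (\<pi>1 (b * G), \<pi>1 (b' * G)) = 0" using B0[OF c(1) bb(2)] diag[OF c(1)] c(2) by simp
    then show ?thesis
      using blocks_index[OF in1[OF slot_less[OF bb(1)]] in1[OF slot_less[OF bb(2)]], of "conflict_entry K ok R1 R2"] blk bb by (simp add: \<sigma>_def)
  qed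
  have "ok (u ! c) (\<sigma> c)" if "c < N" for c
    using entry[OF that that] K by (auto simp: conflict_entry_def link_def split: if_splits)
  moreover have "R1 (\<sigma> c) (\<sigma> (c + 1))" if "c + 1 < N" for c
    using entry[of c "c + 1"] that K by (auto simp: conflict_entry_def link_def split: if_splits)
  moreover have "R2 (\<sigma> c) (\<sigma> (c + m))" if "c + m < N" for c
    using entry[of c "c + m"] that K m by (auto simp: conflict_entry_def link_def split: if_splits)
  ultimately have "tiling G m u ok R1 R2 \<sigma>" using G by (simp add: tiling_def \<sigma>_def)
  moreover have "\<sigma> 0 \<noteq> 0" using ne blk0 div_mult_mod_eq[of "\<pi>1 0" G] by (auto simp: \<sigma>_def)
  ultimately show ?thesis by blast
qed

lemma tiling_value:
  assumes \<sigma>: "tiling G m u ok R1 R2 \<sigma>"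
  shows "\<exists>Ps \<in> soblap_solutions (WA, WB). soblap_value (WA, WB) Ps = (if \<sigma> 0 = 0 then 1 else K)"
proof -
  have \<sigma>G: "\<sigma> c < G" if "c < N" for c using \<sigma> that by (simp add: tiling_def)
  \<comment> \<open>In each block the slot is swapped with the chosen tile. The result is an
    involution, hence a permutation, and it serves for both \<open>P\<^sub>1\<close> and
    \<open>P\<^sub>2\<close>.\<close>
  define \<pi> where "\<pi> = (\<lambda>i. if i < n then i div G * G + Transposition.transpose 0 (\<sigma> (i div G)) (i mod G) else i)"
  have tr: "Transposition.transpose 0 (\<sigma> (i div G)) (i mod G) < G" if "i < n" for i
    using \<sigma>G[OF div_less[OF that]] G by (auto simp: Transposition.transpose_def)
  have dm: "\<pi> i div G = i div G" "\<pi> i mod G = Transposition.transpose 0 (\<sigma> (i div G)) (i mod G)" if "i < n" for i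
    using tr[OF that] that G by (simp_all add: \<pi>_def)
  have less: "\<pi> i < n" if "i < n" for i
  proof -
    have "\<pi> i div G < N" using div_less[OF that] dm(1)[OF that] by simp
    then show ?thesis using G by (simp add: div_less_iff_less_mult)
  qed
  have perm: "\<pi> permutes {..<n}"
  proof (rule involution_permutes)
    fix i
    show "\<pi> (\<pi> i) = i"
    proof (cases "i < n")
      case True
      then have "\<pi> (\<pi> i) = \<pi> i div G * G + Transposition.transpose 0 (\<sigma> (\<pi> i div G)) (\<pi> i mod G)"
        using less by (simp add: \<pi>_def)
      then show ?thesis using dm[OF True] by simp
    qed (simp add: \<pi>_def)
  qed (simp add: \<pi>_def)
  obtain Ps where sol: "solution \<pi> \<pi> Ps" using solution_exists[OF perm perm] by blast
  have \<pi>slot: "\<pi> (c * G) = c * G + \<sigma> c" if "c < N" for c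
    using slot_less[OF that] G by (simp add: \<pi>_def)
  have slot_div: "(c * G + \<sigma> c) div G = c" if "c < N" for c using \<sigma>G[OF that] by simp
  have "B2 $$ (\<pi> (c * G), \<pi> (c' * G)) = 0" if c: "c < N" "c' < N" for c c'
  proof -
    have "conflict_entry K ok R1 R2 (u ! c) (link m c c') (\<sigma> c) (\<sigma> c') = 0"
      using \<sigma> c by (auto simp: conflict_entry_def link_def tiling_def)
    then show ?thesis
      using blocks_index[OF less[OF slot_less[OF c(1)]] less[OF slot_less[OF c(2)]], of "conflict_entry K ok R1 R2"] \<sigma>G c
      by (simp add: \<pi>slot slot_div)
  qed
  then have "(\<Sum>c < N. \<Sum>c' < N. B2 $$ (\<pi> (c * G), \<pi> (c' * G))) = 0" by simp
  moreover have "(\<Sum>c < N. A1 $$ (c * G, \<pi> (c * G))) = A1 $$ (0, \<pi> 0) + (\<Sum>c \<in> {..<N} - {0}. A1 $$ (c * G, \<pi> (c * G)))"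
    using N by (subst sum.remove[of _ 0]) auto
  moreover have "(\<Sum>c \<in> {..<N} - {0}. A1 $$ (c * G, \<pi> (c * G))) = 0"
  proof (rule sum.neutral, rule ballI)
    fix c assume "c \<in> {..<N} - {0}"
    then have c: "0 < c" "c < N" by auto
    then show "A1 $$ (c * G, \<pi> (c * G)) = 0"
      using A1_cases[OF c less[OF slot_less[OF c(2)]]] \<pi>slot[OF c(2)] slot_div[OF c(2)] by simp
  qed
  moreover have "A1 $$ (0, \<pi> 0) = (if \<sigma> 0 = 0 then 1 else K)"
  proof -
    have "\<pi> 0 = \<sigma> 0" "\<sigma> 0 div G = 0" using \<pi>slot[OF N] \<sigma>G[OF N] by simp_all
    moreover have "0 < n" using N G by simp
    ultimately show ?thesis using A1_first[OF less[of 0]] by simp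
  qed
  ultimately have "soblap_value (WA, WB) Ps = (if \<sigma> 0 = 0 then 1 else K)"
    unfolding value_eq[OF sol] by simp
  then show ?thesis using sol by (auto simp: solution_def)
qed

end

lemma finite_soblap_solutions: "finite (soblap_solutions I)"
proof -
  obtain WA WB where I: "I = (WA, WB)" by fastforce
  let ?X = "\<Union>k < length WB - 1. (perm_matrices (dim_row (WB ! k)) :: 'a mat set)"
  have "perm_matrices k = (\<lambda>\<pi>. perm_mat k \<pi> :: 'a mat) ` {\<pi>. \<pi> permutes {..<k}}" for k
    by (auto simp: perm_matrices_iff)
  then have "finite (perm_matrices k :: 'a mat set)" for k by (simp add: finite_permutations)
  then have "finite {Ps. set Ps \<subseteq> ?X \<and> length Ps = length WB - 1}"
    by (intro finite_lists_length_eq) auto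
  moreover have "soblap_solutions I \<subseteq> {Ps. set Ps \<subseteq> ?X \<and> length Ps = length WB - 1}"
    by (fastforce simp: I in_set_conv_nth)
  ultimately show ?thesis by (rule finite_subset[rotated])
qed

section \<open>Computations as tilings\<close>

text \<open>
  The cell in row \<open>t\<close> and column \<open>i\<close> holds the symbols at depth \<open>i\<close> of all stacks after \<open>t\<close>
  steps, together with its two horizontal neighbours and with the control state and the
  stack tops that determine the next step. Column 0 is marked as the edge.
\<close>

datatype tile = Tile
  (t_ctl: "com list") (t_top: "nat \<Rightarrow> nat") (t_edge: bool)
  (t_left: "nat \<Rightarrow> nat") (t_mid: "nat \<Rightarrow> nat") (t_right: "nat \<Rightarrow> nat")

text \<open>An edge tile shows the tops themselves. The last condition says that below the end of a
  stack everything is empty: it fixes \<open>t_right\<close> in the last column, which has no right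
  neighbour, and it keeps a guessed certificate free of gaps.\<close>

definition tiles :: "com \<Rightarrow> nat \<Rightarrow> nat \<Rightarrow> tile set" where
  "tiles c k S = {T. t_ctl T \<in> insert [] (reach c []) \<and> t_top T \<in> tuples k S \<and>
     t_left T \<in> tuples k S \<and> t_mid T \<in> tuples k S \<and> t_right T \<in> tuples k S \<and>
     (t_edge T \<longrightarrow> t_mid T = t_top T) \<and> (\<forall>v. t_mid T v = 0 \<longrightarrow> t_right T v = 0)}"

text \<open>After one operation the symbol at depth \<open>i\<close> is determined by those at
  depths \<open>i - 1\<close>, \<open>i\<close> and \<open>i + 1\<close> before it, with depth 0 as
  a special case. This locality is why stacks suit a tiling.\<close>

fun nxt :: "op \<Rightarrow> bool \<Rightarrow> nat \<Rightarrow> nat \<Rightarrow> nat \<Rightarrow> nat" where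
  "nxt Keep e l x r = x"
| "nxt Pop e l x r = r"
| "nxt (Push a) e l x r = (if e then a else l)"
| "nxt (Put a) e l x r = (if e then a else x)"

text \<open>
  Cell classes: 1 and 2 are input bits, 3 is a free bit or blank, 4 is a blank of row 0;
  5 is unconstrained, 6 is the accepting cell, 7 and 8 are the first cell with its bit.
\<close>

definition allowed :: "com \<Rightarrow> nat \<Rightarrow> tile \<Rightarrow> bool" where
  "allowed c a T \<longleftrightarrow>
     (a \<le> 4 \<longrightarrow> \<not> t_edge T) \<and> (7 \<le> a \<longrightarrow> t_edge T \<and> t_ctl T = [c] \<and> t_mid T 0 = a - 6) \<and>
     (a \<noteq> 5 \<and> a \<noteq> 6 \<longrightarrow> (\<forall>v > 0. t_mid T v = 0)) \<and>
     (a \<le> 2 \<longrightarrow> t_mid T 0 = a) \<and> (a = 3 \<longrightarrow> t_mid T 0 \<le> 2) \<and> (a = 4 \<longrightarrow> t_mid T 0 = 0) \<and>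
     (a = 6 \<longrightarrow> t_ctl T = [] \<and> t_top T 1 = 2)"

text \<open>In the consecutive numbering the last cell of a row precedes the first of the next row.
  There the second tile is an edge, and nothing is demanded.\<close>

definition hor :: "tile \<Rightarrow> tile \<Rightarrow> bool" where
  "hor T T' \<longleftrightarrow> t_edge T' \<or> t_ctl T = t_ctl T' \<and> t_top T = t_top T' \<and>
     t_right T = t_mid T' \<and> t_left T' = t_mid T"

definition ver :: "tile \<Rightarrow> tile \<Rightarrow> bool" where
  "ver T T' \<longleftrightarrow> t_edge T = t_edge T' \<and> t_ctl T' = ctl (t_ctl T) (t_top T) \<and>
     t_mid T' = (\<lambda>v. nxt (ops (t_ctl T) (t_top T) v) (t_edge T) (t_left T v) (t_mid T v) (t_right T v))"

text \<open>Stacks grow by at most one symbol per step, so the \<open>t + 2\<close> blanks keep the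
  last column beyond the end of every stack during \<open>t\<close> steps.\<close>

definition row0 :: "bool list \<Rightarrow> nat \<Rightarrow> nat \<Rightarrow> nat list" where
  "row0 x p t = map bit_symbol x @ replicate p 3 @ replicate (t + 2) 4"

text \<open>The rows \<open>0\<close> to \<open>t\<close> are complete, while row
  \<open>t + 1\<close> consists of its first cell only: this is enough to check that the program has
  halted and accepted.\<close>

definition layout :: "bool list \<Rightarrow> nat \<Rightarrow> nat \<Rightarrow> nat list" where
  "layout x p t = (hd (row0 x p t) + 6) # tl (row0 x p t) @ replicate (length (row0 x p t) * t) 5 @ [6]"

lemma finite_tiles: "finite (tiles c k S)"
proof -
  let ?X = "insert [] (reach c []) \<times> tuples k S \<times> (UNIV :: bool set) \<times> tuples k S \<times> tuples k S \<times> tuples k S"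
  have "tiles c k S \<subseteq> (\<lambda>(a, b, e, l, x, r). Tile a b e l x r) ` ?X"
  proof
    fix T assume "T \<in> tiles c k S"
    then show "T \<in> (\<lambda>(a, b, e, l, x, r). Tile a b e l x r) ` ?X"
      by (intro image_eqI[of _ _ "(t_ctl T, t_top T, t_edge T, t_left T, t_mid T, t_right T)"])
        (auto simp: tiles_def)
  qed
  moreover have "finite ?X" by (simp add: finite_reach finite_tuples)
  ultimately show ?thesis using finite_surj by blast
qed

lemma nxt_cont:
  assumes "0 < i \<Longrightarrow> l = cont xs (i - 1)"
  shows "nxt x (i = 0) l (cont xs i) (cont xs (Suc i)) = cont (apply_op x xs) i"
  using assms by (cases x; cases i) (auto simp: cont_tl)

text \<open>\<open>x\<close> will be the delimited input and \<open>p\<close> the length allowed for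
  a certificate \<open>y\<close>; a pair is encoded as the concatenation, so the verifier runs on
  \<open>x @ y\<close>.\<close>

locale computation =
  fixes c :: com and k S :: nat and x :: "bool list" and p t :: nat
  assumes c: "bounded k S c" and k: "0 < k" and S: "3 \<le> S" and x: "x \<noteq> []"
begin

abbreviation "m \<equiv> length (row0 x p t)"
abbreviation "u \<equiv> layout x p t"

definition conf :: "bool list \<Rightarrow> nat \<Rightarrow> com list \<times> store" where
  "conf y n = (cstep ^^ n) ([c], init_store (x @ y))"

definition tiled :: "(nat \<Rightarrow> tile) \<Rightarrow> bool" where
  "tiled \<tau> \<longleftrightarrow> (\<forall>i < length u. \<tau> i \<in> tiles c k S \<and> allowed c (u ! i) (\<tau> i)) \<and>
     (\<forall>i. i + 1 < length u \<longrightarrow> hor (\<tau> i) (\<tau> (i + 1))) \<and>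
     (\<forall>i. i + m < length u \<longrightarrow> ver (\<tau> i) (\<tau> (i + m)))"

lemma m: "m = length x + p + t + 2"
  by (simp add: row0_def)

lemma length_u: "length u = m * (t + 1) + 1"
  by (simp add: layout_def m algebra_simps)

lemma u_row0: "0 < i \<Longrightarrow> i < m \<Longrightarrow> u ! i = row0 x p t ! i"
  by (cases i) (auto simp: layout_def nth_append nth_tl)

lemma u_first: "u ! 0 = bit_symbol (x ! 0) + 6"
  using x by (cases x) (auto simp: layout_def row0_def)

lemma u_last: "u ! (m * (t + 1)) = 6"
proof -
  have "u = (hd (row0 x p t) + 6) # (tl (row0 x p t) @ replicate (m * t) 5) @ [6]"
    by (simp add: layout_def)
  moreover have "m * (t + 1) = Suc (length (tl (row0 x p t) @ replicate (m * t) 5))"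
    by (simp add: m)
  ultimately show ?thesis by (metis nth_Cons_Suc nth_append_length)
qed

lemma u_mid: "m \<le> i \<Longrightarrow> i < m * (t + 1) \<Longrightarrow> u ! i = 5"
  by (cases i) (auto simp: layout_def nth_append m)

lemma row0_cases:
  "i < m \<Longrightarrow> row0 x p t ! i =
    (if i < length x then bit_symbol (x ! i) else if i < length x + p then 3 else 4)"
  by (auto simp: row0_def nth_append simp del: add_2_eq_Suc' replicate_Suc)

lemma conf_Suc: "conf y (Suc n) = cstep (conf y n)"
  by (simp add: conf_def)

lemma conf_props:
  "fst (conf y n) \<in> insert [] (reach c [])" "store_ok k S (snd (conf y n))"
  "length (snd (conf y n) v) \<le> length x + length y + n"
proof -
  have "length (init_store (x @ y) v) \<le> length x + length y" by (simp add: init_store_def)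
  then show "fst (conf y n) \<in> insert [] (reach c [])" "store_ok k S (snd (conf y n))"
    "length (snd (conf y n) v) \<le> length x + length y + n"
    using cstep_invariant[OF c store_ok_init[OF S k], of n "x @ y"] unfolding conf_def
    by (auto intro: order_trans)
qed

lemma row_start_less: "r \<le> t \<Longrightarrow> r * m + m < length u"
proof -
  assume "r \<le> t"
  then have "r * m \<le> t * m" by (rule mult_le_mono1)
  moreover have "m * (t + 1) = t * m + m" by simp
  ultimately show ?thesis unfolding length_u by linarith
qed

lemma row_less: "r * m + i < length u \<Longrightarrow> r \<le> t + 1"
proof (rule ccontr)
  assume "r * m + i < length u" "\<not> r \<le> t + 1"
  moreover from this have "(t + 2) * m \<le> r * m" by (intro mult_le_mono) auto
  ultimately show False unfolding length_u using m by (simp add: algebra_simps)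
qed

text \<open>The free cells hold bits or blanks, and after a blank only blanks can follow. So row 0
  spells the input followed by one certificate.\<close>

lemma tiled_row0:
  assumes "tiled \<tau>"
  shows "\<exists>y. length y \<le> p \<and> (\<forall>i < m. t_mid (\<tau> i) 0 = cont (map bit_symbol (x @ y)) i)"
proof -
  define f where "f = (\<lambda>i. t_mid (\<tau> i) 0)"
  have less: "i < length u" if "i < m" for i using that row_start_less[of 0] by simp
  have al: "allowed c (u ! i) (\<tau> i)" if "i < m" for i using assms less[OF that] by (simp add: tiled_def)
  have fx: "f i = bit_symbol (x ! i)" if "i < length x" for i
    using al[of i] that u_first u_row0[of i] row0_cases[of i] m
    by (cases "i = 0") (auto simp: allowed_def f_def bit_symbol_def split: if_splits)
  have edge: "\<not> t_edge (\<tau> i)" if "0 < i" "i < m" for i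
    using al[of i] that u_row0[of i] row0_cases[of i] by (auto simp: allowed_def bit_symbol_def split: if_splits)
  have x0: "0 < length x" using x by simp
  have f2: "f i \<le> 2" if "length x \<le> i" "i < length x + p" for i
    using al[of i] that u_row0[of i] row0_cases[of i] m x0 by (auto simp: allowed_def f_def)
  have f0: "f i = 0" if "length x + p \<le> i" "i < m" for i
    using al[of i] that u_row0[of i] row0_cases[of i] m x0 by (auto simp: allowed_def f_def)
  \<comment> \<open>The condition on \<open>t_mid\<close> and \<open>t_right\<close> in
    \<open>tiles\<close>, carried over to the next cell by \<open>hor\<close>.\<close>
  have closure: "f (Suc i) = 0" if "f i = 0" "Suc i < m" for i
  proof -
    have "hor (\<tau> i) (\<tau> (i + 1))" "\<tau> i \<in> tiles c k S"
      using assms less[OF that(2)] by (auto simp: tiled_def)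
    then show ?thesis using edge[of "Suc i"] that by (auto simp: hor_def tiles_def f_def)
  qed
  define ys where "ys = takeWhile (\<lambda>a. a \<noteq> 0) (map f [length x..<length x + p])"
  define y where "y = map (\<lambda>a. a = 2) ys"
  have len: "length y \<le> p" unfolding y_def ys_def
    using length_takeWhile_le[of _ "map f [length x..<length x + p]"] by simp
  have ynth: "f (length x + j) = bit_symbol (y ! j)" if "j < length y" for j
  proof -
    have j: "j < length ys" "j < p" using that len by (auto simp: y_def)
    have "ys ! j = f (length x + j)" using takeWhile_nth[of j _ "map f [length x..<length x + p]"] j
      by (simp add: ys_def)
    moreover have "ys ! j \<noteq> 0" using j(1) by (metis (mono_tags, lifting) nth_mem set_takeWhileD ys_def)
    moreover have "f (length x + j) \<le> 2" using f2 j by simp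
    ultimately show ?thesis using j by (auto simp: y_def bit_symbol_def)
  qed
  have ynth': "f i = bit_symbol (y ! (i - length x))" if "\<not> i < length x" "i < length x + length y" for i
    using ynth[of "i - length x"] that by simp
  have yend: "f (length x + length y) = 0"
  proof (cases "length y < p")
    case True
    then have "length ys < length (map f [length x..<length x + p])" by (simp add: y_def)
    then show ?thesis using nth_length_takeWhile[of "\<lambda>a. a \<noteq> 0" "map f [length x..<length x + p]", folded ys_def]
      by (simp add: y_def)
  next
    case False
    then show ?thesis using f0 len m by simp
  qed
  have "f i = 0" if "length x + length y \<le> i" "i < m" for i
    using that by (induction i rule: dec_induct) (use yend closure in auto)
  then have "\<forall>i < m. f i = cont (map bit_symbol (x @ y)) i"
    using fx ynth' by (auto simp: cont_def nth_append)
  then show ?thesis using len by (auto simp: f_def)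
qed

text \<open>Row \<open>r\<close> is forced to show the configuration after \<open>r\<close> steps.
  The horizontal constraints spread control state and tops along a row and tell each cell its
  neighbours; the vertical ones perform one step.\<close>

lemma tiled_sound:
  assumes tiled: "tiled \<tau>"
  shows "\<exists>y. length y \<le> p \<and> fst (conf y (t + 1)) = [] \<and> tops (snd (conf y (t + 1))) 1 = 2"
proof -
  obtain y where y: "length y \<le> p" and row0: "\<And>i. i < m \<Longrightarrow> t_mid (\<tau> i) 0 = cont (map bit_symbol (x @ y)) i"
    using tiled_row0[OF tiled] by blast
  have T: "\<tau> i \<in> tiles c k S" "allowed c (u ! i) (\<tau> i)" if "i < length u" for i
    using tiled that by (auto simp: tiled_def)
  have H: "hor (\<tau> i) (\<tau> (Suc i))" if "Suc i < length u" for i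
    using tiled that by (simp add: tiled_def)
  have V: "ver (\<tau> i) (\<tau> (i + m))" if "i + m < length u" for i
    using tiled that by (simp add: tiled_def)
  have m0: "0 < m" using m by simp
  have step: "t_ctl (\<tau> (r * m + i)) = fst (conf y r) \<and> t_top (\<tau> (r * m + i)) = tops (snd (conf y r)) \<and>
      t_edge (\<tau> (r * m + i)) = (i = 0) \<and> t_mid (\<tau> (r * m + i)) = (\<lambda>v. cont (snd (conf y r) v) i)"
    if "i < m" "r * m + i < length u" for r i
    using that
  proof (induction r arbitrary: i)
    case 0
    have in0: "j < length u" if "j < m" for j using row_start_less[of 0] that by simp
    have edge: "t_edge (\<tau> j) = (j = 0)" if "j < m" for j
      using T(2)[OF in0[OF that]] u_first u_row0[of j] row0_cases[OF that] that
      by (cases "j = 0") (auto simp: allowed_def bit_symbol_def split: if_splits)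
    have mid: "t_mid (\<tau> j) = (\<lambda>v. cont (init_store (x @ y) v) j)" if "j < m" for j
    proof
      fix v
      have "0 < v \<Longrightarrow> t_mid (\<tau> j) v = 0"
        using T(2)[OF in0[OF that]] u_first u_row0[of j] row0_cases[OF that] that
        by (cases "j = 0") (auto simp: allowed_def bit_symbol_def split: if_splits)
      then show "t_mid (\<tau> j) v = cont (init_store (x @ y) v) j"
        using row0[OF that] by (cases "v = 0") (auto simp: init_store_def)
    qed
    have "t_ctl (\<tau> j) = [c] \<and> t_top (\<tau> j) = tops (init_store (x @ y))" if "j < m" for j
      using that
    proof (induction j)
      case 0
      have "t_ctl (\<tau> 0) = [c]" using T(2)[OF in0[OF 0]] u_first by (auto simp: allowed_def bit_symbol_def)
      moreover have "t_top (\<tau> 0) = t_mid (\<tau> 0)" using T(1)[OF in0[OF 0]] edge[OF 0] by (simp add: tiles_def)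
      ultimately show ?case using mid[OF 0] by (simp add: tops_def fun_eq_iff)
    next
      case (Suc j)
      then show ?case using H[OF in0[OF Suc.prems]] edge[OF Suc.prems] by (auto simp: hor_def)
    qed
    then show ?case using 0 edge mid by (simp add: conf_def)
  next
    case (Suc r)
    have r: "r \<le> t" using row_less[OF Suc.prems(2)] by simp
    have inr: "r * m + j < length u" if "j < m" for j using row_start_less[OF r] that by simp
    obtain K s where Ks: "conf y r = (K, s)" by fastforce
    have K': "conf y (Suc r) = (ctl K (tops s), \<lambda>v. apply_op (ops K (tops s) v) (s v))"
      by (simp add: conf_Suc Ks cstep_pair)
    have IH: "t_ctl (\<tau> (r * m + j)) = K" "t_top (\<tau> (r * m + j)) = tops s"
      "t_edge (\<tau> (r * m + j)) = (j = 0)" "t_mid (\<tau> (r * m + j)) = (\<lambda>v. cont (s v) j)" if "j < m" for j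
      using Suc.IH[OF that inr[OF that]] by (auto simp: Ks)
    have len: "length (s v) \<le> m - 2" for v
      using conf_props(3)[of y r v] y r unfolding m by (simp add: Ks)
    have Tr: "t_ctl (\<tau> (Suc r * m + j)) = ctl K (tops s)" "t_edge (\<tau> (Suc r * m + j)) = (j = 0)"
      "t_mid (\<tau> (Suc r * m + j)) = (\<lambda>v. cont (apply_op (ops K (tops s) v) (s v)) j)"
      if j: "j < m" "Suc r * m + j < length u" for j
    proof -
      have idx: "r * m + j + m = Suc r * m + j" by simp
      have v: "ver (\<tau> (r * m + j)) (\<tau> (Suc r * m + j))"
        using V[of "r * m + j"] j(2) unfolding idx by blast
      have left: "t_left (\<tau> (r * m + j)) = (\<lambda>v. cont (s v) (j - 1))" if "0 < j"
      proof -
        have e: "Suc (r * m + (j - 1)) = r * m + j" using that by simp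
        have "hor (\<tau> (r * m + (j - 1))) (\<tau> (r * m + j))"
          using H[of "r * m + (j - 1)"] inr[OF j(1)] unfolding e by blast
        then show ?thesis using IH[OF j(1)] IH[of "j - 1"] j(1) that by (auto simp: hor_def)
      qed
      have right: "t_right (\<tau> (r * m + j)) v = cont (s v) (Suc j)" for v
      proof (cases "Suc j < m")
        case True
        have "hor (\<tau> (r * m + j)) (\<tau> (r * m + Suc j))"
          using H[of "r * m + j"] inr[OF True] by simp
        then show ?thesis using IH[OF True] by (auto simp: hor_def)
      next
        case False
        have "cont (s v) j = 0" "cont (s v) (Suc j) = 0" using False len[of v] m0
          by (auto intro!: cont_beyond)
        moreover have "t_mid (\<tau> (r * m + j)) v = 0 \<longrightarrow> t_right (\<tau> (r * m + j)) v = 0"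
          using T(1)[OF inr[OF j(1)]] by (auto simp: tiles_def)
        ultimately show ?thesis using IH(4)[OF j(1)] by simp
      qed
      show "t_ctl (\<tau> (Suc r * m + j)) = ctl K (tops s)" "t_edge (\<tau> (Suc r * m + j)) = (j = 0)"
        using v IH[OF j(1)] by (auto simp: ver_def)
      show "t_mid (\<tau> (Suc r * m + j)) = (\<lambda>v. cont (apply_op (ops K (tops s) v) (s v)) j)"
      proof
        fix w
        have "t_mid (\<tau> (Suc r * m + j)) w =
            nxt (ops K (tops s) w) (j = 0) (t_left (\<tau> (r * m + j)) w) (cont (s w) j) (cont (s w) (Suc j))"
          using v IH[OF j(1)] right by (auto simp: ver_def)
        also have "\<dots> = cont (apply_op (ops K (tops s) w) (s w)) j"
          by (rule nxt_cont) (simp add: left)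
        finally show "t_mid (\<tau> (Suc r * m + j)) w = cont (apply_op (ops K (tops s) w) (s w)) j" .
      qed
    qed
    \<comment> \<open>The tops of the new row are read off the middle of its own edge tile and
      passed on to the right.\<close>
    have top: "t_top (\<tau> (Suc r * m + j)) = (\<lambda>v. cont (apply_op (ops K (tops s) v) (s v)) 0)"
      if "j < m" "Suc r * m + j < length u" for j
      using that
    proof (induction j)
      case 0
      then show ?case using Tr(2,3)[OF 0] T(1)[OF 0(2)] by (simp add: tiles_def)
    next
      case (Suc j)
      have "hor (\<tau> (Suc r * m + j)) (\<tau> (Suc r * m + Suc j))"
        using H[of "Suc r * m + j"] Suc.prems(2) by simp
      then show ?case using Suc Tr(2)[OF Suc.prems] by (auto simp: hor_def)
    qed
    show ?case using Tr[OF Suc.prems] top[OF Suc.prems] by (simp add: K' tops_def fun_eq_iff)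
  qed
  have last: "(t + 1) * m + 0 < length u" unfolding length_u by (simp add: mult.commute)
  have "allowed c 6 (\<tau> ((t + 1) * m))" using T(2)[OF last] u_last by (simp add: mult.commute)
  then show ?thesis using step[OF m0 last] y by (auto simp: allowed_def)
qed

lemma tiled_complete:
  assumes y: "length y \<le> p" and acc: "fst (conf y (t + 1)) = []" "tops (snd (conf y (t + 1))) 1 = 2"
  shows "\<exists>\<tau>. tiled \<tau>"
proof -
  \<comment> \<open>Column 0 has no left neighbour. Truncated subtraction supplies a default there,
    which is admissible because neither \<open>nxt\<close> nor \<open>hor\<close> looks at
    \<open>t_left\<close> of an edge tile.\<close>
  define mk where "mk = (\<lambda>r i. Tile (fst (conf y r)) (tops (snd (conf y r))) (i = 0)
    (\<lambda>v. cont (snd (conf y r) v) (i - 1)) (\<lambda>v. cont (snd (conf y r) v) i) (\<lambda>v. cont (snd (conf y r) v) (Suc i)))"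
  define \<tau> where "\<tau> = (\<lambda>j. mk (j div m) (j mod m))"
  have m0: "0 < m" using m by simp
  have in_tuples: "(\<lambda>v. cont (snd (conf y r) v) i) \<in> tuples k S" for r i
    using conf_props(2)[of y r] S by (auto simp: tuples_def store_ok_def intro!: cont_less)
  have "mk r i \<in> tiles c k S" for r i
  proof -
    have "0 \<notin> set (snd (conf y r) v)" for v using conf_props(2)[of y r] by (force simp: store_ok_def)
    then have "cont (snd (conf y r) v) i = 0 \<Longrightarrow> cont (snd (conf y r) v) (Suc i) = 0" for v
      by (simp add: cont_eq_0_iff)
    moreover have "tops (snd (conf y r)) = (\<lambda>v. cont (snd (conf y r) v) 0)" by (simp add: tops_def fun_eq_iff)
    ultimately show ?thesis using conf_props(1)[of y r] in_tuples by (auto simp: tiles_def mk_def)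
  qed
  moreover have "allowed c (u ! j) (\<tau> j)" if j: "j < length u" for j
  proof -
    consider "j = 0" | "0 < j" "j < m" | "m \<le> j" "j < m * (t + 1)" | "j = m * (t + 1)"
      using j unfolding length_u by linarith
    then show ?thesis
    proof cases
      case 1
      have "cont (map bit_symbol (x @ y)) 0 = bit_symbol (x ! 0)" using x by (cases x) auto
      then show ?thesis using m0 by (auto simp: 1 u_first allowed_def \<tau>_def mk_def conf_def init_store_def bit_symbol_def)
    next
      case 2
      then have "\<tau> j = mk 0 j" by (simp add: \<tau>_def)
      moreover have "u ! j = row0 x p t ! j" using u_row0 2 by blast
      moreover have "bit_symbol b \<le> 2" "bit_symbol b \<noteq> 0" for b by (auto simp: bit_symbol_def)
      ultimately show ?thesis using 2 y row0_cases[OF 2(2)]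
        by (auto simp: allowed_def mk_def conf_def init_store_def cont_def nth_append bit_symbol_def)
    next
      case 3
      then show ?thesis using u_mid by (simp add: allowed_def)
    next
      case 4
      then have "\<tau> j = mk (t + 1) 0" using m0 by (simp add: \<tau>_def)
      then show ?thesis using u_last acc by (simp add: 4 allowed_def mk_def)
    qed
  qed
  moreover have "hor (\<tau> j) (\<tau> (j + 1))" for j
  proof (cases "Suc (j mod m) = m")
    case True
    then have "(j + 1) mod m = 0" by (simp add: mod_Suc)
    then show ?thesis by (simp add: hor_def \<tau>_def mk_def)
  next
    case False
    then have "(j + 1) mod m = Suc (j mod m)" "(j + 1) div m = j div m"
      by (simp_all add: mod_Suc div_Suc)
    then show ?thesis by (simp add: hor_def \<tau>_def mk_def)
  qed
  moreover have "ver (\<tau> j) (\<tau> (j + m))" for j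
  proof -
    have "(j + m) mod m = j mod m" "(j + m) div m = Suc (j div m)" using m0 by simp_all
    then have e: "\<tau> (j + m) = mk (Suc (j div m)) (j mod m)" by (simp add: \<tau>_def)
    obtain K s where Ks: "conf y (j div m) = (K, s)" by fastforce
    have "conf y (Suc (j div m)) = (ctl K (tops s), \<lambda>v. apply_op (ops K (tops s) v) (s v))"
      by (simp add: conf_Suc Ks cstep_pair)
    then show ?thesis
      by (auto simp: ver_def e) (auto simp: \<tau>_def mk_def Ks nxt_cont)
  qed
  ultimately have "tiled \<tau>" by (simp add: tiled_def \<tau>_def)
  then show ?thesis by blast
qed

text \<open>A halted configuration persists, so a test at time \<open>t + 1\<close> covers every
  halting time up to \<open>t\<close>.\<close>

lemma accepts_iff:
  assumes run: "runs c (init_store (x @ y)) s' t" and out: "s' 1 = [bit_symbol b]"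
  shows "fst (conf y (t + 1)) = [] \<and> tops (snd (conf y (t + 1))) 1 = 2 \<longleftrightarrow> b"
proof -
  obtain n where n: "n \<le> t" "(cstep ^^ n) ([c], init_store (x @ y)) = ([], s')"
    using run unfolding runs_def by blast
  have "conf y (t + 1) = (cstep ^^ (t + 1 - n)) ((cstep ^^ n) ([c], init_store (x @ y)))"
    unfolding conf_def using n(1) by (metis (no_types, lifting) add_diff_cancel_right' diff_add funpow_add le_add1 o_apply order.trans le_add_diff_inverse2)
  then have "conf y (t + 1) = ([], s')" by (simp only: n(2) cstep_halted)
  then show ?thesis using out by (auto simp: tops_def bit_symbol_def)
qed

end

text \<open>
  Tile 0 is a joker. Covering all cells with it gives a tiling that exists for every input.
\<close>

definition pick :: "tile set \<Rightarrow> nat \<Rightarrow> tile" where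
  "pick X = (SOME h. bij_betw h {1..<card X + 1} X)"

lemma bij_pick: "finite X \<Longrightarrow> bij_betw (pick X) {1..<card X + 1} X"
proof -
  assume "finite X"
  then obtain h where h: "bij_betw h {0..<card X} X" using ex_bij_betw_nat_finite by blast
  have "bij_betw (\<lambda>i. i - 1) {1..<card X + 1} {0..<card X}"
    by (rule bij_betw_byWitness[where f' = Suc]) auto
  then have "bij_betw (h \<circ> (\<lambda>i. i - 1)) {1..<card X + 1} X" using h by (rule bij_betw_trans)
  then show ?thesis unfolding pick_def by (rule someI[of "\<lambda>h. bij_betw h {1..<card X + 1} X"])
qed

definition joker_ok :: "com \<Rightarrow> tile set \<Rightarrow> nat \<Rightarrow> nat \<Rightarrow> bool" where
  "joker_ok c X a g \<longleftrightarrow> g = 0 \<or> allowed c a (pick X g)"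

text \<open>The joker tolerates only itself beside it. Along the consecutive numbering it therefore
  occupies all cells or none, and the first cell tells which.\<close>

definition joker_rel :: "(tile \<Rightarrow> tile \<Rightarrow> bool) \<Rightarrow> tile set \<Rightarrow> nat \<Rightarrow> nat \<Rightarrow> bool" where
  "joker_rel R X g g' \<longleftrightarrow> (if g = 0 \<or> g' = 0 then g = g' else R (pick X g) (pick X g'))"

lemma joker_tiling: "0 < G \<Longrightarrow> tiling G m u (joker_ok c X) (joker_rel R X) (joker_rel R' X) (\<lambda>_. 0)"
  by (simp add: tiling_def joker_ok_def joker_rel_def)

lemma (in computation) tiling_iff:
  assumes run: "\<And>y. length y \<le> p \<Longrightarrow> \<exists>s'. runs c (init_store (x @ y)) s' t \<and> s' 1 = [bit_symbol (x @ y \<in> B)]"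
  shows "(\<exists>\<sigma>. tiling (card (tiles c k S) + 1) m u (joker_ok c (tiles c k S))
      (joker_rel hor (tiles c k S)) (joker_rel ver (tiles c k S)) \<sigma> \<and> \<sigma> 0 \<noteq> 0) \<longleftrightarrow>
    (\<exists>y. length y \<le> p \<and> x @ y \<in> B)"
proof -
  let ?X = "tiles c k S"
  let ?tiling = "tiling (card ?X + 1) m u (joker_ok c ?X) (joker_rel hor ?X) (joker_rel ver ?X)"
  have bij: "bij_betw (pick ?X) {1..<card ?X + 1} ?X" by (rule bij_pick[OF finite_tiles])
  have 1: "\<exists>\<tau>. tiled \<tau>" if "?tiling \<sigma>" "\<sigma> 0 \<noteq> 0" for \<sigma>
  proof -
    have nz: "\<sigma> i \<noteq> 0" if "i < length u" for i
      using that
    proof (induction i)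
      case 0
      then show ?case using \<open>\<sigma> 0 \<noteq> 0\<close> by simp
    next
      case (Suc i)
      then have "joker_rel hor ?X (\<sigma> i) (\<sigma> (i + 1))" "\<sigma> i \<noteq> 0"
        using \<open>?tiling \<sigma>\<close> by (auto simp: tiling_def)
      then show ?case by (auto simp: joker_rel_def split: if_splits)
    qed
    have "pick ?X (\<sigma> i) \<in> ?X" if "i < length u" for i
      using that nz[OF that] \<open>?tiling \<sigma>\<close> by (intro bij_betw_apply[OF bij]) (auto simp: tiling_def)
    then have "tiled (\<lambda>i. pick ?X (\<sigma> i))"
      using \<open>?tiling \<sigma>\<close> nz by (auto simp: tiled_def tiling_def joker_ok_def joker_rel_def)
    then show ?thesis by blast
  qed
  have 2: "\<exists>\<sigma>. ?tiling \<sigma> \<and> \<sigma> 0 \<noteq> 0" if "tiled \<tau>" for \<tau>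
  proof -
    define \<sigma> where "\<sigma> = (\<lambda>i. inv_into {1..<card ?X + 1} (pick ?X) (\<tau> i))"
    have in_X: "\<tau> i \<in> pick ?X ` {1..<card ?X + 1}" if "i < length u" for i
      using that \<open>tiled \<tau>\<close> bij by (auto simp: tiled_def bij_betw_def)
    have pick: "pick ?X (\<sigma> i) = \<tau> i" if "i < length u" for i
      unfolding \<sigma>_def by (rule f_inv_into_f[OF in_X[OF that]])
    have rng: "\<sigma> i \<in> {1..<card ?X + 1}" if "i < length u" for i
      unfolding \<sigma>_def by (rule inv_into_into[OF in_X[OF that]])
    have nz: "\<sigma> i \<noteq> 0" "\<sigma> i < card ?X + 1" if "i < length u" for i using rng[OF that] by auto
    have "?tiling \<sigma>"
      unfolding tiling_def
    proof (intro conjI allI impI)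
      fix i assume i: "i + 1 < length u"
      then have "hor (\<tau> i) (\<tau> (i + 1))" using \<open>tiled \<tau>\<close> by (simp add: tiled_def)
      then show "joker_rel hor ?X (\<sigma> i) (\<sigma> (i + 1))"
        unfolding joker_rel_def using i pick[of i] pick[of "i + 1"] nz(1)[of i] nz(1)[of "i + 1"] by simp
    next
      fix i assume i: "i + m < length u"
      then have "ver (\<tau> i) (\<tau> (i + m))" using \<open>tiled \<tau>\<close> by (simp add: tiled_def)
      then show "joker_rel ver ?X (\<sigma> i) (\<sigma> (i + m))"
        unfolding joker_rel_def using i pick[of i] pick[of "i + m"] nz(1)[of i] nz(1)[of "i + m"] by simp
    qed (use \<open>tiled \<tau>\<close> nz pick in \<open>auto simp: tiled_def joker_ok_def\<close>)
    moreover have "\<sigma> 0 \<noteq> 0" using nz(1)[of 0] length_u by simp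
    ultimately show ?thesis by blast
  qed
  have 3: "x @ y \<in> B \<longleftrightarrow> fst (conf y (t + 1)) = [] \<and> tops (snd (conf y (t + 1))) 1 = 2"
    if "length y \<le> p" for y
    using run[OF that] accepts_iff by blast
  show ?thesis using 1 2 3 tiled_sound tiled_complete by blast
qed

section \<open>Printing block matrices\<close>

definition emit :: "nat \<Rightarrow> ((nat \<Rightarrow> nat) \<Rightarrow> bool list) \<Rightarrow> com" where
  "emit l f = seqs (map (\<lambda>i. upd 1 (\<lambda>\<tau>. if i < length (f \<tau>) then Push (bit_symbol (f \<tau> ! i)) else Keep)) [0..<l])"

definition outputs :: "bool list \<Rightarrow> store \<Rightarrow> store" where
  "outputs w s = s(1 := rev (map bit_symbol w) @ s 1)"

lemma outputs_append: "outputs (v @ w) s = outputs w (outputs v s)"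
  by (simp add: outputs_def)

lemma outputs_Nil [simp]: "outputs [] s = s"
  by (simp add: outputs_def)

lemma outputs_other [simp]: "a \<noteq> 1 \<Longrightarrow> outputs w s a = s a"
  by (simp add: outputs_def)

lemma tops_outputs [simp]: "a \<noteq> 1 \<Longrightarrow> tops (outputs w s) a = tops s a"
  by (simp add: tops_def)

lemma outputs_upd [simp]: "a \<noteq> 1 \<Longrightarrow> outputs w (s(a := xs)) = (outputs w s)(a := xs)"
  by (auto simp: outputs_def fun_eq_iff)

lemma bounded_emit: "2 \<le> k \<Longrightarrow> 3 \<le> S \<Longrightarrow> bounded k S (emit l f)"
  by (auto simp: emit_def bit_symbol_def intro!: bounded_seqs bounded_upd)

text \<open>The word is computed anew before each push, so it must not change with the output
  already written; this is why the second assumption ranges over all \<open>v\<close>.\<close>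

lemma runs_emit:
  assumes len: "length w \<le> l" and f: "\<And>v. f (tops (outputs v s)) = w"
  shows "runs (emit l f) s (outputs w s) (2 * l + 1)"
proof -
  let ?A = "\<lambda>i. upd 1 (\<lambda>\<tau>. if i < length (f \<tau>) then Push (bit_symbol (f \<tau> ! i)) else Keep)"
  have "runs (seqs (map ?A [i..<l])) (outputs (take i w) s) (outputs w s) (2 * (l - i) + 1)" if "i \<le> l" for i
    using that
  proof (induction i rule: inc_induct)
    case base
    then show ?case using len runs_skip by simp
  next
    case (step i)
    have "runs (?A i) (outputs (take i w) s) (outputs (take (Suc i) w) s) 1"
      by (rule runs_upd, cases "i < length w", simp_all only: f if_True if_False)
        (auto simp: take_Suc_conv_app_nth outputs_def fun_eq_iff)
    from runs_Seq[OF this step.IH] have "runs (seqs (map ?A [i..<l])) (outputs (take i w) s) (outputs w s) (Suc (1 + (2 * (l - Suc i) + 1)))"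
      using step.hyps by (simp add: upt_conv_Cons)
    then show ?case by (rule runs_weaken) (use step.hyps in simp)
  qed
  from this[of 0] show ?thesis by (simp add: emit_def)
qed

text \<open>Cell classes go up to 8 and links up to 4, so 9 symbols including 0 suffice for all
  printing programs.\<close>

definition clamp :: "nat \<Rightarrow> nat" where
  "clamp a = (if 1 \<le> a \<and> a \<le> 8 then a else 1)"

definition small :: "nat list \<Rightarrow> bool" where
  "small xs \<longleftrightarrow> set xs \<subseteq> {1..8}"

lemma clamp_props [simp]: "clamp a \<noteq> 0" "0 < clamp a" "clamp a < 9" "a \<in> {1..8} \<Longrightarrow> clamp a = a"
  by (auto simp: clamp_def)

lemma map_clamp [simp]: "small xs \<Longrightarrow> map clamp xs = xs"
  by (auto simp: small_def intro!: map_idI)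

lemma small_nonzero: "small xs \<Longrightarrow> 0 \<notin> set xs"
  by (auto simp: small_def)

lemma small_simps [simp]: "small []" "small (x # xs) \<longleftrightarrow> x \<in> {1..8} \<and> small xs"
  "small (xs @ ys) \<longleftrightarrow> small xs \<and> small ys" "small (rev xs) \<longleftrightarrow> small xs"
  "small (replicate n a) \<longleftrightarrow> n = 0 \<or> a \<in> {1..8}"
  by (auto simp: small_def)

definition copy :: "nat \<Rightarrow> nat \<Rightarrow> nat \<Rightarrow> com" where
  "copy a e b = xfer b (\<lambda>_ _. 0) ;; move a e clamp ;;
     xfer e (\<lambda>v x. if v = a \<or> v = b then clamp x else 0)"

lemma bounded_copy: "a < k \<Longrightarrow> b < k \<Longrightarrow> e < k \<Longrightarrow> 9 \<le> S \<Longrightarrow> bounded k S (copy a e b)"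
  unfolding copy_def by (auto intro!: bounded_xfer bounded_move intro: less_le_trans[OF clamp_props(3)])

lemma runs_copy:
  assumes "small (s a)" "0 \<notin> set (s b)" "s e = []" "a \<noteq> b" "a \<noteq> e" "b \<noteq> e"
  shows "runs (copy a e b) s (s(b := s a)) (2 * length (s b) + 4 * length (s a) + 5)"
proof -
  define s1 where "s1 = s(b := [])"
  define s2 where "s2 = s1(a := [], e := rev (s a))"
  have 1: "runs (xfer b (\<lambda>_ _. 0)) s s1 (2 * length (s b) + 1)"
    by (rule runs_xfer) (use assms in \<open>auto simp: s1_def\<close>)
  have 2: "runs (move a e clamp) s1 s2 (2 * length (s a) + 1)"
    by (rule runs_move) (use assms small_nonzero in \<open>auto simp: s1_def s2_def\<close>)
  have *: "filter (\<lambda>y. 0 < y) (map clamp (s a)) = s a" "filter (\<lambda>y. 0 < y) (map (\<lambda>x. 0::nat) (s a)) = []"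
    using assms(1) small_nonzero by (auto simp: filter_id_conv intro: ccontr)
  have 3: "runs (xfer e (\<lambda>v x. if v = a \<or> v = b then clamp x else 0)) s2 (s(b := s a)) (2 * length (s a) + 1)"
  proof (rule runs_xfer)
    show "s(b := s a) = (\<lambda>v. if v = e then [] else rev (filter (\<lambda>y. y \<noteq> 0)
        (map ((\<lambda>v x. if v = a \<or> v = b then clamp x else 0) v) (s2 e))) @ s2 v)"
      using assms * by (auto simp: fun_eq_iff s2_def s1_def rev_map[symmetric] rev_filter[symmetric])
  qed (use assms small_nonzero in \<open>auto simp: s2_def\<close>)
  show ?thesis unfolding copy_def
    by (rule runs_weaken[OF runs_Seq[OF 1 runs_Seq[OF 2 3]]]) simp
qed

text \<open>
  Stack 3 holds the word \<open>u\<close> of cell classes and stack 4 the links of cell 0 to the cells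
  \<open>0, 1, ...\<close>; the printer works with copies of them on the stacks 9 and 8. Pushing a 1 on stack 8
  turns the links of a cell into those of its successor.
\<close>

definition ready :: "nat list \<Rightarrow> nat list \<Rightarrow> store \<Rightarrow> bool" where
  "ready u d s \<longleftrightarrow> s 3 = u \<and> s 4 = d \<and> s 5 = [] \<and> s 6 = [] \<and> small (s 8) \<and> small (s 9) \<and>
     length (s 8) \<le> length u + length d \<and> length (s 9) \<le> length u"

definition prints :: "nat list \<Rightarrow> nat list \<Rightarrow> com \<Rightarrow> bool list \<Rightarrow> nat \<Rightarrow> bool" where
  "prints u d c w t \<longleftrightarrow> (\<forall>s. ready u d s \<longrightarrow>
     (\<exists>s'. runs c s s' t \<and> ready u d s' \<and> s' 1 = rev (map bit_symbol w) @ s 1))"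

lemma prints_Seq:
  assumes "prints u d a v t1" "prints u d b w t2"
  shows "prints u d (a ;; b) (v @ w) (Suc (t1 + t2))"
  unfolding prints_def
proof (intro allI impI)
  fix s assume "ready u d s"
  then obtain s1 where s1: "runs a s s1 t1" "ready u d s1" "s1 1 = rev (map bit_symbol v) @ s 1"
    using assms(1) unfolding prints_def by blast
  then obtain s2 where "runs b s1 s2 t2" "ready u d s2" "s2 1 = rev (map bit_symbol w) @ s1 1"
    using assms(2) unfolding prints_def by blast
  then show "\<exists>s'. runs (a ;; b) s s' (Suc (t1 + t2)) \<and> ready u d s' \<and> s' 1 = rev (map bit_symbol (v @ w)) @ s 1"
    using s1 runs_Seq by (intro exI[of _ s2]) auto
qed

lemma ready_outputs: "ready u d s \<Longrightarrow> ready u d (outputs w s)"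
  by (simp add: ready_def)

lemma prints_const: "prints u d (emit (length w) (\<lambda>_. w)) w (2 * length w + 1)"
  unfolding prints_def
proof (intro allI impI)
  fix s assume "ready u d s"
  then show "\<exists>s'. runs (emit (length w) (\<lambda>_. w)) s s' (2 * length w + 1) \<and> ready u d s' \<and>
      s' 1 = rev (map bit_symbol w) @ s 1"
    using runs_emit[of w "length w" "\<lambda>_. w" s] ready_outputs
    by (intro exI[of _ "outputs w s"]) (simp add: outputs_def)
qed

type_synonym token = "nat \<Rightarrow> nat \<Rightarrow> nat \<Rightarrow> nat \<Rightarrow> bool list"

text \<open>Past the end of the stored links the top reads as 0, which means the same as 1: no
  link.\<close>

definition link_of :: "nat \<Rightarrow> nat" where
  "link_of z = (if z = 0 then 1 else z)"

definition block_text :: "nat \<Rightarrow> token \<Rightarrow> nat \<Rightarrow> nat \<Rightarrow> nat \<Rightarrow> bool list" where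
  "block_text G tok a z g = concat (map (\<lambda>g'. tok a (link_of z) g g') [0..<G])"

definition row_text :: "nat \<Rightarrow> nat \<Rightarrow> token \<Rightarrow> nat \<Rightarrow> nat list \<Rightarrow> nat \<Rightarrow> bool list" where
  "row_text G n tok a ds g = concat (map (\<lambda>c'. block_text G tok a (cont ds c') g) [0..<n])"

text \<open>One round per cell of the column index: stack 3 acts as the counter, stack 8 supplies
  the link to that cell, and the top of stack 9 is the class of the row. Stacks 5 and 6 save what is
  popped, to be put back afterwards.\<close>

definition row_loop :: "nat \<Rightarrow> nat \<Rightarrow> token \<Rightarrow> nat \<Rightarrow> com" where
  "row_loop G l tok g = Whl (\<lambda>\<tau>. \<tau> 3 \<noteq> 0)
     (emit l (\<lambda>\<tau>. block_text G tok (\<tau> 9) (\<tau> 8) g) ;;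
      Act (\<lambda>\<tau> v. if v = 3 \<or> v = 8 then Pop
        else if v = 5 then Push (clamp (\<tau> 3))
        else if v = 6 \<and> \<tau> 8 \<noteq> 0 then Push (clamp (\<tau> 8)) else Keep))"

lemma length_block_text:
  "(\<And>a z g g'. length (tok a z g g') \<le> l0) \<Longrightarrow> G * l0 \<le> l \<Longrightarrow> length (block_text G tok a z g) \<le> l"
proof -
  assume l0: "\<And>a z g g'. length (tok a z g g') \<le> l0" and l: "G * l0 \<le> l"
  have "length (concat (map (\<lambda>g'. tok a (link_of z) g g') xs)) \<le> length xs * l0" for xs
    by (induction xs) (auto intro: add_mono l0)
  from this[of "[0..<G]"] l show ?thesis by (simp add: block_text_def)
qed

lemma runs_row_loop:
  assumes l0: "\<And>a z g. length (block_text G tok a z g) \<le> l"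
    and s: "small (s 3)" "small (s 8)"
  shows "runs (row_loop G l tok g) s
    (outputs (row_text G (length (s 3)) tok (cont (s 9) 0) (s 8) g)
      (s(3 := [], 5 := rev (s 3) @ s 5, 8 := drop (length (s 3)) (s 8),
         6 := rev (take (length (s 3)) (s 8)) @ s 6)))
    (length (s 3) * (2 * l + 4) + 1)"
  using s
proof (induction "s 3" arbitrary: s)
  case Nil
  have nil: "s 3 = []" using Nil.hyps by simp
  have "s(3 := [], 5 := s 5, 8 := s 8, 6 := s 6) = s" using nil by (auto simp: fun_eq_iff)
  then have eq: "outputs (row_text G (length (s 3)) tok (cont (s 9) 0) (s 8) g)
      (s(3 := [], 5 := rev (s 3) @ s 5, 8 := drop (length (s 3)) (s 8),
         6 := rev (take (length (s 3)) (s 8)) @ s 6)) = s"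
    by (simp add: nil row_text_def del: fun_upd_apply)
  show ?case unfolding eq row_loop_def
    by (rule runs_weaken[OF runs_Whl_False]) (simp_all add: tops_def nil)
next
  case (Cons x xs)
  let ?A = "Act (\<lambda>\<tau> v. if v = 3 \<or> v = 8 then Pop
        else if v = 5 then Push (clamp (\<tau> 3))
        else if v = 6 \<and> \<tau> 8 \<noteq> 0 then Push (clamp (\<tau> 8)) else Keep)"
  have s3: "s 3 = x # xs" by (simp add: Cons.hyps)
  define w where "w = block_text G tok (cont (s 9) 0) (cont (s 8) 0) g"
  define s1 where "s1 = outputs w s"
  define s2 where "s2 = s1(3 := xs, 5 := x # s 5, 8 := tl (s 8), 6 := take 1 (s 8) @ s 6)"
  have 1: "runs (emit l (\<lambda>\<tau>. block_text G tok (\<tau> 9) (\<tau> 8) g)) s s1 (2 * l + 1)"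
    unfolding s1_def by (rule runs_emit) (use l0 in \<open>simp_all add: w_def tops_def\<close>)
  have x: "x \<in> {1..8}" using Cons.prems(1) s3 by simp
  have hd8: "small (s 8)" by (rule Cons.prems(2))
  have 2: "runs ?A s1 s2 1"
  proof (rule runs_Act, rule ext)
    fix v :: nat
    have c3: "clamp (tops s1 3) = x" using x by (simp add: s1_def tops_def s3)
    have c8: "apply_op (if tops s1 8 \<noteq> 0 then Push (clamp (tops s1 8)) else Keep) (s 6) = take 1 (s 8) @ s 6"
      using hd8 by (cases "s 8") (auto simp: s1_def tops_def)
    consider "v = 3" | "v = 8" | "v = 5" | "v = 6" | "v \<notin> {3, 5, 6, 8}" by blast
    then show "s2 v = apply_op (if v = 3 \<or> v = 8 then Pop
        else if v = 5 then Push (clamp (tops s1 3))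
        else if v = 6 \<and> tops s1 8 \<noteq> 0 then Push (clamp (tops s1 8)) else Keep) (s1 v)"
      using c3 c8 by cases (auto simp: s2_def s1_def s3)
  qed
  have s2v: "s2 3 = xs" "s2 8 = tl (s 8)" "s2 9 = s 9" "s2 5 = x # s 5" "s2 6 = take 1 (s 8) @ s 6"
    by (simp_all add: s2_def s1_def)
  have sm: "small (s2 3)" "small (s2 8)"
    using Cons.prems s3 s2v by (auto simp: small_def dest: list.set_sel(2)[rotated]) (metis atLeastAtMost_iff in_mono list.sel(2) list.set_sel(2))+
  have IH: "runs (row_loop G l tok g) s2
    (outputs (row_text G (length xs) tok (cont (s 9) 0) (tl (s 8)) g)
      (s2(3 := [], 5 := rev xs @ x # s 5, 8 := drop (length xs) (tl (s 8)),
         6 := rev (take (length xs) (tl (s 8))) @ take 1 (s 8) @ s 6)))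
    (length xs * (2 * l + 4) + 1)"
    using Cons.hyps(1)[of s2, OF _ sm] unfolding s2v by simp
  have split: "row_text G (length (s 3)) tok (cont (s 9) 0) (s 8) g =
      w @ row_text G (length xs) tok (cont (s 9) 0) (tl (s 8)) g"
  proof -
    have "[0..<Suc (length xs)] = 0 # map Suc [0..<length xs]" by (simp add: map_Suc_upt upt_conv_Cons del: upt_Suc)
    then show ?thesis by (simp add: row_text_def s3 w_def cont_tl comp_def del: upt_Suc)
  qed
  have eq: "outputs (row_text G (length xs) tok (cont (s 9) 0) (tl (s 8)) g)
      (s2(3 := [], 5 := rev xs @ x # s 5, 8 := drop (length xs) (tl (s 8)),
         6 := rev (take (length xs) (tl (s 8))) @ take 1 (s 8) @ s 6)) =
    outputs (row_text G (length (s 3)) tok (cont (s 9) 0) (s 8) g)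
      (s(3 := [], 5 := rev (s 3) @ s 5, 8 := drop (length (s 3)) (s 8),
         6 := rev (take (length (s 3)) (s 8)) @ s 6))"
  proof -
    have "rev (take (length xs) (tl (s 8))) @ take 1 (s 8) = rev (take (length (s 3)) (s 8))"
      by (cases "s 8") (simp_all add: s3)
    moreover have "drop (length xs) (tl (s 8)) = drop (length (s 3)) (s 8)"
      by (simp add: s3 drop_Suc)
    ultimately show ?thesis unfolding split outputs_append
      by (auto simp: s2_def s1_def s3 fun_eq_iff)
  qed
  have "runs (row_loop G l tok g) s (outputs (row_text G (length xs) tok (cont (s 9) 0) (tl (s 8)) g)
      (s2(3 := [], 5 := rev xs @ x # s 5, 8 := drop (length xs) (tl (s 8)),
         6 := rev (take (length xs) (tl (s 8))) @ take 1 (s 8) @ s 6)))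
    (Suc (Suc (2 * l + 1 + 1) + (length xs * (2 * l + 4) + 1)))"
    unfolding row_loop_def
    by (rule runs_Whl_True[OF _ runs_Seq[OF 1 2] IH[unfolded row_loop_def]]) (use x in \<open>simp add: tops_def s3\<close>)
  then show ?case unfolding eq by (rule runs_weaken) (simp add: s3)
qed

definition print_row :: "nat \<Rightarrow> nat \<Rightarrow> token \<Rightarrow> bool list \<Rightarrow> nat \<Rightarrow> com" where
  "print_row G l tok e g = row_loop G l tok g ;; move 5 3 clamp ;; move 6 8 clamp ;; emit l (\<lambda>_. e)"

lemma runs_print_row:
  assumes l0: "\<And>a z g. length (block_text G tok a z g) \<le> l" and e: "length e \<le> l"
    and s: "small (s 3)" "small (s 8)" "s 5 = []" "s 6 = []"
  shows "runs (print_row G l tok e g) s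
    (outputs (row_text G (length (s 3)) tok (cont (s 9) 0) (s 8) g @ e) s)
    (length (s 3) * (2 * l + 8) + 2 * l + 7)"
proof -
  let ?n = "length (s 3)"
  let ?w = "row_text G ?n tok (cont (s 9) 0) (s 8) g"
  define s1 where "s1 = outputs ?w (s(3 := [], 5 := rev (s 3), 8 := drop ?n (s 8), 6 := rev (take ?n (s 8))))"
  define s2 where "s2 = outputs ?w (s(8 := drop ?n (s 8), 6 := rev (take ?n (s 8))))"
  have 1: "runs (row_loop G l tok g) s s1 (?n * (2 * l + 4) + 1)"
    using runs_row_loop[OF l0 s(1,2)] by (simp add: s1_def s(3,4))
  have 2: "runs (move 5 3 clamp) s1 s2 (2 * ?n + 1)"
  proof (rule runs_move)
    have s35: "rev (map clamp (s1 5)) @ s1 3 = s 3" using s(1) by (simp add: s1_def rev_map)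
    show "s2 = s1(5 := [], 3 := rev (map clamp (s1 5)) @ s1 3)"
      unfolding s35 by (auto simp: s1_def s2_def fun_eq_iff s(3))
  qed (use s(1) small_nonzero in \<open>auto simp: s1_def\<close>)
  have sm: "small (take ?n (s 8))" using s(2) by (auto simp: small_def dest: in_set_takeD)
  have 3: "runs (move 6 8 clamp) s2 (outputs ?w s) (2 * ?n + 1)"
  proof (rule runs_move)
    have s68: "rev (map clamp (s2 6)) @ s2 8 = s 8" using sm by (simp add: s2_def rev_map)
    show "outputs ?w s = s2(6 := [], 8 := rev (map clamp (s2 6)) @ s2 8)"
      unfolding s68 by (auto simp: s2_def fun_eq_iff s(4))
  qed (use sm small_nonzero in \<open>auto simp: s2_def\<close>)
  have 4: "runs (emit l (\<lambda>_. e)) (outputs ?w s) (outputs e (outputs ?w s)) (2 * l + 1)"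
    by (rule runs_emit) (use e in auto)
  show ?thesis unfolding print_row_def outputs_append
    by (rule runs_weaken[OF runs_Seq[OF 1 runs_Seq[OF 2 runs_Seq[OF 3 4]]]]) (simp add: algebra_simps)
qed

definition print_cell :: "nat \<Rightarrow> nat \<Rightarrow> token \<Rightarrow> bool list \<Rightarrow> com" where
  "print_cell G l tok e = seqs (map (print_row G l tok e) [0..<G])"

definition cell_text :: "nat \<Rightarrow> nat \<Rightarrow> token \<Rightarrow> bool list \<Rightarrow> nat \<Rightarrow> nat list \<Rightarrow> bool list" where
  "cell_text G n tok e a ds = concat (map (\<lambda>g. row_text G n tok a ds g @ e) [0..<G])"

lemma runs_print_cell:
  assumes l0: "\<And>a z g. length (block_text G tok a z g) \<le> l" and e: "length e \<le> l"
    and s: "small (s 3)" "small (s 8)" "s 5 = []" "s 6 = []"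
  shows "runs (print_cell G l tok e) s (outputs (cell_text G (length (s 3)) tok e (cont (s 9) 0) (s 8)) s)
    (G * (length (s 3) * (2 * l + 8) + 2 * l + 8) + 1)"
proof -
  have "runs (seqs (map (print_row G l tok e) gs)) s
      (outputs (concat (map (\<lambda>g. row_text G (length (s 3)) tok (cont (s 9) 0) (s 8) g @ e) gs)) s)
      (length gs * (length (s 3) * (2 * l + 8) + 2 * l + 8) + 1)" for gs
    using s
  proof (induction gs arbitrary: s)
    case Nil
    then show ?case using runs_skip by simp
  next
    case (Cons g gs)
    define s1 where "s1 = outputs (row_text G (length (s 3)) tok (cont (s 9) 0) (s 8) g @ e) s"
    have s1v: "s1 3 = s 3" "s1 5 = s 5" "s1 6 = s 6" "s1 8 = s 8" "s1 9 = s 9" by (simp_all add: s1_def)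
    have 1: "runs (print_row G l tok e g) s s1 (length (s 3) * (2 * l + 8) + 2 * l + 7)"
      unfolding s1_def by (rule runs_print_row[OF l0 e Cons.prems])
    have 2: "runs (seqs (map (print_row G l tok e) gs)) s1
      (outputs (concat (map (\<lambda>g. row_text G (length (s 3)) tok (cont (s 9) 0) (s 8) g @ e) gs)) s1)
      (length gs * (length (s 3) * (2 * l + 8) + 2 * l + 8) + 1)"
      using Cons.IH[of s1] Cons.prems unfolding s1v by blast
    from runs_Seq[OF 1 2] show ?case
      by (auto simp: s1_def outputs_append[symmetric] algebra_simps elim: runs_weaken)
  qed
  from this[of "[0..<G]"] show ?thesis by (simp add: print_cell_def cell_text_def)
qed

definition print_blocks :: "nat \<Rightarrow> nat \<Rightarrow> token \<Rightarrow> bool list \<Rightarrow> com" where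
  "print_blocks G l tok e = Whl (\<lambda>\<tau>. \<tau> 9 \<noteq> 0)
     (print_cell G l tok e ;; Act (\<lambda>\<tau> v. if v = 9 then Pop else if v = 8 then Push 1 else Keep))"

lemma runs_print_blocks:
  assumes l0: "\<And>a z g. length (block_text G tok a z g) \<le> l" and e: "length e \<le> l"
    and s: "small (s 3)" "small (s 8)" "s 5 = []" "s 6 = []" "small (s 9)"
  shows "runs (print_blocks G l tok e) s
    (outputs (concat (map (\<lambda>c. cell_text G (length (s 3)) tok e (s 9 ! c) (replicate c 1 @ s 8)) [0..<length (s 9)]))
      (s(9 := [], 8 := replicate (length (s 9)) 1 @ s 8)))
    (length (s 9) * (G * (length (s 3) * (2 * l + 8) + 2 * l + 8) + 4) + 1)"
  using s
proof (induction "s 9" arbitrary: s)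
  case Nil
  have nil: "s 9 = []" using Nil.hyps by simp
  have "s(9 := [], 8 := s 8) = s" using nil by (auto simp: fun_eq_iff)
  then have eq: "outputs (concat (map (\<lambda>c. cell_text G (length (s 3)) tok e (s 9 ! c) (replicate c 1 @ s 8)) [0..<length (s 9)]))
      (s(9 := [], 8 := replicate (length (s 9)) 1 @ s 8)) = s"
    by (simp add: nil del: fun_upd_apply)
  show ?case unfolding eq print_blocks_def
    by (rule runs_weaken[OF runs_Whl_False]) (simp_all add: tops_def nil)
next
  case (Cons a as)
  let ?T = "G * (length (s 3) * (2 * l + 8) + 2 * l + 8)"
  let ?t = "\<lambda>xs ds. concat (map (\<lambda>c. cell_text G (length (s 3)) tok e (xs ! c) (replicate c 1 @ ds)) [0..<length xs])"
  have s9: "s 9 = a # as" by (simp add: Cons.hyps)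
  define w where "w = cell_text G (length (s 3)) tok e a (s 8)"
  define s2 where "s2 = (outputs w s)(9 := as, 8 := 1 # s 8)"
  have 1: "runs (print_cell G l tok e) s (outputs w s) (?T + 1)"
    using runs_print_cell[OF l0 e Cons.prems(1-4)] by (simp add: w_def s9)
  have 2: "runs (Act (\<lambda>\<tau> v. if v = 9 then Pop else if v = 8 then Push 1 else Keep)) (outputs w s) s2 1"
    by (rule runs_Act) (auto simp: s2_def fun_eq_iff s9)
  have s2v: "s2 3 = s 3" "s2 5 = s 5" "s2 6 = s 6" "s2 8 = 1 # s 8" "s2 9 = as" by (simp_all add: s2_def)
  have IH: "runs (print_blocks G l tok e) s2
    (outputs (?t as (1 # s 8)) (s2(9 := [], 8 := replicate (length as) 1 @ 1 # s 8))) (length as * (?T + 4) + 1)"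
    using Cons.hyps(1)[of s2] Cons.prems unfolding s2v by (simp add: s9)
  have split: "?t (s 9) (s 8) = w @ ?t as (1 # s 8)"
  proof -
    have "[0..<Suc (length as)] = 0 # map Suc [0..<length as]" by (simp add: map_Suc_upt upt_conv_Cons del: upt_Suc)
    then show ?thesis by (simp add: s9 w_def comp_def replicate_app_Cons_same del: upt_Suc)
  qed
  have eq: "outputs (?t as (1 # s 8)) (s2(9 := [], 8 := replicate (length as) 1 @ 1 # s 8)) =
      outputs (?t (s 9) (s 8)) (s(9 := [], 8 := replicate (length (s 9)) 1 @ s 8))"
    unfolding split outputs_append by (auto simp: s2_def s9 fun_eq_iff replicate_app_Cons_same)
  have "runs (print_blocks G l tok e) s (outputs (?t as (1 # s 8)) (s2(9 := [], 8 := replicate (length as) 1 @ 1 # s 8)))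
      (Suc (Suc (?T + 1 + 1) + (length as * (?T + 4) + 1)))"
    unfolding print_blocks_def
    by (rule runs_Whl_True[OF _ runs_Seq[OF 1 2] IH[unfolded print_blocks_def]])
      (use Cons.prems(5) in \<open>simp add: tops_def s9\<close>)
  then show ?case unfolding eq by (rule runs_weaken) (simp add: s9)
qed

text \<open>\<open>e\<close> is the mark that closes a row and \<open>f\<close> the one that closes
  the matrix.\<close>

definition print_matrix :: "nat \<Rightarrow> nat \<Rightarrow> token \<Rightarrow> bool list \<Rightarrow> bool list \<Rightarrow> com" where
  "print_matrix G l tok e f = copy 3 5 9 ;; copy 4 5 8 ;; print_blocks G l tok e ;; emit l (\<lambda>_. f)"

definition print_single_row :: "nat \<Rightarrow> nat \<Rightarrow> token \<Rightarrow> bool list \<Rightarrow> bool list \<Rightarrow> com" where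
  "print_single_row G l tok e f = print_row G l tok e 0 ;; emit l (\<lambda>_. f)"

definition matrix_text :: "nat \<Rightarrow> token \<Rightarrow> bool list \<Rightarrow> nat list \<Rightarrow> nat list \<Rightarrow> bool list" where
  "matrix_text G tok e u d = concat (map (\<lambda>c. cell_text G (length u) tok e (u ! c) (replicate c 1 @ d)) [0..<length u])"

definition matrix_time :: "nat \<Rightarrow> nat \<Rightarrow> nat \<Rightarrow> nat \<Rightarrow> nat" where
  "matrix_time G l n d = n * (G * (n * (2 * l + 8) + 2 * l + 8) + 12) + 6 * d + 4 * l + 30"

lemma prints_matrix:
  assumes l0: "\<And>a z g. length (block_text G tok a z g) \<le> l" and e: "length e \<le> l" "length f \<le> l"
    and small: "small u" "small d"
  shows "prints u d (print_matrix G l tok e f) (matrix_text G tok e u d @ f) (matrix_time G l (length u) (length d))"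
  unfolding prints_def
proof (intro allI impI)
  fix s assume ready: "ready u d s"
  let ?n = "length u"
  define s1 where "s1 = s(9 := u)"
  define s2 where "s2 = s(9 := u, 8 := d)"
  define s3 where "s3 = outputs (matrix_text G tok e u d) (s(9 := [], 8 := replicate ?n 1 @ d))"
  have s: "s 3 = u" "s 4 = d" "s 5 = []" "s 6 = []" "small (s 8)" "small (s 9)"
    "length (s 8) \<le> ?n + length d" "length (s 9) \<le> ?n" using ready by (auto simp: ready_def)
  have 1: "runs (copy 3 5 9) s s1 (2 * length (s 9) + 4 * ?n + 5)"
    using runs_copy[of s 3 9 5] s small small_nonzero by (simp add: s1_def)
  have 2: "runs (copy 4 5 8) s1 s2 (2 * length (s 8) + 4 * length d + 5)"
    using runs_copy[of s1 4 8 5] s small small_nonzero by (simp add: s1_def s2_def)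
  have 3: "runs (print_blocks G l tok e) s2 s3 (?n * (G * (?n * (2 * l + 8) + 2 * l + 8) + 4) + 1)"
    using runs_print_blocks[OF l0 e(1), of s2] s small by (simp add: s2_def s3_def matrix_text_def fun_upd_twist)
  have 4: "runs (emit l (\<lambda>_. f)) s3 (outputs f s3) (2 * l + 1)"
    by (rule runs_emit) (use e in auto)
  have "runs (print_matrix G l tok e f) s (outputs f s3) (matrix_time G l ?n (length d))"
    unfolding print_matrix_def
    by (rule runs_weaken[OF runs_Seq[OF 1 runs_Seq[OF 2 runs_Seq[OF 3 4]]]])
      (use s(7,8) in \<open>simp add: matrix_time_def algebra_simps\<close>)
  moreover have "ready u d (outputs f s3)" using s small by (simp add: s3_def ready_def)
  moreover have "outputs f s3 1 = rev (map bit_symbol (matrix_text G tok e u d @ f)) @ s 1"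
    by (simp add: s3_def outputs_def)
  ultimately show "\<exists>s'. runs (print_matrix G l tok e f) s s' (matrix_time G l ?n (length d)) \<and> ready u d s' \<and>
      s' 1 = rev (map bit_symbol (matrix_text G tok e u d @ f)) @ s 1" by blast
qed

text \<open>With a constant token the text is determined by the number of rounds, so whatever
  earlier printing left on the stacks 8 and 9 is acceptable.\<close>

lemma prints_single_row:
  assumes l0: "\<And>a z g. length (block_text G (\<lambda>_ _ _ _. z0) a z g) \<le> l" and e: "length e \<le> l" "length f \<le> l"
    and small: "small u" and G: "0 < G"
  shows "prints u d (print_single_row G l (\<lambda>_ _ _ _. z0) e f)
    (concat (replicate (length u * G) z0) @ e @ f) (matrix_time G l (length u) (length d))"
  unfolding prints_def
proof (intro allI impI)
  fix s assume ready: "ready u d s"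
  let ?n = "length u"
  let ?tok = "\<lambda>_ _ _ _. z0 :: bool list"
  have s: "s 3 = u" "s 4 = d" "s 5 = []" "s 6 = []" "small (s 8)" "small (s 9)"
    "length (s 8) \<le> ?n + length d" "length (s 9) \<le> ?n" using ready by (auto simp: ready_def)
  define w where "w = row_text G ?n ?tok (cont (s 9) 0) (s 8) 0 @ e"
  have 1: "runs (print_row G l ?tok e 0) s (outputs w s) (?n * (2 * l + 8) + 2 * l + 7)"
    using runs_print_row[OF l0 e(1), of s 0] s small by (simp add: w_def)
  have 2: "runs (emit l (\<lambda>_. f)) (outputs w s) (outputs f (outputs w s)) (2 * l + 1)"
    by (rule runs_emit) (use e in auto)
  have w: "w = concat (replicate (?n * G) z0) @ e"
  proof -
    have "concat (map (\<lambda>c. concat (map (\<lambda>g. z0) [0..<G])) [0..<j]) = concat (replicate (j * G) z0)" for j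
      by (induction j) (simp_all add: map_replicate_const replicate_add[symmetric] add.commute flip: concat_append)
    then show ?thesis by (simp add: w_def row_text_def block_text_def)
  qed
  show "\<exists>s'. runs (print_single_row G l ?tok e f) s s' (matrix_time G l ?n (length d)) \<and> ready u d s' \<and>
      s' 1 = rev (map bit_symbol (concat (replicate (?n * G) z0) @ e @ f)) @ s 1"
  proof (intro exI conjI)
    show "runs (print_single_row G l ?tok e f) s (outputs f (outputs w s)) (matrix_time G l ?n (length d))"
      unfolding print_single_row_def
    proof (rule runs_weaken[OF runs_Seq[OF 1 2]])
      have "2 * l + 8 \<le> G * (?n * (2 * l + 8) + 2 * l + 8) + 12"
        using G by (cases G) simp_all
      then have "?n * (2 * l + 8) \<le> ?n * (G * (?n * (2 * l + 8) + 2 * l + 8) + 12)"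
        by (rule mult_le_mono2)
      then show "Suc (?n * (2 * l + 8) + 2 * l + 7 + (2 * l + 1)) \<le> matrix_time G l ?n (length d)"
        unfolding matrix_time_def by linarith
    qed
    show "ready u d (outputs f (outputs w s))" using ready by (simp add: ready_outputs)
    show "outputs f (outputs w s) 1 = rev (map bit_symbol (concat (replicate (?n * G) z0) @ e @ f)) @ s 1"
      by (simp add: outputs_def w)
  qed
qed

section \<open>Laying out the cell classes\<close>

text \<open>Multiplication in unary: for each symbol of stack 5 the contents of stack 2 are added to
  stack 7 and restored by way of stack 6.\<close>

definition multiply :: com where
  "multiply = Whl (\<lambda>\<tau>. \<tau> 5 \<noteq> 0)
     (upd 5 (\<lambda>_. Pop) ;; xfer 2 (\<lambda>v x. if v = 6 \<or> v = 7 then 1 else 0) ;; move 6 2 (\<lambda>_. 1))"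

lemma runs_multiply:
  assumes "s 2 = replicate n 1" "s 5 = replicate a 1" "s 6 = []"
  shows "runs multiply s (s(5 := [], 7 := replicate (a * n) 1 @ s 7)) (a * (4 * n + 6) + 1)"
  using assms
proof (induction a arbitrary: s)
  case 0
  then have "s(5 := [], 7 := replicate (0 * n) 1 @ s 7) = s" by (auto simp: fun_eq_iff)
  then show ?case unfolding multiply_def
    by (simp only:) (rule runs_weaken[OF runs_Whl_False]; use 0 in \<open>simp add: tops_def\<close>)
next
  case (Suc a)
  define s1 where "s1 = s(5 := replicate a 1)"
  define s2 where "s2 = s1(2 := [], 6 := replicate n 1, 7 := replicate n 1 @ s 7)"
  define s3 where "s3 = s1(7 := replicate n 1 @ s 7)"
  have 1: "runs (upd 5 (\<lambda>_. Pop)) s s1 1"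
    by (rule runs_upd) (use Suc.prems in \<open>simp add: s1_def\<close>)
  have 2: "runs (xfer 2 (\<lambda>v x. if v = 6 \<or> v = 7 then 1 else 0)) s1 s2 (2 * n + 1)"
    by (rule runs_xfer) (use Suc.prems in \<open>auto simp: s1_def s2_def fun_eq_iff filter_replicate\<close>)
  have 3: "runs (move 6 2 (\<lambda>_. 1)) s2 s3 (2 * n + 1)"
    by (rule runs_move) (use Suc.prems in \<open>auto simp: s1_def s2_def s3_def fun_eq_iff map_replicate_const\<close>)
  have 4: "runs multiply s3 (s3(5 := [], 7 := replicate (a * n) 1 @ s3 7)) (a * (4 * n + 6) + 1)"
    by (rule Suc.IH) (use Suc.prems in \<open>simp_all add: s3_def s1_def\<close>)
  have eq: "s3(5 := [], 7 := replicate (a * n) 1 @ s3 7) = s(5 := [], 7 := replicate (Suc a * n) 1 @ s 7)"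
    by (auto simp: s3_def s1_def fun_eq_iff replicate_add add.commute[of n])
  have "runs multiply s (s(5 := [], 7 := replicate (Suc a * n) 1 @ s 7))
      (Suc (Suc (1 + Suc (2 * n + 1 + (2 * n + 1))) + (a * (4 * n + 6) + 1)))"
    unfolding multiply_def
    by (rule runs_Whl_True[OF _ runs_Seq[OF 1 runs_Seq[OF 2 3]] 4[unfolded eq multiply_def]])
      (use Suc.prems in \<open>simp add: tops_def\<close>)
  then show ?case by (rule runs_weaken) simp
qed

lemma runs_pushes: "runs (seqs (replicate a (upd b (\<lambda>_. Push x)))) s (s(b := replicate a x @ s b)) (2 * a + 1)"
proof (induction a arbitrary: s)
  case 0
  then show ?case using runs_skip[of s] by simp
next
  case (Suc a)
  have "runs (upd b (\<lambda>_. Push x)) s (s(b := x # s b)) 1" by (rule runs_upd) simp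
  from runs_Seq[OF this Suc.IH] show ?case
    by (simp add: replicate_app_Cons_same fun_upd_same del: fun_upd_apply)
qed

text \<open>The argument, the length of the input, stands in unary on stack 2; the coefficients are
  part of the program.\<close>

fun horner :: "nat list \<Rightarrow> com" where
  "horner [] = skip"
| "horner (a # as) = horner as ;; multiply ;; seqs (replicate a (upd 7 (\<lambda>_. Push 1))) ;; move 7 5 (\<lambda>_. 1)"

fun horner_time :: "nat list \<Rightarrow> nat \<Rightarrow> nat" where
  "horner_time [] n = 1"
| "horner_time (a # as) n = horner_time as n + poly (Poly as) n * (4 * n + 6) +
     2 * (poly (Poly as) n * n) + 4 * a + 6"

lemma runs_horner:
  assumes "s 2 = replicate n 1" "s 5 = []" "s 6 = []" "s 7 = []"
  shows "runs (horner as) s (s(5 := replicate (poly (Poly as) n) 1)) (horner_time as n)"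
proof (induction as)
  case Nil
  then have "s(5 := replicate (poly (Poly []) n) 1) = s" using assms by (auto simp: fun_eq_iff)
  then show ?case using runs_skip[of s] by (simp del: fun_upd_apply)
next
  case (Cons a as)
  let ?v = "poly (Poly as) n"
  define s1 where "s1 = s(5 := replicate ?v 1)"
  define s2 where "s2 = s(7 := replicate (?v * n) 1)"
  define s3 where "s3 = s(7 := replicate (a + ?v * n) 1)"
  have 1: "runs (horner as) s s1 (horner_time as n)" unfolding s1_def by (rule Cons)
  have "s1(5 := [], 7 := replicate (?v * n) 1 @ s1 7) = s2"
    using assms by (auto simp: s1_def s2_def fun_eq_iff)
  then have 2: "runs multiply s1 s2 (?v * (4 * n + 6) + 1)"
    using runs_multiply[of s1 n ?v] assms by (simp add: s1_def)
  have "s2(7 := replicate a 1 @ s2 7) = s3"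
    by (auto simp: s2_def s3_def fun_eq_iff replicate_add)
  then have 3: "runs (seqs (replicate a (upd 7 (\<lambda>_. Push 1)))) s2 s3 (2 * a + 1)"
    using runs_pushes[of a 7 1 s2] by simp
  have 4: "runs (move 7 5 (\<lambda>_. 1)) s3 (s(5 := replicate (poly (Poly (a # as)) n) 1)) (2 * (a + ?v * n) + 1)"
    by (rule runs_move) (use assms in \<open>auto simp: s3_def fun_eq_iff map_replicate_const mult.commute\<close>)
  show ?case unfolding horner.simps
    by (rule runs_weaken[OF runs_Seq[OF 1 runs_Seq[OF 2 runs_Seq[OF 3 4]]]]) simp
qed

definition push_poly :: "nat poly \<Rightarrow> nat \<Rightarrow> nat \<Rightarrow> com" where
  "push_poly p d a = horner (coeffs p) ;; move 5 d (\<lambda>_. a)"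

definition push_time :: "nat poly \<Rightarrow> nat \<Rightarrow> nat" where
  "push_time p n = horner_time (coeffs p) n + 2 * poly p n + 2"

lemma runs_push_poly:
  assumes "s 2 = replicate n 1" "s 5 = []" "s 6 = []" "s 7 = []" "d \<notin> {2, 5, 6, 7}" "a \<noteq> 0"
    "s' = s(d := replicate (poly p n) a @ s d)"
  shows "runs (push_poly p d a) s s' (push_time p n)"
proof -
  have 1: "runs (horner (coeffs p)) s (s(5 := replicate (poly p n) 1)) (horner_time (coeffs p) n)"
    using runs_horner[OF assms(1-4), of "coeffs p"] by simp
  have 2: "runs (move 5 d (\<lambda>_. a)) (s(5 := replicate (poly p n) 1)) s' (2 * poly p n + 1)"
    by (rule runs_move) (use assms in \<open>auto simp: fun_eq_iff map_replicate_const\<close>)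
  show ?thesis unfolding push_poly_def push_time_def
    by (rule runs_weaken[OF runs_Seq[OF 1 2]]) simp
qed

text \<open>Stack 4 holds the input in reverse, so pushing from it restores the order.\<close>

definition double_bits :: com where
  "double_bits = Whl (\<lambda>\<tau>. \<tau> 4 \<noteq> 0)
     (upd 3 (\<lambda>\<tau>. Push (bit_clamp (\<tau> 4))) ;;
      Act (\<lambda>\<tau> v. if v = 3 then Push (bit_clamp (\<tau> 4)) else if v = 4 then Pop else Keep))"

lemma runs_double_bits:
  assumes "s 4 = map bit_symbol (rev y)"
  shows "runs double_bits s (s(4 := [], 3 := map bit_symbol (concat (map (\<lambda>b. [b, b]) y)) @ s 3)) (4 * length y + 1)"
  using assms
proof (induction y arbitrary: s rule: rev_induct)
  case Nil
  then have "s(4 := [], 3 := map bit_symbol (concat (map (\<lambda>b. [b, b]) [])) @ s 3) = s"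
    by (auto simp: fun_eq_iff)
  then show ?case unfolding double_bits_def
    by (simp only:) (rule runs_weaken[OF runs_Whl_False]; use Nil in \<open>simp add: tops_def\<close>)
next
  case (snoc b y)
  let ?b = "bit_symbol b"
  define s1 where "s1 = s(3 := ?b # s 3)"
  define s2 where "s2 = s(3 := ?b # ?b # s 3, 4 := map bit_symbol (rev y))"
  have 1: "runs (upd 3 (\<lambda>\<tau>. Push (bit_clamp (\<tau> 4)))) s s1 1"
    by (rule runs_upd) (use snoc.prems in \<open>simp add: s1_def tops_def\<close>)
  have 2: "runs (Act (\<lambda>\<tau> v. if v = 3 then Push (bit_clamp (\<tau> 4)) else if v = 4 then Pop else Keep)) s1 s2 1"
    by (rule runs_Act) (use snoc.prems in \<open>auto simp: s1_def s2_def tops_def fun_eq_iff\<close>)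
  have 3: "runs double_bits s2 (s2(4 := [], 3 := map bit_symbol (concat (map (\<lambda>b. [b, b]) y)) @ s2 3)) (4 * length y + 1)"
    by (rule snoc.IH) (simp add: s2_def)
  have eq: "s2(4 := [], 3 := map bit_symbol (concat (map (\<lambda>b. [b, b]) y)) @ s2 3) =
      s(4 := [], 3 := map bit_symbol (concat (map (\<lambda>b. [b, b]) (y @ [b]))) @ s 3)"
    by (auto simp: s2_def fun_eq_iff)
  have "runs double_bits s (s(4 := [], 3 := map bit_symbol (concat (map (\<lambda>b. [b, b]) (y @ [b]))) @ s 3))
      (Suc (Suc (1 + 1) + (4 * length y + 1)))"
    unfolding double_bits_def
    by (rule runs_Whl_True[OF _ runs_Seq[OF 1 2] 3[unfolded eq double_bits_def]])
      (use snoc.prems in \<open>simp add: tops_def\<close>)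
  then show ?case by (rule runs_weaken) simp
qed

definition links :: "nat \<Rightarrow> nat list" where
  "links m = [2, 3] @ replicate (m - 2) 1 @ [4]"

text \<open>A link depends only on the difference of the two cells. The list for cell 0 thus becomes
  the list for cell \<open>c\<close> when it is preceded by \<open>c\<close> entries without
  link.\<close>

lemma link_links: "2 \<le> m \<Longrightarrow> link_of (cont (replicate c 1 @ links m) c') = link m c c'"
  by (auto simp: links_def link_of_def link_def cont_def nth_append nth_Cons')

text \<open>The polynomials \<open>p\<close> and \<open>t\<close> bound the certificate length and the running time.\<close>

definition prepare :: "nat poly \<Rightarrow> nat poly \<Rightarrow> com" where
  "prepare p t =
     xfer 0 (\<lambda>v b. if v = 2 then 1 else if v = 4 then bit_clamp b else 0) ;;
     upd 3 (\<lambda>_. Push 6) ;;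
     push_poly (([:4, 2:] + p + t) * t) 3 5 ;;
     push_poly (t + 2) 3 4 ;;
     push_poly p 3 3 ;;
     upd 3 (\<lambda>_. Push 2) ;;
     upd 3 (\<lambda>_. Push 1) ;;
     double_bits ;;
     upd 3 (\<lambda>\<tau>. Put (if \<tau> 3 = 2 then 8 else 7)) ;;
     upd 4 (\<lambda>_. Push 4) ;;
     push_poly ([:2, 2:] + p + t) 4 1 ;;
     upd 4 (\<lambda>_. Push 3) ;;
     upd 4 (\<lambda>_. Push 2)"

definition prepare_time :: "nat poly \<Rightarrow> nat poly \<Rightarrow> nat \<Rightarrow> nat" where
  "prepare_time p t n = push_time (([:4, 2:] + p + t) * t) n + push_time (t + 2) n + push_time p n +
     push_time ([:2, 2:] + p + t) n + 6 * n + 21"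

text \<open>The classes are pushed from the last cell to the first: the accepting cell, the
  unconstrained rows, blanks, free cells, the end mark as \<open>1\<close> and \<open>2\<close>, and
  the doubled input. Finally the first cell is raised by 6. The links are pushed from their end as
  well.\<close>

lemma runs_prepare:
  fixes p t :: "nat poly"
  defines "pn \<equiv> \<lambda>x :: bool list. poly p (length x)" and "tn \<equiv> \<lambda>x :: bool list. poly t (length x)"
  shows "\<exists>s. runs (prepare p t) (init_store x) s (prepare_time p t (length x)) \<and>
    ready (layout (delimit x) (pn x) (tn x)) (links (length (row0 (delimit x) (pn x) (tn x)))) s \<and> s 1 = []"
proof -
  let ?n = "length x"
  let ?D = "map bit_symbol (concat (map (\<lambda>b. [b, b]) x))"
  define w where "w = row0 (delimit x) (pn x) (tn x)"
  define m where "m = length w"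
  have lenD: "length (concat (map (\<lambda>b. [b, b]) x)) = 2 * ?n" by (induction x) auto
  have m: "m = 2 * ?n + 4 + pn x + tn x" by (simp add: m_def w_def row0_def delimit_def lenD)
  define r1 :: store where "r1 = (\<lambda>_. [])(2 := replicate ?n 1, 4 := map bit_symbol (rev x))"
  define B where "B = replicate (m * tn x) 5 @ [6::nat]"
  define r where "r = (\<lambda>b. r1(3 := b))"
  have r2: "r b 2 = replicate ?n 1" "r b 5 = []" "r b 6 = []" "r b 7 = []" "r b 3 = b" for b
    by (simp_all add: r_def r1_def)
  have r_upd: "(r b)(3 := b') = r b'" for b b' by (simp add: r_def)
  have 1: "runs (xfer 0 (\<lambda>v b. if v = 2 then 1 else if v = 4 then bit_clamp b else 0)) (init_store x) (r []) (2 * ?n + 1)"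
  proof (rule runs_xfer)
    have a: "filter (\<lambda>y. 0 < y) (map (bit_clamp \<circ> bit_symbol) x) = map bit_symbol x"
      by (simp add: filter_id_conv)
    have b: "filter (\<lambda>y. 0 < y) (map ((\<lambda>b. 0::nat) \<circ> bit_symbol) x) = []" by simp
    show "r [] = (\<lambda>v. if v = 0 then [] else rev (filter (\<lambda>y. y \<noteq> 0)
      (map ((\<lambda>v b. if v = 2 then 1 else if v = 4 then bit_clamp b else 0) v) (init_store x 0))) @ init_store x v)"
      by (auto simp: fun_eq_iff r_def r1_def init_store_def rev_map comp_def map_replicate_const)
  qed (auto simp: init_store_def)
  have 2: "runs (upd 3 (\<lambda>_. Push 6)) (r []) (r [6]) 1"
    by (rule runs_upd) (simp add: r_upd r2)
  have 3: "runs (push_poly (([:4, 2:] + p + t) * t) 3 5) (r [6]) (r B) (push_time (([:4, 2:] + p + t) * t) ?n)"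
    by (rule runs_push_poly[OF r2(1-4)]) (simp_all add: r_upd r2 B_def m pn_def tn_def algebra_simps)
  have 4: "runs (push_poly (t + 2) 3 4) (r B) (r (replicate (tn x + 2) 4 @ B)) (push_time (t + 2) ?n)"
    by (rule runs_push_poly[OF r2(1-4)]) (simp_all add: r_upd r2 tn_def)
  have 5: "runs (push_poly p 3 3) (r (replicate (tn x + 2) 4 @ B)) (r (replicate (pn x) 3 @ replicate (tn x + 2) 4 @ B)) (push_time p ?n)"
    by (rule runs_push_poly[OF r2(1-4)]) (simp_all only: r_upd r2 pn_def, simp_all)
  have 6: "runs (upd 3 (\<lambda>_. Push a)) (r b) (r (a # b)) 1" for a b
    by (rule runs_upd) (simp add: r_upd r2)
  let ?E = "1 # 2 # replicate (pn x) 3 @ replicate (tn x + 2) 4 @ B"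
  have w: "?D @ ?E = w @ B" by (simp add: w_def row0_def delimit_def bit_symbol_def)
  define r8 where "r8 = r1(4 := [], 3 := w @ B)"
  have 8: "runs double_bits (r ?E) r8 (4 * ?n + 1)"
  proof -
    have "runs double_bits (r ?E) ((r ?E)(4 := [], 3 := ?D @ r ?E 3)) (4 * ?n + 1)"
      by (rule runs_double_bits) (simp add: r_def r1_def)
    moreover have "(r ?E)(4 := [], 3 := ?D @ r ?E 3) = r8"
      unfolding r2(5) w by (auto simp: r_def r8_def fun_eq_iff)
    ultimately show ?thesis by (simp only:)
  qed
  define u where "u = layout (delimit x) (pn x) (tn x)"
  have hw: "w \<noteq> []" "hd w = 1 \<or> hd w = 2"
    unfolding w_def row0_def delimit_def by (cases x; auto simp: bit_symbol_def)+
  define r9 where "r9 = r1(4 := [], 3 := u)"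
  have 9: "runs (upd 3 (\<lambda>\<tau>. Put (if \<tau> 3 = 2 then 8 else 7))) r8 r9 1"
    by (rule runs_upd) (use hw in \<open>cases w; auto simp: r8_def r9_def tops_def u_def layout_def w_def[symmetric] m_def B_def\<close>)
  define q where "q = (\<lambda>b. r1(4 := b, 3 := u))"
  have q2: "q b 2 = replicate ?n 1" "q b 5 = []" "q b 6 = []" "q b 7 = []" "q b 4 = b" "q b 3 = u" for b
    by (simp_all add: q_def r1_def)
  have q_upd: "(q b)(4 := b') = q b'" for b b' by (auto simp: q_def)
  have 10: "runs (upd 4 (\<lambda>_. Push a)) (q b) (q (a # b)) 1" for a b
    by (rule runs_upd) (simp add: q_upd q2)
  have 11: "runs (push_poly ([:2, 2:] + p + t) 4 1) (q [4]) (q (replicate (m - 2) 1 @ [4])) (push_time ([:2, 2:] + p + t) ?n)"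
  proof -
    have e: "m - 2 = poly ([:2, 2:] + p + t) ?n" by (simp add: m pn_def tn_def)
    show ?thesis unfolding e by (rule runs_push_poly[OF q2(1-4)]) (simp_all only: q_upd q2, simp_all)
  qed
  have r9: "r9 = q []" by (simp add: r9_def q_def)
  have run: "runs (prepare p t) (init_store x) (q (links m)) (prepare_time p t ?n)"
    unfolding prepare_def links_def append_Cons append_Nil
    by (rule runs_weaken[OF runs_Seq[OF 1 runs_Seq[OF 2 runs_Seq[OF 3 runs_Seq[OF 4 runs_Seq[OF 5
        runs_Seq[OF 6 runs_Seq[OF 6 runs_Seq[OF 8 runs_Seq[OF 9[unfolded r9] runs_Seq[OF 10 runs_Seq[OF 11 runs_Seq[OF 10 10]]]]]]]]]]]]])
      (simp add: prepare_time_def)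
  have "ready u (links m) (q (links m))" by (simp add: ready_def q_def r1_def)
  moreover have "q (links m) 1 = []" by (simp add: q_def r1_def)
  ultimately show ?thesis using run unfolding u_def m_def w_def by blast
qed

lemma small_layout: "small (layout (delimit x) p t)"
proof -
  have "set (row0 (delimit x) p t) \<subseteq> {1, 2, 3, 4}" by (auto simp: row0_def bit_symbol_def)
  moreover have "hd (row0 (delimit x) p t) \<in> {1, 2}"
    unfolding row0_def delimit_def by (cases x) (auto simp: bit_symbol_def)
  moreover have "set (tl (row0 (delimit x) p t)) \<subseteq> set (row0 (delimit x) p t)"
    by (cases "row0 (delimit x) p t") auto
  ultimately have "set (layout (delimit x) p t) \<subseteq> {1..8}" unfolding layout_def by fastforce
  then show ?thesis by (simp add: small_def)
qed

lemma small_links: "small (links m)"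
  by (auto simp: links_def)

section \<open>Polynomial time bounds\<close>

definition is_poly :: "(nat \<Rightarrow> nat) \<Rightarrow> bool" where
  "is_poly f \<longleftrightarrow> (\<exists>p. \<forall>n. f n = poly p n)"

lemma is_poly_poly: "is_poly (poly p)"
  by (auto simp: is_poly_def)

lemma is_poly_const: "is_poly (\<lambda>n. k)"
  unfolding is_poly_def by (intro exI[of _ "[:k:]"]) simp

lemma is_poly_id: "is_poly (\<lambda>n. n)"
  unfolding is_poly_def by (intro exI[of _ "[:0, 1:]"]) simp

lemma is_poly_add: "is_poly f \<Longrightarrow> is_poly g \<Longrightarrow> is_poly (\<lambda>n. f n + g n)"
  unfolding is_poly_def by (metis poly_add)

lemma is_poly_mult: "is_poly f \<Longrightarrow> is_poly g \<Longrightarrow> is_poly (\<lambda>n. f n * g n)"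
  unfolding is_poly_def by (metis poly_mult)

lemma is_poly_Suc: "is_poly f \<Longrightarrow> is_poly (\<lambda>n. Suc (f n))"
  using is_poly_add[OF _ is_poly_const[of 1], of f] by simp

lemma is_poly_horner_time: "is_poly (horner_time as)"
proof (induction as)
  case Nil
  then show ?case using is_poly_const[of 1] by (simp add: is_poly_def)
next
  case (Cons a as)
  have "horner_time (a # as) = (\<lambda>n. horner_time as n + poly (Poly as) n * (4 * n + 6) +
     2 * (poly (Poly as) n * n) + 4 * a + 6)" by auto
  then show ?case using Cons by (simp only:) (intro is_poly_add is_poly_mult is_poly_const is_poly_id is_poly_poly)
qed

lemma is_poly_push_time: "is_poly (push_time p)"
  unfolding push_time_def[abs_def]
  by (intro is_poly_add is_poly_mult is_poly_const is_poly_poly is_poly_horner_time)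

lemma is_poly_prepare_time: "is_poly (prepare_time p t)"
  unfolding prepare_time_def[abs_def]
  by (intro is_poly_add is_poly_mult is_poly_const is_poly_id is_poly_push_time)

lemma bounded_push_poly:
  assumes "d < 10" "a < 9" "a \<noteq> 0"
  shows "bounded 10 9 (push_poly p d a)"
proof -
  have "bounded 10 9 (horner as)" for as
    by (induction as)
      (auto simp: skip_def multiply_def intro!: bounded_upd bounded_xfer bounded_move bounded_seqs)
  then show ?thesis using assms by (auto simp: push_poly_def intro!: bounded_move)
qed

lemma bounded_prepare: "bounded 10 9 (prepare p t)"
proof -
  have "bit_clamp b < 9" for b by (simp add: bit_clamp_def)
  then show ?thesis
    by (auto simp: prepare_def double_bits_def intro!: bounded_upd bounded_xfer bounded_push_poly)
qed

section \<open>The reduction is computable in polynomial time\<close>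

definition dbl :: "bool list \<Rightarrow> bool list" where
  "dbl z = concat (map (\<lambda>b. [b, b]) z)"

text \<open>A text inside \<open>k\<close> further delimiters has its bits doubled \<open>k\<close>
  times. Doubling distributes over concatenation, so each piece can be printed in its final form and
  no program has to delimit a text after printing it.\<close>

definition lev :: "nat \<Rightarrow> bool list \<Rightarrow> bool list" where
  "lev k = dbl ^^ k"

lemma delimit_dbl: "delimit z = dbl z @ [False, True]"
  by (simp add: delimit_def dbl_def)

lemma lev_append: "lev k (a @ b) = lev k a @ lev k b"
  by (induction k arbitrary: a b) (simp_all add: lev_def dbl_def)

lemma lev_Nil [simp]: "lev k [] = []"
  by (induction k) (simp_all add: lev_def dbl_def)

lemma lev_concat: "lev k (concat xs) = concat (map (lev k) xs)"
  by (induction xs) (simp_all add: lev_append)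

lemma lev_mark: "lev k (False # True # z) = lev k [False, True] @ lev k z"
  using lev_append[of k "[False, True]" z] by simp

lemma lev_dbl: "lev k (dbl z) = lev (Suc k) z"
  by (simp add: lev_def funpow_swap1)

lemma lev_0 [simp]: "lev 0 z = z"
  by (simp add: lev_def)

text \<open>An entry stands in a delimited row of a delimited matrix, hence the two additional
  levels.\<close>

definition rat_token :: "nat \<Rightarrow> rat \<Rightarrow> bool list" where
  "rat_token k r = lev (k + 2) (delimit (enc_rat r))"

definition mat_token :: "nat \<Rightarrow> rat mat \<Rightarrow> bool list" where
  "mat_token k A = lev k (delimit (enc_mat A))"

lemma mat_token_eq:
  "mat_token k A = concat (map (\<lambda>row. concat (map (rat_token k) row) @ lev (Suc k) [False, True]) (mat_to_list A))
    @ lev k [False, True]"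
proof -
  have "lev (Suc k) (enc_mat A) = concat (map (\<lambda>row. lev (Suc k) (delimit (enc_list enc_rat row))) (mat_to_list A))"
    unfolding enc_mat_def enc_list_def[of "enc_list enc_rat"] by (simp add: lev_concat comp_def)
  moreover have "lev (Suc k) (delimit (enc_list enc_rat row)) = concat (map (rat_token k) row) @ lev (Suc k) [False, True]" for row
  proof -
    have "lev (Suc (Suc k)) (enc_list enc_rat row) = concat (map (rat_token k) row)"
      unfolding enc_list_def by (simp add: lev_concat comp_def rat_token_def[abs_def])
    then show ?thesis by (simp add: delimit_dbl lev_append lev_dbl)
  qed
  ultimately show ?thesis by (simp add: mat_token_def delimit_dbl lev_append lev_dbl)
qed

lemma lev_enc_mats: "lev k (enc_mats As) = concat (map (mat_token k) As)"
  unfolding enc_mats_def enc_list_def by (simp add: lev_concat comp_def mat_token_def[abs_def])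

lemma concat_blocks:
  "concat (map f [0..<N * G]) = concat (map (\<lambda>c. concat (map (\<lambda>g. f (c * G + g)) [0..<G])) [0..<N])"
proof (induction N)
  case (Suc N)
  have "Suc N * G = N * G + G" by simp
  then have "[0..<Suc N * G] = [0..<N * G] @ [N * G..<N * G + G]"
    by (simp only: upt_add_eq_append[of 0])
  moreover have "map f [N * G..<N * G + G] = map (\<lambda>g. f (N * G + g)) [0..<G]"
    by (rule nth_equalityI) auto
  ultimately show ?case using Suc by simp
qed simp

lemma blocks_text:
  assumes m: "2 \<le> m"
  shows "matrix_text G (\<lambda>a d g g'. rat_token k (e a d g g')) (lev (Suc k) [False, True]) u (links m) @ lev k [False, True] =
    mat_token k (blocks G m u e)"
proof -
  let ?N = "length u" and ?A = "blocks G m u e" and ?E = "lev (Suc k) [False, True]"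
  have dim: "dim_row ?A = ?N * G" "dim_col ?A = ?N * G" by (simp_all add: blocks_def)
  have row: "concat (map (\<lambda>j. rat_token k (?A $$ (c * G + g, j))) [0..<?N * G]) =
      row_text G ?N (\<lambda>a d g g'. rat_token k (e a d g g')) (u ! c) (replicate c 1 @ links m) g"
    if "c < ?N" "g < G" for c g
  proof -
    have less: "c * G + g < ?N * G" if "c < ?N" "g < G" for c g
      using that by (metis div_less_iff_less_mult add.commute div_mult_self1 add_0_right div_less gr_implies_not0 neq0_conv mult.commute)
    have "?A $$ (c * G + g, c' * G + g') = e (u ! c) (link_of (cont (replicate c 1 @ links m) c')) g g'"
      if "c' < ?N" "g' < G" for c' g'
      using less[OF \<open>c < ?N\<close> \<open>g < G\<close>] less[OF that] \<open>g < G\<close> that(2)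
      by (simp add: blocks_def link_links[OF m] del: One_nat_def)
    then show ?thesis unfolding row_text_def block_text_def concat_blocks
      by (intro arg_cong[of _ _ concat] map_cong refl) auto
  qed
  have "mat_token k ?A = concat (map (\<lambda>i. concat (map (\<lambda>j. rat_token k (?A $$ (i, j))) [0..<?N * G]) @ ?E) [0..<?N * G]) @ lev k [False, True]"
    unfolding mat_token_eq mat_to_list_def dim by (simp add: comp_def)
  also have "\<dots> = matrix_text G (\<lambda>a d g g'. rat_token k (e a d g g')) ?E u (links m) @ lev k [False, True]"
    unfolding matrix_text_def cell_text_def concat_blocks[of "\<lambda>i. concat (map (\<lambda>j. rat_token k (?A $$ (i, j))) [0..<?N * G]) @ ?E"]
    by (intro arg_cong2[of _ _ _ _ "(@)"] arg_cong[of _ _ concat] map_cong refl) (use row in auto)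
  finally show ?thesis by simp
qed

lemma zero_row_text:
  "mat_token k (0\<^sub>m 1 n) = concat (replicate n (rat_token k 0)) @ lev (Suc k) [False, True] @ lev k [False, True]"
proof -
  have "mat_to_list (0\<^sub>m 1 n :: rat mat) = [replicate n 0]"
    by (auto simp: mat_to_list_def intro: nth_equalityI)
  then show ?thesis by (simp add: mat_token_eq map_replicate)
qed

text \<open>A stand-in for polynomials in two variables: all that is needed is that substituting
  polynomials yields a polynomial.\<close>

definition is_poly2 :: "(nat \<Rightarrow> nat \<Rightarrow> nat) \<Rightarrow> bool" where
  "is_poly2 T \<longleftrightarrow> (\<forall>f g. is_poly f \<longrightarrow> is_poly g \<longrightarrow> is_poly (\<lambda>n. T (f n) (g n)))"

definition printable :: "(nat list \<Rightarrow> nat \<Rightarrow> bool list) \<Rightarrow> bool" where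
  "printable w \<longleftrightarrow> (\<exists>c T. bounded 10 9 c \<and> is_poly2 T \<and>
     (\<forall>u m. small u \<longrightarrow> 2 \<le> m \<longrightarrow> prints u (links m) c (w u m) (T (length u) m)))"

lemma printable_append:
  assumes "printable v" "printable w"
  shows "printable (\<lambda>u m. v u m @ w u m)"
proof -
  obtain c1 T1 where 1: "bounded 10 9 c1" "is_poly2 T1"
    "\<And>u m. small u \<Longrightarrow> 2 \<le> m \<Longrightarrow> prints u (links m) c1 (v u m) (T1 (length u) m)"
    using assms(1) unfolding printable_def by blast
  obtain c2 T2 where 2: "bounded 10 9 c2" "is_poly2 T2"
    "\<And>u m. small u \<Longrightarrow> 2 \<le> m \<Longrightarrow> prints u (links m) c2 (w u m) (T2 (length u) m)"
    using assms(2) unfolding printable_def by blast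
  have "is_poly2 (\<lambda>n m. Suc (T1 n m + T2 n m))"
    unfolding is_poly2_def
    by (intro allI impI is_poly_Suc is_poly_add 1(2)[unfolded is_poly2_def, rule_format] 2(2)[unfolded is_poly2_def, rule_format])
  then show ?thesis unfolding printable_def using 1 2 prints_Seq
    by (intro exI[of _ "c1 ;; c2"] exI[of _ "\<lambda>n m. Suc (T1 n m + T2 n m)"]) auto
qed

lemma printable_const: "printable (\<lambda>u m. w)"
  unfolding printable_def using prints_const[of _ _ w]
  by (intro exI[of _ "emit (length w) (\<lambda>_. w)"] exI[of _ "\<lambda>n m. 2 * length w + 1"])
    (auto simp: is_poly2_def bounded_emit is_poly_const)

lemma is_poly2_matrix_time: "is_poly2 (\<lambda>n m. matrix_time G l n (m + 1))"
  unfolding is_poly2_def matrix_time_def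
  by (intro allI impI is_poly_add is_poly_mult is_poly_const)

lemma bounded_print_row: "bounded 10 9 (print_row G l tok e g)"
  by (auto simp: print_row_def row_loop_def intro!: bounded_emit bounded_move)

lemma length_links: "2 \<le> m \<Longrightarrow> length (links m) = m + 1"
  by (simp add: links_def)

lemma length_rat_token_le:
  assumes "finite F" "r \<in> F"
  shows "length (rat_token k r) \<le> (\<Sum>r \<in> F. length (rat_token k r))"
  using assms by (intro member_le_sum) auto

text \<open>Finitely many values have tokens of bounded length, so the text of one block row is
  short enough for a fixed sequence of pushes that depends only on the tops.\<close>

lemma printable_blocks:
  assumes F: "finite F" "\<And>a d g g'. e a d g g' \<in> F"
  shows "printable (\<lambda>u m. mat_token k (blocks G m u e))"
proof -
  define l where "l = G * (\<Sum>r \<in> F. length (rat_token k r)) + length (lev (Suc k) [False, True]) + length (lev k [False, True])"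
  let ?tok = "\<lambda>a d g g'. rat_token k (e a d g g')"
  have l0: "length (block_text G ?tok a z g) \<le> l" for a z g
    by (rule length_block_text[of _ "\<Sum>r \<in> F. length (rat_token k r)"])
      (use length_rat_token_le[OF F(1)] F(2) in \<open>auto simp: l_def\<close>)
  let ?c = "print_matrix G l ?tok (lev (Suc k) [False, True]) (lev k [False, True])"
  have "prints u (links m) ?c (mat_token k (blocks G m u e)) (matrix_time G l (length u) (m + 1))"
    if "small u" "2 \<le> m" for u m
    using prints_matrix[OF l0 _ _ that(1) small_links, of "lev (Suc k) [False, True]" "lev k [False, True]" m]
    unfolding blocks_text[OF that(2)] length_links[OF that(2)] by (simp add: l_def)
  moreover have "bounded 10 9 ?c"
    using bounded_print_row
    by (auto simp: print_matrix_def print_blocks_def print_cell_def intro!: bounded_copy bounded_emit bounded_seqs)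
  ultimately show ?thesis unfolding printable_def using is_poly2_matrix_time by blast
qed

lemma printable_zero_row:
  assumes "0 < G"
  shows "printable (\<lambda>u m. mat_token k (0\<^sub>m 1 (length u * G)))"
proof -
  define l where "l = G * length (rat_token k 0) + length (lev (Suc k) [False, True]) + length (lev k [False, True])"
  let ?c = "print_single_row G l (\<lambda>_ _ _ _. rat_token k 0) (lev (Suc k) [False, True]) (lev k [False, True])"
  have l0: "length (block_text G (\<lambda>_ _ _ _. rat_token k 0) a z g) \<le> l" for a z g
    by (rule length_block_text[of _ "length (rat_token k 0)"]) (auto simp: l_def)
  have "prints u (links m) ?c (mat_token k (0\<^sub>m 1 (length u * G))) (matrix_time G l (length u) (m + 1))"
    if "small u" "2 \<le> m" for u m
    using prints_single_row[OF l0 _ _ that(1) assms, of "lev (Suc k) [False, True]" "lev k [False, True]" "links m"]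
    unfolding zero_row_text length_links[OF that(2)] by (simp add: l_def)
  moreover have "bounded 10 9 ?c"
    using bounded_print_row by (auto simp: print_single_row_def intro!: bounded_emit)
  ultimately show ?thesis unfolding printable_def using is_poly2_matrix_time by blast
qed

definition stack_mats :: "nat \<Rightarrow> nat \<Rightarrow> (nat \<Rightarrow> nat \<Rightarrow> nat \<Rightarrow> nat \<Rightarrow> rat) \<Rightarrow> (nat \<Rightarrow> nat \<Rightarrow> nat \<Rightarrow> nat \<Rightarrow> rat) \<Rightarrow>
    nat list \<Rightarrow> nat \<Rightarrow> rat mat list" where
  "stack_mats L G e1 e2 u m =
     [blocks G m u e1, blocks G m u e2, 0\<^sub>m 1 (length u * G)] @ replicate (L - 3) (0\<^sub>m 1 1)"

lemma printable_stack_mats: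
  assumes "0 < G" "finite F" "\<And>a d g g'. e1 a d g g' \<in> F" "\<And>a d g g'. e2 a d g g' \<in> F"
  shows "printable (\<lambda>u m. lev k (enc_mats (stack_mats L G e1 e2 u m)))"
proof -
  have "(\<lambda>u m. lev k (enc_mats (stack_mats L G e1 e2 u m))) =
      (\<lambda>u m. mat_token k (blocks G m u e1) @ mat_token k (blocks G m u e2) @
        mat_token k (0\<^sub>m 1 (length u * G)) @ concat (replicate (L - 3) (mat_token k (0\<^sub>m 1 1))))"
    by (simp add: fun_eq_iff stack_mats_def lev_enc_mats)
  then show ?thesis
    by (simp only:) (intro printable_append printable_blocks[OF assms(2,3)] printable_blocks[OF assms(2,4)]
      printable_zero_row[OF assms(1)] printable_const)
qed

lemma printable_instance:
  assumes "0 < G" "finite F" "\<And>a d g g'. e1 a d g g' \<in> F" "\<And>a d g g'. e2 a d g g' \<in> F"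
    "\<And>a d g g'. e3 a d g g' \<in> F" "\<And>a d g g'. e4 a d g g' \<in> F"
  shows "printable (\<lambda>u m. lev k (enc_instance (stack_mats L G e1 e2 u m, stack_mats L G e3 e4 u m)))"
proof -
  have "(\<lambda>u m. lev k (enc_instance (stack_mats L G e1 e2 u m, stack_mats L G e3 e4 u m))) =
      (\<lambda>u m. lev (Suc k) (enc_mats (stack_mats L G e1 e2 u m)) @ lev k [False, True] @
        lev k (enc_mats (stack_mats L G e3 e4 u m)))"
    by (simp add: fun_eq_iff enc_pair_def delimit_dbl lev_append lev_dbl lev_mark[of _ "enc_mats _"])
  then show ?thesis
    by (simp only:) (intro printable_append printable_const printable_stack_mats[OF assms(1,2)] assms)
qed

lemma printable_FP:
  fixes p t :: "nat poly"
  defines "pn \<equiv> \<lambda>x :: bool list. poly p (length x)" and "tn \<equiv> \<lambda>x :: bool list. poly t (length x)"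
  assumes "printable w"
  shows "(\<lambda>x. w (layout (delimit x) (pn x) (tn x)) (length (row0 (delimit x) (pn x) (tn x)))) \<in> FP"
proof -
  obtain c T where c: "bounded 10 9 c" "is_poly2 T"
    "\<And>u m. small u \<Longrightarrow> 2 \<le> m \<Longrightarrow> prints u (links m) c (w u m) (T (length u) m)"
    using assms unfolding printable_def by blast
  define mf where "mf = (\<lambda>n. 2 * n + 4 + poly p n + poly t n)"
  define uf where "uf = (\<lambda>n. mf n * (poly t n + 1) + 1)"
  have m_eq: "length (row0 (delimit x) (pn x) (tn x)) = mf (length x)" for x
  proof -
    have "length (concat (map (\<lambda>b. [b, b]) x)) = 2 * length x" by (induction x) auto
    then show ?thesis by (simp add: row0_def delimit_def mf_def pn_def tn_def)
  qed
  have u_eq: "length (layout (delimit x) (pn x) (tn x)) = uf (length x)" for x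
    unfolding layout_def using m_eq[of x] by (simp add: uf_def mf_def tn_def algebra_simps)
  have poly_m: "is_poly mf" unfolding mf_def by (intro is_poly_add is_poly_mult is_poly_const is_poly_id is_poly_poly)
  have poly_u: "is_poly uf" unfolding uf_def by (intro is_poly_add is_poly_mult is_poly_const is_poly_poly poly_m)
  have "is_poly (\<lambda>n. T (uf n) (mf n))" using c(2) poly_u poly_m by (simp add: is_poly2_def)
  then have "is_poly (\<lambda>n. Suc (prepare_time p t n + T (uf n) (mf n)))"
    by (intro is_poly_Suc is_poly_add is_poly_prepare_time)
  then obtain q where q: "\<And>n. Suc (prepare_time p t n + T (uf n) (mf n)) = poly q n"
    unfolding is_poly_def by blast
  have "com_computes 10 9 (prepare p t ;; c)
      (\<lambda>x. w (layout (delimit x) (pn x) (tn x)) (length (row0 (delimit x) (pn x) (tn x)))) q"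
    unfolding com_computes_def
  proof (intro conjI allI)
    fix x
    let ?u = "layout (delimit x) (pn x) (tn x)" and ?m = "length (row0 (delimit x) (pn x) (tn x))"
    obtain s where s: "runs (prepare p t) (init_store x) s (prepare_time p t (length x))"
      "ready ?u (links ?m) s" "s 1 = []"
      using runs_prepare[of p t x] unfolding pn_def tn_def by blast
    have "prints ?u (links ?m) c (w ?u ?m) (T (uf (length x)) (mf (length x)))"
      using c(3)[OF small_layout, of ?m x "pn x" "tn x"] unfolding u_eq m_eq by (simp add: mf_def)
    then obtain s' where s': "runs c s s' (T (uf (length x)) (mf (length x)))"
      "s' 1 = rev (map bit_symbol (w ?u ?m)) @ s 1"
      using s(2) unfolding prints_def by blast
    show "\<exists>s'. runs (prepare p t ;; c) (init_store x) s' (poly q (length x)) \<and> s' 1 = rev (map bit_symbol (w ?u ?m))"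
      using runs_Seq[OF s(1) s'(1)] s'(2) s(3) unfolding q by (intro exI[of _ s']) simp
  qed (use c(1) bounded_prepare in simp_all)
  then show ?thesis by (rule com_computes_FP)
qed

section \<open>Hardness\<close>

text \<open>
  Setting the first entry of the first permutation matrix is an escape that is worth exactly 1 at
  best; whether a certificate exists shows in the value of the remaining solutions.
\<close>

definition gap_reduction :: "nat \<Rightarrow> rat \<Rightarrow> bool list set \<Rightarrow> (bool list \<Rightarrow> rat mat list \<times> rat mat list) \<Rightarrow> bool" where
  "gap_reduction L K A I \<longleftrightarrow> (\<forall>x. I x \<in> soblap_instances L \<and>
     (\<exists>Ps \<in> soblap_solutions (I x). soblap_value (I x) Ps = 1) \<and>
     (\<forall>Ps \<in> soblap_solutions (I x). Ps ! 0 $$ (0, 0) = 1 \<longrightarrow> soblap_value (I x) Ps \<le> 1) \<and>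
     (x \<in> A \<longrightarrow> (\<exists>Ps \<in> soblap_solutions (I x). soblap_value (I x) Ps = K)) \<and>
     (x \<notin> A \<longrightarrow> (\<forall>Ps \<in> soblap_solutions (I x). Ps ! 0 $$ (0, 0) \<noteq> 1 \<longrightarrow> soblap_value (I x) Ps \<le> 0)))"

lemma gap_reductionD:
  assumes "gap_reduction L K A I"
  shows "I x \<in> soblap_instances L" "\<exists>Ps \<in> soblap_solutions (I x). soblap_value (I x) Ps = 1"
    "Ps \<in> soblap_solutions (I x) \<Longrightarrow> Ps ! 0 $$ (0, 0) = 1 \<Longrightarrow> soblap_value (I x) Ps \<le> 1"
    "x \<in> A \<Longrightarrow> \<exists>Ps \<in> soblap_solutions (I x). soblap_value (I x) Ps = K"
    "x \<notin> A \<Longrightarrow> Ps \<in> soblap_solutions (I x) \<Longrightarrow> Ps ! 0 $$ (0, 0) \<noteq> 1 \<Longrightarrow> soblap_value (I x) Ps \<le> 0"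
  using assms unfolding gap_reduction_def by blast+

lemma gap_reduction_decides:
  assumes "gap_reduction L K A I" "Ps \<in> soblap_solutions (I x)"
    and "x \<in> A \<Longrightarrow> 1 < soblap_value (I x) Ps" "x \<notin> A \<Longrightarrow> 0 < soblap_value (I x) Ps"
  shows "x \<in> A \<longleftrightarrow> Ps ! 0 $$ (0, 0) \<noteq> 1"
  using gap_reductionD(3)[OF assms(1,2)] gap_reductionD(5)[OF assms(1) _ assms(2)] assms(3,4)
  by (meson not_le)

lemma ex_gap_reduction:
  assumes A: "A \<in> NPTIME" and L: "2 < L" and K: "1 \<le> K"
  shows "\<exists>I. gap_reduction L K A I \<and> (\<lambda>x. enc_instance (I x)) \<in> FP \<and>
    (\<forall>r. (\<lambda>x. enc_pair (enc_instance (I x)) (enc_rat r)) \<in> FP)"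
proof -
  obtain B and p :: "nat poly" where B: "B \<in> PTIME"
    and AB: "\<And>x. x \<in> A \<longleftrightarrow> (\<exists>y. length y \<le> poly p (length x) \<and> enc_pair x y \<in> B)"
    using A unfolding NPTIME_def by blast
  have "(\<lambda>z. [z \<in> B]) \<in> FP" using B by (simp add: PTIME_def)
  from FP_com_computes[OF this] obtain k S c q where "com_computes k S c (\<lambda>z. [z \<in> B]) q"
    by blast
  then have k: "2 \<le> k" and S: "3 \<le> S" and c: "bounded k S c"
    and run: "\<And>z. \<exists>s'. runs c (init_store z) s' (poly q (length z)) \<and> s' 1 = [bit_symbol (z \<in> B)]"
    by (auto simp: com_computes_def)
  \<comment> \<open>The code of a pair \<open>x\<close>, \<open>y\<close> has at most
    \<open>2 * length x + 2 + poly p (length x)\<close> bits, and the verifier takes time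
    \<open>q\<close> in that length.\<close>
  define t where "t = pcompose q ([:2, 2:] + p)"
  let ?X = "tiles c k S"
  define G where "G = card ?X + 1"
  define pn where "pn = (\<lambda>x :: bool list. poly p (length x))"
  define tn where "tn = (\<lambda>x :: bool list. poly t (length x))"
  define u where "u = (\<lambda>x. layout (delimit x) (pn x) (tn x))"
  define m where "m = (\<lambda>x. length (row0 (delimit x) (pn x) (tn x)))"
  let ?ok = "joker_ok c ?X" and ?R1 = "joker_rel hor ?X" and ?R2 = "joker_rel ver ?X"
  define e4 where "e4 = conflict_entry K ?ok ?R1 ?R2"
  define I where "I = (\<lambda>x. (stack_mats L G (choice_entry K) slot_entry (u x) (m x),
    stack_mats L G unit_entry e4 (u x) (m x)))"
  have len: "length (delimit x) = 2 * length x + 2" for x by (induction x) (auto simp: delimit_def)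
  have red: "gap_reduction L K A I"
    unfolding gap_reduction_def
  proof (intro allI)
    fix x
    interpret computation c k S "delimit x" "pn x" "tn x"
      by unfold_locales (use k S c in \<open>auto simp: delimit_def\<close>)
    have u_eq: "u x = layout (delimit x) (pn x) (tn x)" by (simp add: u_def)
    have first: "7 \<le> u x ! i \<longleftrightarrow> i = 0" if i: "i < length (u x)" for i
    proof -
      consider "i = 0" | "0 < i" "i < m x" | "m x \<le> i" "i < m x * (tn x + 1)" | "i = m x * (tn x + 1)"
      proof -
        have "i \<le> m x * (tn x + 1)" using i length_u by (simp add: u_eq m_def)
        then show thesis using that by fastforce
      qed
      then show ?thesis
      proof cases
        case 1
        then show ?thesis using u_first by (simp add: u_eq bit_symbol_def)
      next
        case 2
        then show ?thesis using u_row0[of i] row0_cases[of i] by (auto simp: u_eq m_def bit_symbol_def)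
      next
        case 3
        then show ?thesis using u_mid[of i] computation.m[OF computation_axioms] by (auto simp: u_eq m_def)
      next
        case 4
        then show ?thesis using u_last computation.m[OF computation_axioms] by (auto simp: u_eq m_def)
      qed
    qed
    interpret gap G "m x" L "u x" ?ok ?R1 ?R2 K
      by unfold_locales (use L K first length_u in \<open>auto simp: G_def m_def row0_def u_eq\<close>)
    have I_eq: "I x = (WA, WB)" by (simp add: I_def WA_def WB_def stack_mats_def e4_def)
    \<comment> \<open>The height of the grid must not depend on \<open>y\<close>, so one time bound
      serves all admissible certificates.\<close>
    have "\<exists>s'. runs c (init_store (delimit x @ y)) s' (tn x) \<and> s' 1 = [bit_symbol (delimit x @ y \<in> B)]"
      if "length y \<le> pn x" for y
    proof -
      have "length (delimit x @ y) \<le> 2 * length x + 2 + poly p (length x)" using that len by (simp add: pn_def)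
      also have "2 * length x + 2 + poly p (length x) = poly ([:2, 2:] + p) (length x)" by simp
      finally have "poly q (length (delimit x @ y)) \<le> tn x"
        unfolding tn_def t_def poly_pcompose by (rule poly_mono_nat)
      then show ?thesis using run[of "delimit x @ y"] runs_weaken by blast
    qed
    from tiling_iff[OF this] have tiling: "(\<exists>\<sigma>. tiling G (m x) (u x) ?ok ?R1 ?R2 \<sigma> \<and> \<sigma> 0 \<noteq> 0) \<longleftrightarrow> x \<in> A"
      unfolding AB enc_pair_def G_def m_def u_eq pn_def by blast
    have "tiling G (m x) (u x) ?ok ?R1 ?R2 (\<lambda>_. 0)" by (rule joker_tiling) (simp add: G_def)
    from tiling_value[OF this] have "\<exists>Ps \<in> soblap_solutions (I x). soblap_value (I x) Ps = 1"
      unfolding I_eq by simp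
    moreover have "\<exists>Ps \<in> soblap_solutions (I x). soblap_value (I x) Ps = K" if xA: "x \<in> A"
    proof -
      obtain \<sigma> where "tiling G (m x) (u x) ?ok ?R1 ?R2 \<sigma>" "\<sigma> 0 \<noteq> 0" using tiling xA by blast
      then show ?thesis using tiling_value[of \<sigma>] unfolding I_eq by simp
    qed
    moreover have "\<forall>Ps \<in> soblap_solutions (I x). Ps ! 0 $$ (0, 0) \<noteq> 1 \<longrightarrow> soblap_value (I x) Ps \<le> 0" if "x \<notin> A"
      using that tiling value_no_escape unfolding I_eq by (meson not_le)
    ultimately show "I x \<in> soblap_instances L \<and>
       (\<exists>Ps \<in> soblap_solutions (I x). soblap_value (I x) Ps = 1) \<and>
       (\<forall>Ps \<in> soblap_solutions (I x). Ps ! 0 $$ (0, 0) = 1 \<longrightarrow> soblap_value (I x) Ps \<le> 1) \<and>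
       (x \<in> A \<longrightarrow> (\<exists>Ps \<in> soblap_solutions (I x). soblap_value (I x) Ps = K)) \<and>
       (x \<notin> A \<longrightarrow> (\<forall>Ps \<in> soblap_solutions (I x). Ps ! 0 $$ (0, 0) \<noteq> 1 \<longrightarrow> soblap_value (I x) Ps \<le> 0))"
      using instance_in value_escape unfolding I_eq by blast
  qed
  have G: "0 < G" by (simp add: G_def)
  have F: "finite {0, 1, K, - K}" "choice_entry K a d g g' \<in> {0, 1, K, - K}" "slot_entry a d g g' \<in> {0, 1, K, - K}"
    "unit_entry a d g g' \<in> {0, 1, K, - K}" "e4 a d g g' \<in> {0, 1, K, - K}" for a d g g'
    by (simp_all add: choice_entry_def slot_entry_def unit_entry_def e4_def conflict_entry_def)
  note pr = printable_instance[OF G F, where L = L]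
  have "(\<lambda>x. enc_instance (I x)) \<in> FP"
    using printable_FP[OF pr[where k = 0], where p = p and t = t] by (simp add: I_def u_def m_def pn_def tn_def)
  \<comment> \<open>Here the instance is the delimited component of a pair, so its text is doubled
    once more: \<open>k = 1\<close>.\<close>
  moreover have "(\<lambda>x. enc_pair (enc_instance (I x)) (enc_rat r)) \<in> FP" for r
    using printable_FP[OF printable_append[OF pr[where k = 1] printable_const[of "[False, True] @ enc_rat r"]],
        where p = p and t = t]
    by (simp add: I_def u_def m_def pn_def tn_def enc_pair_def delimit_dbl lev_dbl[of 0, symmetric] del: enc_instance.simps)
  ultimately show ?thesis using red by blast
qed

section \<open>The position of the deciding bit\<close>

lemma delimit_nth: "i < length z \<Longrightarrow> delimit z ! (2 * i) = z ! i"
proof (induction z arbitrary: i)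
  case (Cons b z)
  then show ?case by (cases i) (auto simp: delimit_def)
qed simp

lemma length_delimit: "length (delimit z) = 2 * length z + 2"
  by (induction z) (auto simp: delimit_def)

lemma enc_list_nth:
  assumes "i < length (e x)"
  shows "enc_list e (x # xs) ! (2 * i) = e x ! i" "2 * i < length (enc_list e (x # xs))"
  using assms delimit_nth[OF assms] by (simp_all add: enc_list_Cons enc_pair_def nth_append length_delimit)

text \<open>The doubled sign bit occupies the positions 0 and 1. Position 2 then holds the first bit
  of the end mark \<open>01\<close> in the code of 0, but the only digit of the numerator in the
  code of 1.\<close>

lemma enc_rat_bit:
  assumes "r = 0 \<or> r = 1"
  shows "enc_rat r ! 2 \<longleftrightarrow> r = 1" "2 < length (enc_rat r)"
proof -
  have 1: "enc_nat 1 = [True]" "enc_nat 0 = []" by (subst enc_nat.simps; simp add: enc_nat.simps[of 0])+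
  have "quotient_of 0 = (0, 1)" "quotient_of 1 = (1, 1)" by simp_all
  then have "enc_rat 0 = enc_pair [False] [False, True]" "enc_rat 1 = enc_pair [False, True] [False, True]"
    using 1 by (simp_all add: enc_rat_def enc_int_def)
  then show "enc_rat r ! 2 \<longleftrightarrow> r = 1" "2 < length (enc_rat r)"
    using assms by (auto simp: enc_pair_def delimit_def)
qed

text \<open>The first entry is the first item at each of three nested delimited lists, and each of
  them doubles positions: bit 2 of its code moves to 4, 8 and 16.\<close>

lemma bit_clear_solution:
  assumes I: "I \<in> soblap_instances L" "2 < L" and Ps: "Ps \<in> soblap_solutions I"
  shows "bit_clear 16 (enc_mats Ps) \<longleftrightarrow> Ps ! 0 $$ (0, 0) \<noteq> 1"
proof -
  obtain WA WB where W: "I = (WA, WB)" by fastforce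
  obtain d :: "nat \<Rightarrow> nat" where d: "length WB = L" "\<forall>l \<le> L. 0 < d l" "\<forall>k < L. WB ! k \<in> carrier_mat (d (Suc k)) (d k)"
    using I(1) by (auto simp: soblap_instances_def W)
  have "WB ! 0 \<in> carrier_mat (d (Suc 0)) (d 0)" using d(3) I(2) by simp
  then have n: "dim_row (WB ! 0) = d 1" "0 < d 1" using d(2) I(2) by auto
  have "\<forall>k < L - 1. Ps ! k \<in> perm_matrices (dim_row (WB ! k))" "length Ps = L - 1"
    using Ps d(1) by (auto simp: W)
  then have "Ps ! 0 \<in> perm_matrices (d 1)" "length Ps = L - 1" using I(2) n by (metis zero_less_diff less_trans one_less_numeral_iff semiring_norm(76))+
  then obtain \<pi> Qs where Qs: "Ps = perm_mat (d 1) \<pi> # Qs"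
    unfolding perm_matrices_iff using I(2) by (cases Ps) auto
  let ?P = "perm_mat (d 1) \<pi> :: rat mat" and ?r = "perm_mat (d 1) \<pi> $$ (0, 0) :: rat"
  have r: "?r = 0 \<or> ?r = 1" using n by (auto simp: perm_mat_def)
  have "[0..<d 1] = 0 # [1..<d 1]" using n(2) by (simp add: upt_conv_Cons)
  then obtain row rows where rows: "mat_to_list ?P = (?r # row) # rows"
    by (auto simp: mat_to_list_def perm_mat_def)
  have 1: "enc_list enc_rat (?r # row) ! 4 = enc_rat ?r ! 2" "4 < length (enc_list enc_rat (?r # row))"
    using enc_list_nth[of 2 enc_rat ?r row] enc_rat_bit[OF r] by simp_all
  have 2: "enc_mat ?P ! 8 = enc_rat ?r ! 2" "8 < length (enc_mat ?P)"
    unfolding enc_mat_def rows using enc_list_nth[of 4 "enc_list enc_rat" "?r # row" rows] 1 by simp_all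
  have 3: "enc_mats Ps ! 16 = enc_rat ?r ! 2" "16 < length (enc_mats Ps)"
    unfolding enc_mats_def Qs using enc_list_nth[of 8 enc_mat ?P Qs] 2 by simp_all
  show ?thesis using 3 enc_rat_bit[OF r] by (simp add: bit_clear_def Qs)
qed

lemma gap_reduction_values:
  assumes "gap_reduction L K A I" "1 \<le> K"
  shows "1 \<le> soblap_opt (I x)" "x \<in> A \<Longrightarrow> K \<le> soblap_opt (I x)"
proof -
  have fin: "finite (soblap_value (I x) ` soblap_solutions (I x))" by (simp add: finite_soblap_solutions)
  show "1 \<le> soblap_opt (I x)" "x \<in> A \<Longrightarrow> K \<le> soblap_opt (I x)"
    using assms Max_ge[OF fin] unfolding gap_reduction_def soblap_opt_def by (metis image_eqI)+
qed

lemma soblap_argmax_nonempty: "soblap_solutions I \<noteq> {} \<Longrightarrow> \<exists>Ps. Ps \<in> soblap_argmax I"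
  using ex_is_arg_min_if_finite[OF finite_soblap_solutions, of I "\<lambda>Ps. - soblap_value I Ps"]
  by (auto simp: soblap_argmax_def is_arg_max_def is_arg_min_def)

theorem lemma1:
  fixes L :: nat
  assumes "L > 2"
  shows "NP_hard (SOBLAP_decision L)
       \<and> NP_hard_search (SOBLAP_search L)
       \<and> (PTIME \<noteq> NPTIME \<longrightarrow>
            \<not> (\<exists>c > 0. \<exists>alg \<in> FP. SOBLAP_approximates L c alg))"
proof (intro conjI impI)
  show "NP_hard (SOBLAP_decision L)"
    unfolding NP_hard_def
  proof
    fix A assume "A \<in> NPTIME"
    \<comment> \<open>With \<open>K = 2\<close> the threshold 2 separates the cases: if
      \<open>x \<notin> A\<close>, solutions with the escape have value at most 1 and all others at
      most 0.\<close>
    from ex_gap_reduction[OF this assms, of 2] obtain I where I: "gap_reduction L 2 A I"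
      "(\<lambda>x. enc_pair (enc_instance (I x)) (enc_rat 2)) \<in> FP" by auto
    have dec: "x \<in> A \<longleftrightarrow> enc_pair (enc_instance (I x)) (enc_rat 2) \<in> SOBLAP_decision L" for x
    proof -
      have Ix: "I x \<in> soblap_instances L" using I(1) by (simp add: gap_reduction_def)
      have "enc_pair (enc_instance (I x)) (enc_rat 2) \<in> SOBLAP_decision L \<longleftrightarrow>
          (\<exists>Ps \<in> soblap_solutions (I x). 2 \<le> soblap_value (I x) Ps)"
      proof
        assume "enc_pair (enc_instance (I x)) (enc_rat 2) \<in> SOBLAP_decision L"
        then obtain J r where J: "enc_pair (enc_instance (I x)) (enc_rat 2) = enc_pair (enc_instance J) (enc_rat r)"
          "\<exists>Ps \<in> soblap_solutions J. r \<le> soblap_value J Ps"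
          unfolding SOBLAP_decision_def by blast
        then have "I x = J" "r = 2"
          using enc_instance_inject[OF Ix] injD[OF inj_enc_rat] unfolding enc_pair_inject by metis+
        then show "\<exists>Ps \<in> soblap_solutions (I x). 2 \<le> soblap_value (I x) Ps" using J(2) by simp
      next
        assume "\<exists>Ps \<in> soblap_solutions (I x). 2 \<le> soblap_value (I x) Ps"
        then show "enc_pair (enc_instance (I x)) (enc_rat 2) \<in> SOBLAP_decision L"
          using Ix unfolding SOBLAP_decision_def by blast
      qed
      also have "\<dots> \<longleftrightarrow> x \<in> A"
      proof (cases "x \<in> A")
        case True
        then show ?thesis using gap_reductionD(4)[OF I(1), of x] by (metis order.refl)
      next
        case False
        have "soblap_value (I x) Ps \<le> 1" if "Ps \<in> soblap_solutions (I x)" for Ps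
          using gap_reductionD(3)[OF I(1) that] gap_reductionD(5)[OF I(1) False that]
          by (meson order_trans zero_le_one)
        moreover have "\<not> (2 :: rat) \<le> 1" by simp
        ultimately show ?thesis using False by (meson order_trans)
      qed
      finally show ?thesis by simp
    qed
    show "\<exists>f \<in> FP. \<forall>x. x \<in> A \<longleftrightarrow> f x \<in> SOBLAP_decision L"
      by (rule bexI[OF _ I(2)]) (rule allI, rule dec)
  qed
  show "NP_hard_search (SOBLAP_search L)"
    unfolding NP_hard_search_def
  proof
    fix A assume "A \<in> NPTIME"
    from ex_gap_reduction[OF this assms, of 2] obtain I where I: "gap_reduction L 2 A I"
      "(\<lambda>x. enc_instance (I x)) \<in> FP" by auto
    define B where "B = {z. bit_clear 16 (snd (unpair z))}"
    have B: "B \<in> PTIME"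
      using FP_comp[OF snd_unpair_FP bit_clear_FP[of 16]] by (simp add: PTIME_def B_def comp_def)
    have 1: "\<exists>y. (enc_instance (I x), y) \<in> SOBLAP_search L" for x
    proof -
      have "I x \<in> soblap_instances L" "soblap_solutions (I x) \<noteq> {}"
        using gap_reductionD(1,2)[OF I(1), of x] by blast+
      moreover from this(2) obtain Ps where "Ps \<in> soblap_argmax (I x)"
        using soblap_argmax_nonempty by blast
      ultimately show ?thesis unfolding SOBLAP_search_def by blast
    qed
    have 2: "x \<in> A \<longleftrightarrow> enc_pair x y \<in> B" if xy: "(enc_instance (I x), y) \<in> SOBLAP_search L" for x y
    proof -
      have Ix: "I x \<in> soblap_instances L" using I(1) by (simp add: gap_reduction_def)
      obtain J Ps where "enc_instance (I x) = enc_instance J" "y = enc_mats Ps" "Ps \<in> soblap_argmax J"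
        using xy unfolding SOBLAP_search_def by blast
      then have Ps: "y = enc_mats Ps" "Ps \<in> soblap_argmax (I x)"
        using enc_instance_inject[OF Ix] by metis+
      have sol: "Ps \<in> soblap_solutions (I x)"
        and max: "\<And>Qs. Qs \<in> soblap_solutions (I x) \<Longrightarrow> soblap_value (I x) Qs \<le> soblap_value (I x) Ps"
        using Ps(2) by (auto simp: soblap_argmax_def is_arg_max_linorder)
      have "x \<in> A \<longleftrightarrow> Ps ! 0 $$ (0, 0) \<noteq> 1"
      \<comment> \<open>An optimal solution has value at least 2 if \<open>x \<in> A\<close>, which
        rules out the escape, and at least 1 otherwise, which requires it.\<close>
      proof (rule gap_reduction_decides[OF I(1) sol])
        assume "x \<in> A"
        then obtain Qs where "Qs \<in> soblap_solutions (I x)" "soblap_value (I x) Qs = 2"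
          using gap_reductionD(4)[OF I(1)] by blast
        then show "1 < soblap_value (I x) Ps" using max[of Qs] by simp
      next
        obtain Qs where "Qs \<in> soblap_solutions (I x)" "soblap_value (I x) Qs = 1"
          using gap_reductionD(2)[OF I(1)] by blast
        then show "0 < soblap_value (I x) Ps" using max[of Qs] by simp
      qed
      then show ?thesis using bit_clear_solution[OF Ix assms sol] by (simp add: B_def Ps(1))
    qed
    show "\<exists>f \<in> FP. \<exists>B \<in> PTIME. \<forall>x. (\<exists>y. (f x, y) \<in> SOBLAP_search L) \<and>
        (\<forall>y. (f x, y) \<in> SOBLAP_search L \<longrightarrow> (x \<in> A \<longleftrightarrow> enc_pair x y \<in> B))"
      by (rule bexI[OF _ I(2)], rule bexI[OF _ B]) (intro allI conjI impI 1 2)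
  qed
  assume neq: "PTIME \<noteq> NPTIME"
  show "\<not> (\<exists>c > 0. \<exists>alg \<in> FP. SOBLAP_approximates L c alg)"
  proof
    assume "\<exists>c > 0. \<exists>alg \<in> FP. SOBLAP_approximates L c alg"
    then obtain c alg where c: "0 < c" "alg \<in> FP" "SOBLAP_approximates L c alg" by blast
    \<comment> \<open>\<open>K\<close> has to exceed \<open>1 / c\<close>: then a solution within
      factor \<open>c\<close> of an optimum of at least \<open>K\<close> has value above 1 and
      cannot use the escape.\<close>
    obtain k :: nat where k: "1 / c < real k" using reals_Archimedean2 by blast
    define K :: rat where "K = of_nat (k + 1)"
    have K: "1 \<le> K" "1 < c * of_rat K"
    proof -
      have "of_rat K = real k + 1" by (simp add: K_def of_rat_add)
      moreover have "1 < c * real k" using k c(1) by (simp add: divide_less_eq mult.commute)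
      ultimately show "1 < c * of_rat K" using c(1) by (simp add: algebra_simps)
    qed (simp add: K_def)
    have "NPTIME \<subseteq> PTIME"
    proof
      fix A assume "A \<in> NPTIME"
      from ex_gap_reduction[OF this assms K(1)] obtain I where I: "gap_reduction L K A I"
        "(\<lambda>x. enc_instance (I x)) \<in> FP" by blast
      have "x \<in> A \<longleftrightarrow> bit_clear 16 (alg (enc_instance (I x)))" for x
      proof -
        have Ix: "I x \<in> soblap_instances L" using I(1) by (simp add: gap_reduction_def)
        note opt = gap_reduction_values[OF I(1) K(1), of x]
        have "0 < soblap_opt (I x)" using opt(1) by simp
        then obtain Ps where Ps: "Ps \<in> soblap_solutions (I x)" "alg (enc_instance (I x)) = enc_mats Ps"
          "c * of_rat (soblap_opt (I x)) \<le> of_rat (soblap_value (I x) Ps)"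
          using c(3) Ix unfolding SOBLAP_approximates_def by blast
        have "x \<in> A \<longleftrightarrow> Ps ! 0 $$ (0, 0) \<noteq> 1"
        proof (rule gap_reduction_decides[OF I(1) Ps(1)])
          assume "x \<in> A"
          then have "(of_rat K :: real) \<le> of_rat (soblap_opt (I x))" using opt(2) by (simp add: of_rat_less_eq)
          then have "c * of_rat K \<le> c * of_rat (soblap_opt (I x))" using c(1) by simp
          then have "(1 :: real) < of_rat (soblap_value (I x) Ps)" using K(2) Ps(3) by linarith
          then show "1 < soblap_value (I x) Ps" by simp
        next
          \<comment> \<open>For \<open>x \<notin> A\<close> a positive value is enough to force the
            escape. The optimum is at least 1 by the joker, so the guarantee gives a value of at
            least \<open>c\<close>.\<close>
          have "(0 :: real) < of_rat (soblap_opt (I x))" using opt(1) by simp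
          then have "(0 :: real) < of_rat (soblap_value (I x) Ps)" using c(1) Ps(3)
            by (meson less_le_trans mult_pos_pos)
          then show "0 < soblap_value (I x) Ps" by simp
        qed
        then show ?thesis using bit_clear_solution[OF Ix assms Ps(1)] Ps(2) by simp
      qed
      then have "(\<lambda>x. [x \<in> A]) = (\<lambda>y. [bit_clear 16 y]) \<circ> (alg \<circ> (\<lambda>x. enc_instance (I x)))"
        by (simp add: fun_eq_iff)
      then show "A \<in> PTIME" unfolding PTIME_def using FP_comp[OF FP_comp[OF I(2) c(2)] bit_clear_FP] by simp
    qed
    with PTIME_subset_NPTIME neq show False by blast
  qed
qed

end
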